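(* Let $l\neq 2$ be a prime number and let $\mathfrak H_{l^3}$ be the Heisenberg group, i.e. the non-commutative group of order $l^3$ and exponent $l$. Then for every local field $K$ whose residue field is finite of characteristic $p\neq l$, there is no finite Galois extension $L$ of $K$ with $\mathrm{Gal}(L|K)$ isomorphic to $\mathfrak H_{l^3}$.
   Context: A local field is a field complete for a discrete valuation with finite residue field. For an odd prime $l$ there are, up to isomorphism, exactly two non-commutative groups of order $l^3$, one of exponent $l$ (denoted $\mathfrak H_{l^3}$) and one of exponent $l^2$. *)

theory Defs
  imports "HOL-Algebra.Algebra" "HOL-Computational_Algebra.Primes"
begin

section \<open>Local fields\<close>

text \<open>
  The valuation is normalised, i.e. \<open>v\<close> maps the multiplicative group onto the integers.  The
  convention that \<open>v\<close> is infinite at zero is not encoded in the type: the value of the function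
  \<open>v\<close> at zero is arbitrary and never used; see \<open>val_ge\<close>.
\<close>

locale discrete_valuation = field K for K (structure) +
  fixes v :: "'a \<Rightarrow> int"
  assumes val_mult: "\<lbrakk>x \<in> carrier K - {\<zero>}; y \<in> carrier K - {\<zero>}\<rbrakk> \<Longrightarrow> v (x \<otimes> y) = v x + v y"
    and val_add: "\<lbrakk>x \<in> carrier K - {\<zero>}; y \<in> carrier K - {\<zero>}; x \<oplus> y \<noteq> \<zero>\<rbrakk>
      \<Longrightarrow> min (v x) (v y) \<le> v (x \<oplus> y)"
    and val_surj: "v ` (carrier K - {\<zero>}) = UNIV"

definition val_ge :: "('a, 'm) ring_scheme \<Rightarrow> ('a \<Rightarrow> int) \<Rightarrow> int \<Rightarrow> 'a \<Rightarrow> bool" where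
  "val_ge K v n x \<longleftrightarrow> x = \<zero>\<^bsub>K\<^esub> \<or> n \<le> v x"

definition val_Cauchy :: "('a, 'm) ring_scheme \<Rightarrow> ('a \<Rightarrow> int) \<Rightarrow> (nat \<Rightarrow> 'a) \<Rightarrow> bool" where
  "val_Cauchy K v s \<longleftrightarrow> (\<forall>N. \<exists>M. \<forall>i\<ge>M. \<forall>j\<ge>M. val_ge K v N (s i \<ominus>\<^bsub>K\<^esub> s j))"

definition val_tendsto :: "('a, 'm) ring_scheme \<Rightarrow> ('a \<Rightarrow> int) \<Rightarrow> (nat \<Rightarrow> 'a) \<Rightarrow> 'a \<Rightarrow> bool" where
  "val_tendsto K v s a \<longleftrightarrow> (\<forall>N. \<exists>M. \<forall>i\<ge>M. val_ge K v N (s i \<ominus>\<^bsub>K\<^esub> a))"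

definition valuation_ring :: "('a, 'm) ring_scheme \<Rightarrow> ('a \<Rightarrow> int) \<Rightarrow> ('a, 'm) ring_scheme" where
  "valuation_ring K v = K\<lparr>carrier := {x \<in> carrier K. val_ge K v 0 x}\<rparr>"

definition valuation_ideal :: "('a, 'm) ring_scheme \<Rightarrow> ('a \<Rightarrow> int) \<Rightarrow> 'a set" where
  "valuation_ideal K v = {x \<in> carrier K. val_ge K v 1 x}"

definition residue_field :: "('a, 'm) ring_scheme \<Rightarrow> ('a \<Rightarrow> int) \<Rightarrow> 'a set ring" where
  "residue_field K v = valuation_ring K v Quot valuation_ideal K v"

locale local_field = discrete_valuation +
  assumes complete: "\<lbrakk>range s \<subseteq> carrier K; val_Cauchy K v s\<rbrakk> \<Longrightarrow> \<exists>a\<in>carrier K. val_tendsto K v s a"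
    and finite_residue_field: "finite (carrier (residue_field K v))"

text \<open>\<open>group.ord\<close> is \<open>0\<close> for elements of infinite order, in accordance with characteristic zero.\<close>

definition ring_characteristic :: "('a, 'm) ring_scheme \<Rightarrow> nat" where
  "ring_characteristic R = group.ord (add_monoid R) \<one>\<^bsub>R\<^esub>"

section \<open>Finite Galois extensions\<close>

text \<open>
  An extension of \<open>K\<close> is a field \<open>L\<close> with a homomorphism \<open>\<phi>\<close> from \<open>K\<close> to \<open>L\<close>, so \<open>K\<close> is
  identified with \<open>\<phi> ` carrier K\<close>.  As in \<open>BijGroup\<close>, automorphisms are extensional functions on
  the carrier, and the multiplication is composition.
\<close>

definition Gal_group ::
  "('a, 'm) ring_scheme \<Rightarrow> ('b, 'n) ring_scheme \<Rightarrow> ('a \<Rightarrow> 'b) \<Rightarrow> ('b \<Rightarrow> 'b) monoid" where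
  "Gal_group K L \<phi> = (BijGroup (carrier L))
     \<lparr>carrier := {\<sigma> \<in> Bij (carrier L). \<sigma> \<in> ring_hom L L \<and> (\<forall>a\<in>carrier K. \<sigma> (\<phi> a) = \<phi> a)}\<rparr>"

text \<open>
  A finite extension is Galois if the field of elements of \<open>L\<close> fixed by all automorphisms of \<open>L\<close>
  over \<open>K\<close> is \<open>K\<close> (Artin's definition).
\<close>

definition finite_galois_extension ::
  "('a, 'm) ring_scheme \<Rightarrow> ('b, 'n) ring_scheme \<Rightarrow> ('a \<Rightarrow> 'b) \<Rightarrow> bool" where
  "finite_galois_extension K L \<phi> \<longleftrightarrow>
     field K \<and> field L \<and> \<phi> \<in> ring_hom K L \<and>
     ring.finite_dimension L (\<phi> ` carrier K) (carrier L) \<and>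
     {x \<in> carrier L. \<forall>\<sigma>\<in>carrier (Gal_group K L \<phi>). \<sigma> x = x} = \<phi> ` carrier K"

section \<open>The Heisenberg group of order \<open>l\<^sup>3\<close>\<close>

definition group_exponent :: "('a, 'm) monoid_scheme \<Rightarrow> nat" where
  "group_exponent G = (LEAST n. 0 < n \<and> (\<forall>x\<in>carrier G. x [^]\<^bsub>G\<^esub> n = \<one>\<^bsub>G\<^esub>))"

text \<open>For an odd prime \<open>l\<close> these conditions determine the group up to isomorphism.\<close>

definition heisenberg_group :: "nat \<Rightarrow> ('a, 'm) monoid_scheme \<Rightarrow> bool" where
  "heisenberg_group l H \<longleftrightarrow>
     group H \<and> \<not> comm_group H \<and> order H = l ^ 3 \<and> group_exponent H = l"

end

(*
  A Galois group G of order a power of l and exponent l is commutative as soon as l is odd and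
  prime to the residue characteristic.  The valuation extends to a G-invariant discrete valuation
  of L with finite residue field k.  Let g generate the group of units of k, of order M, and
  let pi be a uniformizer.  An element of G acts on L^* modulo the principal units by
  g |-> g^s, pi |-> pi g^x, and exponent l forces s^l = 1 and x (1 + s + ... + s^(l-1)) = 0
  modulo M.  For odd l the sum is l times a unit modulo l^a whenever s = 1 modulo l, so these
  relations kill the l-part of the exponent y (s - 1) - x (t - 1) of a commutator, and since the
  commutator has order dividing l, it is trivial modulo principal units.  An automorphism of order
  prime to the residue characteristic with this property is the identity.

  The valuation of L is v o N, with N the norm.  L contains a G-stable order R which is compact
  in the pi-adic topology, and compactness bounds v o N on R - pi R.  Hence all x with v (N x) >= 0
  lie in one lattice pi^(-C) R; comparing powers of x + y with this lattice gives the ultrametric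
  inequality.
*)
theory Submission
  imports Defs "HOL-Number_Theory.Number_Theory"
begin

section \<open>Discrete valuations\<close>

text \<open>For \<open>l = 2\<close> and \<open>s = -1\<close> the sum \<open>1 + s\<close> vanishes
  and leaves \<open>x\<close> unrestricted. For odd \<open>l\<close>, Fermat turns
  \<open>s ^ l = 1\<close> into \<open>s = 1\<close> modulo \<open>l\<close>, and the linear terms
  of the sum add up to a multiple of \<open>l^2\<close>. When \<open>a > 0\<close>, the factor
  \<open>x\<close> of \<open>x (t - 1)\<close> contributes \<open>l^(a-1)\<close> and
  \<open>t - 1\<close> the missing \<open>l\<close>. That \<open>l\<close> is prime to the residue
  characteristic enters twice: multiplication by \<open>l\<close> preserves valuations, and the
  order of \<open>G\<close>, which is the trace of one, does not vanish in \<open>L\<close>. The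
  second fact shows that elements of \<open>R\<close> in the base field are integral, so that norms
  from \<open>R\<close> are integral. The ultrametric inequality for the norm valuation is often
  drawn from Hensel's lemma; here a lattice replaces it. Its completeness is phrased by digit
  expansions in powers of the uniformizer, because these pass to a span coordinate by coordinate,
  without a choice of basis. The values of \<open>v o N\<close> may fill only a proper subgroup of
  the integers, hence a final division by its generator.\<close>

lemma (in domain) pow_nonzero: "\<lbrakk>x \<in> carrier R; x \<noteq> \<zero>\<rbrakk> \<Longrightarrow> x [^] (n::nat) \<noteq> \<zero>"
  by (induction n) (auto simp: integral_iff)

context discrete_valuation
begin

lemma val_one: "v \<one> = 0"
  using val_mult[of \<one> \<one>] by simp

lemma val_pow: "\<lbrakk>x \<in> carrier K; x \<noteq> \<zero>\<rbrakk> \<Longrightarrow> v (x [^] (n::nat)) = int n * v x"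
proof (induction n)
  case (Suc n)
  then have "x [^] n \<noteq> \<zero>" using pow_nonzero by blast
  with Suc show ?case
    by (simp add: val_mult algebra_simps)
qed (simp add: val_one)

lemma val_inv:
  assumes "x \<in> carrier K" "x \<noteq> \<zero>"
  shows "v (inv x) = - v x"
proof -
  have "inv x \<in> carrier K" "x \<otimes> inv x = \<one>" using assms field_Units by auto
  moreover from this have "inv x \<noteq> \<zero>" using assms by auto
  ultimately have "v x + v (inv x) = 0" using val_mult[of x "inv x"] assms val_one by auto
  then show ?thesis by simp
qed

lemma val_minus:
  assumes x: "x \<in> carrier K"
  shows "v (\<ominus> x) = v x"
proof (cases "x = \<zero>")
  case False
  have "v (\<ominus> \<one>) + v (\<ominus> \<one>) = v (\<ominus> \<one> \<otimes> \<ominus> \<one>)"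
    by (subst val_mult) auto
  also have "\<ominus> \<one> \<otimes> \<ominus> \<one> = \<one>" by algebra
  finally have "v (\<ominus> \<one>) = 0" by (simp add: val_one)
  moreover have "\<ominus> x = \<ominus> \<one> \<otimes> x" using x by algebra
  moreover have "v (\<ominus> \<one> \<otimes> x) = v (\<ominus> \<one>) + v x"
    using x False by (intro val_mult) auto
  ultimately show ?thesis by simp
qed simp

lemma val_ge_zero [simp]: "val_ge K v n \<zero>"
  by (simp add: val_ge_def)

lemma val_ge_mono: "\<lbrakk>val_ge K v n x; m \<le> n\<rbrakk> \<Longrightarrow> val_ge K v m x"
  by (auto simp: val_ge_def)

lemma val_ge_add:
  assumes "x \<in> carrier K" "y \<in> carrier K" "val_ge K v n x" "val_ge K v n y"
  shows "val_ge K v n (x \<oplus> y)"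
proof (cases "x = \<zero> \<or> y = \<zero> \<or> x \<oplus> y = \<zero>")
  case False
  with assms val_add[of x y] show ?thesis by (auto simp: val_ge_def)
qed (use assms in \<open>auto simp: val_ge_def\<close>)

lemma val_ge_minus: "\<lbrakk>x \<in> carrier K; val_ge K v n x\<rbrakk> \<Longrightarrow> val_ge K v n (\<ominus> x)"
  by (auto simp: val_ge_def val_minus)

lemma val_ge_diff:
  "\<lbrakk>x \<in> carrier K; y \<in> carrier K; val_ge K v n x; val_ge K v n y\<rbrakk> \<Longrightarrow> val_ge K v n (x \<ominus> y)"
  by (simp add: a_minus_def val_ge_add val_ge_minus)

lemma val_ge_mult:
  assumes "x \<in> carrier K" "y \<in> carrier K" "val_ge K v n x" "val_ge K v m y"
  shows "val_ge K v (n + m) (x \<otimes> y)"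
proof (cases "x = \<zero> \<or> y = \<zero>")
  case False
  with assms val_mult[of x y] show ?thesis by (auto simp: val_ge_def)
qed (use assms in auto)

lemma val_ge_mult_cancel:
  assumes "x \<in> carrier K" "y \<in> carrier K" "x \<noteq> \<zero>" "val_ge K v (v x + n) (x \<otimes> y)"
  shows "val_ge K v n y"
proof (cases "y = \<zero>")
  case False
  with assms val_mult[of x y] integral[of x y] show ?thesis by (auto simp: val_ge_def)
qed simp

lemma val_ge_nat: "val_ge K v 0 ([(n::nat)] \<cdot> \<one>)"
proof (induction n)
  case (Suc n)
  then show ?case by (simp add: val_ge_add val_ge_def[of K v 0 \<one>] val_one)
qed simp

text \<open>A strictly deeper term cannot change the leading one: otherwise
  \<open>x = (x \<oplus> y) \<oplus> \<ominus> y\<close> would have a valuation above its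
  own.\<close>

lemma val_add_eq:
  assumes "x \<in> carrier K" "y \<in> carrier K" "x \<noteq> \<zero>" "val_ge K v (v x + 1) y"
  shows "x \<oplus> y \<noteq> \<zero>" "v (x \<oplus> y) = v x"
proof -
  have eq: "x = (x \<oplus> y) \<oplus> \<ominus> y" using assms by algebra
  show nz: "x \<oplus> y \<noteq> \<zero>"
  proof
    assume "x \<oplus> y = \<zero>"
    then have "x = \<ominus> y" using assms by (simp add: add.inv_equality add.m_comm)
    then have "val_ge K v (v x + 1) x" using assms val_ge_minus by auto
    with assms show False by (simp add: val_ge_def)
  qed
  have "v x \<le> v (x \<oplus> y)"
    using val_ge_add[of x y "v x"] assms val_ge_mono[OF assms(4), of "v x"] nz
    by (simp add: val_ge_def)
  moreover have "\<not> v x + 1 \<le> v (x \<oplus> y)"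
  proof
    assume "v x + 1 \<le> v (x \<oplus> y)"
    then have "val_ge K v (v x + 1) ((x \<oplus> y) \<oplus> \<ominus> y)"
      using assms by (intro val_ge_add[OF _ _ _ val_ge_minus]) (auto simp: val_ge_def)
    then show False using assms(3) unfolding eq[symmetric] by (simp add: val_ge_def)
  qed
  ultimately show "v (x \<oplus> y) = v x" by simp
qed

lemma obtain_uniformizer:
  obtains \<pi> where "\<pi> \<in> carrier K" "\<pi> \<noteq> \<zero>" "v \<pi> = 1"
proof -
  have "1 \<in> v ` (carrier K - {\<zero>})" using val_surj by simp
  then obtain \<pi> where "v \<pi> = 1" "\<pi> \<in> carrier K - {\<zero>}" by force
  then show ?thesis using that by blast
qed

section \<open>The valuation ring, its maximal ideal and the residue field\<close>

abbreviation V where "V \<equiv> valuation_ring K v"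
abbreviation I where "I \<equiv> valuation_ideal K v"

lemma mem_V: "x \<in> carrier V \<longleftrightarrow> x \<in> carrier K \<and> val_ge K v 0 x"
  by (simp add: valuation_ring_def)

lemma mem_I: "x \<in> I \<longleftrightarrow> x \<in> carrier K \<and> val_ge K v 1 x"
  by (simp add: valuation_ideal_def)

lemma subring_V: "subring (carrier V) K"
proof (rule subringI)
  fix x y assume "x \<in> carrier V" "y \<in> carrier V"
  then show "x \<otimes> y \<in> carrier V" "x \<oplus> y \<in> carrier V"
    using val_ge_mult[of x y 0 0] val_ge_add[of x y 0] by (auto simp: mem_V)
next
  fix x assume "x \<in> carrier V" then show "\<ominus> x \<in> carrier V"
    by (auto simp: mem_V val_ge_minus)
qed (auto simp: mem_V val_ge_def val_one)

lemma V_simps [simp]: "\<zero>\<^bsub>V\<^esub> = \<zero>" "\<one>\<^bsub>V\<^esub> = \<one>" "x \<oplus>\<^bsub>V\<^esub> y = x \<oplus> y" "x \<otimes>\<^bsub>V\<^esub> y = x \<otimes> y"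
  by (simp_all add: valuation_ring_def)

lemma cring_V: "cring V"
proof -
  have "cring (K\<lparr>carrier := carrier V\<rparr>)"
    using subcring_iff[of "carrier V"] subring_V subcringI'[OF subring_V]
      subringE(1)[OF subring_V] by blast
  then show ?thesis by (simp add: valuation_ring_def)
qed

lemma V_minus:
  assumes "x \<in> carrier V" "y \<in> carrier V"
  shows "x \<ominus>\<^bsub>V\<^esub> y = x \<ominus> y"
proof -
  interpret V: cring V by (rule cring_V)
  have "\<ominus>\<^bsub>V\<^esub> y \<oplus> y = \<zero>" using V.l_neg[of y] assms by simp
  moreover have "\<ominus>\<^bsub>V\<^esub> y \<in> carrier K" "y \<in> carrier K"
    using V.a_inv_closed[of y] assms mem_V by blast+
  ultimately have "\<ominus>\<^bsub>V\<^esub> y = \<ominus> y" by (metis minus_equality)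
  then show ?thesis by (simp add: a_minus_def)
qed

lemma ideal_I: "ideal I V"
proof -
  interpret V: cring V by (rule cring_V)
  have sub: "I \<subseteq> carrier V" using val_ge_mono[of 1 _ 0] by (auto simp: mem_V mem_I)
  have "ideal_axioms I V"
  proof
    fix a x assume "a \<in> I" "x \<in> carrier V"
    then show "x \<otimes>\<^bsub>V\<^esub> a \<in> I" "a \<otimes>\<^bsub>V\<^esub> x \<in> I"
      using val_ge_mult[of x a 0 1] val_ge_mult[of a x 1 0] by (auto simp: mem_V mem_I)
  qed
  moreover have "additive_subgroup I V"
  proof (rule additive_subgroup.intro, rule V.add.subgroupI)
    show "I \<subseteq> carrier V" by fact
    have "\<zero> \<in> I" by (simp add: mem_I)
    then show "I \<noteq> {}" by blast
    fix a assume a: "a \<in> I"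
    then have "\<ominus>\<^bsub>V\<^esub> a = \<zero> \<ominus> a"
      using V_minus[of \<zero> a] sub V.zero_closed V.minus_eq[of \<zero> a] V.l_zero[of "\<ominus>\<^bsub>V\<^esub> a"]
        V.a_inv_closed[of a] by auto
    then show "\<ominus>\<^bsub>V\<^esub> a \<in> I" using a val_ge_diff[of \<zero> a 1] by (auto simp: mem_I)
    fix b assume "b \<in> I"
    with a show "a \<oplus>\<^bsub>V\<^esub> b \<in> I" by (auto simp: mem_I val_ge_add)
  qed
  ultimately show ?thesis by (simp add: ideal_def cring.axioms(1)[OF cring_V])
qed

text \<open>Turns equality of cosets into a bound on a difference, so that later arguments need only
  the valuation.\<close>

lemma residue_class_eq_iff:
  assumes "x \<in> carrier V" "y \<in> carrier V"
  shows "I +>\<^bsub>V\<^esub> x = I +>\<^bsub>V\<^esub> y \<longleftrightarrow> val_ge K v 1 (x \<ominus> y)"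
proof -
  interpret I: ideal I V by (rule ideal_I)
  interpret V: cring V by (rule cring_V)
  have "I +>\<^bsub>V\<^esub> x = I +>\<^bsub>V\<^esub> y \<longleftrightarrow> x \<in> I +>\<^bsub>V\<^esub> y"
    using I.a_repr_independence'[of x y] I.a_repr_independenceD[of x y] assms by auto
  also have "\<dots> \<longleftrightarrow> x \<ominus>\<^bsub>V\<^esub> y \<in> I"
    using I.a_rcos_module_minus[OF cring.axioms(1)[OF cring_V]] assms by simp
  finally show ?thesis using V_minus assms mem_V by (auto simp: mem_I)
qed

lemma residue_field_simps:
  "carrier (residue_field K v) = (\<lambda>x. I +>\<^bsub>V\<^esub> x) ` carrier V"
  "\<one>\<^bsub>residue_field K v\<^esub> = I +>\<^bsub>V\<^esub> \<one>" "\<zero>\<^bsub>residue_field K v\<^esub> = I +>\<^bsub>V\<^esub> \<zero>"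
proof -
  interpret I: ideal I V by (rule ideal_I)
  show "carrier (residue_field K v) = (\<lambda>x. I +>\<^bsub>V\<^esub> x) ` carrier V"
    by (auto simp: residue_field_def FactRing_def A_RCOSETS_def' )
  show "\<zero>\<^bsub>residue_field K v\<^esub> = I +>\<^bsub>V\<^esub> \<zero>"
    using I.a_rcos_const[of \<zero>] by (simp add: residue_field_def FactRing_def mem_I)
qed (simp add: residue_field_def FactRing_def)

lemma residue_class_hom: "(\<lambda>x. I +>\<^bsub>V\<^esub> x) \<in> ring_hom V (residue_field K v)"
  unfolding residue_field_def by (rule ideal.rcos_ring_hom[OF ideal_I])

lemma field_residue_field: "field (residue_field K v)"
  unfolding residue_field_def
proof (rule maximalideal.quotient_is_field[OF maximalidealI cring_V])
  show "ideal I V" by (rule ideal_I)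
  show "carrier V \<noteq> I"
  proof
    assume "carrier V = I"
    then have "\<one> \<in> I" using mem_V[of \<one>] by (simp add: val_ge_def val_one)
    then show False by (simp add: mem_I val_ge_def val_one)
  qed
  fix J assume J: "ideal J V" "I \<subseteq> J" "J \<subseteq> carrier V"
  interpret J: ideal J V by fact
  show "J = I \<or> J = carrier V"
  proof (cases "J \<subseteq> I")
    case False
    then obtain x where x: "x \<in> J" "x \<in> carrier K" "x \<noteq> \<zero>" "v x = 0"
      using J(3) by (fastforce simp: mem_I mem_V val_ge_def subset_iff)
    then have i: "inv x \<in> carrier K" "x \<otimes> inv x = \<one>" using field_Units by auto
    then have "inv x \<in> carrier V" using x by (auto simp: mem_V val_ge_def val_inv)
    then have "x \<otimes>\<^bsub>V\<^esub> inv x \<in> J" using x by (intro J.I_r_closed) auto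
    then have "\<one> \<in> J" using i by simp
    then show ?thesis using J.one_imp_carrier by simp
  qed (use J in auto)
qed

text \<open>Finiteness by representatives is the form that enters the lattice \<open>R\<close> and
  from which the residue field of \<open>L\<close> is recovered.\<close>

lemma finite_residue_field_iff:
  "finite (carrier (residue_field K v)) \<longleftrightarrow>
    (\<exists>S. finite S \<and> S \<subseteq> carrier V \<and> (\<forall>x\<in>carrier V. \<exists>s\<in>S. val_ge K v 1 (x \<ominus> s)))"
proof
  assume "finite (carrier (residue_field K v))"
  then obtain S where S: "S \<subseteq> carrier V" "finite S"
    "(\<lambda>x. I +>\<^bsub>V\<^esub> x) ` carrier V = (\<lambda>x. I +>\<^bsub>V\<^esub> x) ` S"
    unfolding residue_field_simps using finite_subset_image[OF _ order_refl] by metis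
  have "\<exists>s\<in>S. val_ge K v 1 (x \<ominus> s)" if x: "x \<in> carrier V" for x
  proof -
    have "I +>\<^bsub>V\<^esub> x \<in> (\<lambda>x. I +>\<^bsub>V\<^esub> x) ` S"
      unfolding S(3)[symmetric] using x by (rule imageI)
    then obtain s where s: "s \<in> S" "I +>\<^bsub>V\<^esub> x = I +>\<^bsub>V\<^esub> s" by (rule imageE)
    then show ?thesis using residue_class_eq_iff[of x s] x S(1) by blast
  qed
  with S(1,2) show "\<exists>S. finite S \<and> S \<subseteq> carrier V \<and> (\<forall>x\<in>carrier V. \<exists>s\<in>S. val_ge K v 1 (x \<ominus> s))"
    by blast
next
  assume "\<exists>S. finite S \<and> S \<subseteq> carrier V \<and> (\<forall>x\<in>carrier V. \<exists>s\<in>S. val_ge K v 1 (x \<ominus> s))"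
  then obtain S where S: "finite S" "S \<subseteq> carrier V"
    "\<And>x. x \<in> carrier V \<Longrightarrow> \<exists>s\<in>S. val_ge K v 1 (x \<ominus> s)" by blast
  have "I +>\<^bsub>V\<^esub> x \<in> (\<lambda>x. I +>\<^bsub>V\<^esub> x) ` S" if x: "x \<in> carrier V" for x
  proof -
    from S(3)[OF x] obtain s where s: "s \<in> S" "val_ge K v 1 (x \<ominus> s)" by blast
    then have "I +>\<^bsub>V\<^esub> x = I +>\<^bsub>V\<^esub> s" using residue_class_eq_iff[of x s] x S(2) by blast
    then show ?thesis using s(1) by (rule image_eqI)
  qed
  then have "carrier (residue_field K v) \<subseteq> (\<lambda>x. I +>\<^bsub>V\<^esub> x) ` S"
    unfolding residue_field_simps by (rule image_subsetI)
  then show "finite (carrier (residue_field K v))" using S(1) finite_surj by blast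
qed

text \<open>If the \<open>l\<close>-fold of one lay in the maximal ideal, it would vanish in the
  residue field, and the additive order \<open>p\<close> of one would divide the prime
  \<open>l\<close>.\<close>

lemma val_nat_eq_zero:
  assumes fin: "finite (carrier (residue_field K v))"
    and "ring_characteristic (residue_field K v) = p"
    and "Factorial_Ring.prime l" "p \<noteq> l"
  shows "[l] \<cdot> \<one> \<noteq> \<zero>" "v ([l] \<cdot> \<one>) = 0"
proof -
  interpret R: field "residue_field K v" by (rule field_residue_field)
  interpret h: ring_hom_cring V "residue_field K v" "\<lambda>x. I +>\<^bsub>V\<^esub> x"
    by (intro ring_hom_cringI ring_hom_ringI2 cring.axioms(1) cring_V R.is_cring residue_class_hom)
  have nat: "[n] \<cdot> \<one> \<in> carrier V" for n :: nat using val_ge_nat by (simp add: mem_V)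
  have hn: "[n] \<cdot>\<^bsub>residue_field K v\<^esub> \<one>\<^bsub>residue_field K v\<^esub> = I +>\<^bsub>V\<^esub> ([n] \<cdot> \<one>)" for n :: nat
  proof (induction n)
    case 0 then show ?case by (simp add: residue_field_simps)
  next
    case (Suc n)
    then show ?case using h.hom_add[of "[n] \<cdot> \<one>" \<one>] nat[of n] nat[of 1]
      by (simp add: residue_field_simps)
  qed
  have "\<not> val_ge K v 1 ([l] \<cdot> \<one>)"
  proof
    assume a: "val_ge K v 1 ([l] \<cdot> \<one>)"
    then have "I +>\<^bsub>V\<^esub> ([l] \<cdot> \<one>) = I +>\<^bsub>V\<^esub> \<zero>"
      using residue_class_eq_iff[of "[l] \<cdot> \<one>" \<zero>] nat[of l] nat[of 0] by (simp add: a_minus_def)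
    then have "[l] \<cdot>\<^bsub>residue_field K v\<^esub> \<one>\<^bsub>residue_field K v\<^esub> = \<zero>\<^bsub>residue_field K v\<^esub>"
      using hn residue_field_simps by simp
    then have "p dvd l" using assms(2) R.add.pow_eq_id[of "\<one>\<^bsub>residue_field K v\<^esub>" l]
      by (simp add: ring_characteristic_def add_pow_def)
    \<comment> \<open>\<open>p\<close> is known only as an additive order, so \<open>p = 1\<close>
      remains; it would make one equal to zero in the residue field.\<close>
    then have "p = 1" using assms(3,4) by (metis prime_nat_iff)
    then have "[(1::nat)] \<cdot>\<^bsub>residue_field K v\<^esub> \<one>\<^bsub>residue_field K v\<^esub> = \<zero>\<^bsub>residue_field K v\<^esub>"
      using assms(2) R.add.pow_eq_id[of "\<one>\<^bsub>residue_field K v\<^esub>" 1]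
      by (simp add: ring_characteristic_def add_pow_def)
    then show False by simp
  qed
  then show "[l] \<cdot> \<one> \<noteq> \<zero>" "v ([l] \<cdot> \<one>) = 0" using nat[of l] by (auto simp: mem_V val_ge_def)
qed

end

section \<open>Congruences for the exponents\<close>

text \<open>With \<open>s = 1 + l k\<close> the powers are \<open>1 + i l k\<close> modulo
  \<open>l^2\<close>, and the linear terms add up to \<open>l k\<close> times
  \<open>l (l - 1) / 2\<close>. As \<open>l\<close> is odd, \<open>(l - 1) / 2\<close> is an integer
  and this is a multiple of \<open>l^2\<close>.\<close>

lemma geometric_sum_cong_square:
  fixes s :: int and l :: nat
  assumes "odd l" and "[s = 1] (mod int l)"
  shows "[(\<Sum>i<l. s ^ i) = int l] (mod (int l)\<^sup>2)"
proof -
  from assms(2) obtain k where k: "s = 1 + int l * k"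
    by (metis cong_iff_lin cong_sym mult.commute)
  have pow: "[s ^ i = 1 + int i * (int l * k)] (mod (int l)\<^sup>2)" for i
  proof (induction i)
    case (Suc i)
    have "[s ^ Suc i = s * (1 + int i * (int l * k))] (mod (int l)\<^sup>2)"
      using cong_mult[OF cong_refl Suc.IH, of s] by simp
    also have "s * (1 + int i * (int l * k)) =
        1 + int (Suc i) * (int l * k) + (int l)\<^sup>2 * (int i * k\<^sup>2)"
      unfolding k by (simp add: algebra_simps power2_eq_square)
    also have "[\<dots> = 1 + int (Suc i) * (int l * k)] (mod (int l)\<^sup>2)"
      by (simp add: cong_def)
    finally show ?case .
  qed simp
  have "[(\<Sum>i<l. s ^ i) = (\<Sum>i<l. 1 + int i * (int l * k))] (mod (int l)\<^sup>2)"
    by (rule cong_sum) (rule pow)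
  also have "(\<Sum>i<l. 1 + int i * (int l * k)) = int l + (\<Sum>i<l. int i) * (int l * k)"
    by (simp add: sum.distrib sum_distrib_right)
  also have "(\<Sum>i<l. int i) = int l * ((int l - 1) div 2)"
  proof -
    have "2 * (\<Sum>i<n. int i) = int n * (int n - 1)" for n
      by (induction n) (auto simp: algebra_simps)
    moreover have "2 * ((int l - 1) div 2) = int l - 1" using assms(1) by simp
    ultimately show ?thesis by (metis mult.left_commute mult_cancel_left zero_neq_numeral)
  qed
  also have "[int l + int l * ((int l - 1) div 2) * (int l * k) = int l] (mod (int l)\<^sup>2)"
  proof -
    have "int l * ((int l - 1) div 2) * (int l * k) = (int l)\<^sup>2 * ((int l - 1) div 2 * k)"
      by (simp add: power2_eq_square)
    then show ?thesis by (simp only: cong_def mod_mult_self2)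
  qed
  finally show ?thesis .
qed

text \<open>Since \<open>s = 1\<close> modulo \<open>l\<close>, the sum is \<open>l\<close> times a
  number prime to \<open>l\<close>. The divisibility of \<open>x\<close> thus falls short by a
  single factor \<open>l\<close>, which \<open>t - 1\<close> supplies.\<close>

lemma prime_power_dvd_of_geometric_sum:
  fixes x s t :: int and l a :: nat
  assumes l: "Factorial_Ring.prime l" "l \<noteq> 2" and s: "[s ^ l = 1] (mod int l ^ a)" and t: "[t ^ l = 1] (mod int l ^ a)"
    and x: "int l ^ a dvd x * (\<Sum>i<l. s ^ i)"
  shows "int l ^ a dvd x * (t - 1)"
proof (cases a)
  case (Suc b)
  \<comment> \<open>Fermat gives \<open>r ^ l = r\<close> modulo \<open>l\<close>, and the
    hypothesis descends to the modulus \<open>l\<close> because \<open>a > 0\<close> here.\<close>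
  have cong1: "[r = 1] (mod int l)" if "[r ^ l = 1] (mod int l ^ a)" for r :: int
  proof -
    have "[r ^ l = 1] (mod int l)" using that Suc by (metis cong_dvd_modulus dvd_triv_left power_Suc)
    moreover have "[r ^ l = r] (mod int l)"
    proof (cases "int l dvd r")
      case True
      then have "int l dvd r ^ l" using prime_gt_0_nat[OF l(1)] by (simp add: dvd_trans[OF _ dvd_power])
      with True show ?thesis by (simp add: cong_def dvd_imp_mod_0)
    next
      case False
      have "[nat (r mod int l) ^ (l - 1) = 1] (mod l)"
      proof (rule fermat_theorem[OF l(1)])
        show "\<not> l dvd nat (r mod int l)"
          using False l(1) by (metis dvd_mod_iff int_dvd_int_iff dvd_refl nat_0_le of_nat_0_less_iff pos_mod_sign prime_gt_0_nat)
      qed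
      then have "[(r mod int l) ^ (l - 1) = 1] (mod int l)"
        using l(1) by (metis cong_int_iff nat_0_le of_nat_0_less_iff of_nat_1 of_nat_power pos_mod_sign prime_gt_0_nat)
      then have "[r ^ (l - 1) = 1] (mod int l)" by (simp add: cong_def power_mod)
      then have "[r ^ (l - 1) * r = 1 * r] (mod int l)" by (rule cong_mult) simp
      moreover have "r ^ (l - 1) * r = r ^ l"
        using prime_gt_0_nat[OF l(1)] by (metis power_minus_mult)
      ultimately show ?thesis by simp
    qed
    ultimately show ?thesis by (meson cong_sym cong_trans)
  qed
  have "odd l" using l by (metis primes_dvd_imp_eq two_is_prime_nat)
  then obtain q where q: "(\<Sum>i<l. s ^ i) = int l + (int l)\<^sup>2 * q"
    using geometric_sum_cong_square[OF _ cong1[OF s]]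
    by (metis cong_iff_lin cong_sym)
  have "int l * int l ^ b dvd int l * (x * (1 + int l * q))"
    using x unfolding q Suc by (simp add: algebra_simps power2_eq_square)
  then have "int l ^ b dvd x * (1 + int l * q)"
    using l by (simp add: prime_gt_0_nat)
  moreover have "coprime (int l ^ b) (1 + int l * q)"
  proof -
    have "coprime (int l) (1 + int l * q)" by (metis coprime_1_right coprime_add_one_right coprime_iff_gcd_eq_1 gcd_add_mult mult.commute add.commute)
    then show ?thesis by simp
  qed
  ultimately have "int l ^ b dvd x" by (simp add: coprime_dvd_mult_left_iff)
  moreover have "int l dvd t - 1" using cong1[OF t] by (simp add: cong_iff_dvd_diff)
  ultimately show ?thesis unfolding Suc by (metis mult.commute mult_dvd_mono power_Suc)
qed simp

text \<open>\<open>eq\<close> compares the exponents at the uniformizer in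
  \<open>\<alpha> \<beta> = c \<beta> \<alpha>\<close>, so \<open>z\<close> is
  \<open>y (s - 1) - x (t - 1)\<close> modulo \<open>M\<close>. The \<open>l\<close>-part of
  \<open>M\<close> divides both terms by the preceding lemma; the part prime to \<open>l\<close>
  divides \<open>z\<close> because it divides \<open>l z\<close>.\<close>

lemma commutator_exponent_dvd:
  fixes x y z s t :: int and l M :: nat
  assumes l: "Factorial_Ring.prime l" "l \<noteq> 2" and "M > 0"
    and s: "[s ^ l = 1] (mod int M)" and t: "[t ^ l = 1] (mod int M)"
    and x: "int M dvd x * (\<Sum>i<l. s ^ i)" and y: "int M dvd y * (\<Sum>i<l. t ^ i)"
    and z: "int M dvd int l * z" and eq: "[x + y * s = z + y + x * t] (mod int M)"
  shows "int M dvd z"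
proof -
  obtain a m where M: "M = l ^ a * m" "\<not> l dvd m"
    using \<open>M > 0\<close> l(1) by (metis multiplicity_decompose' not_prime_unit gr_implies_not_zero)
  then have dl: "int l ^ a dvd int M" by simp
  have "int l ^ a dvd x * (t - 1)"
    using prime_power_dvd_of_geometric_sum[OF l] s t x dl
    by (meson cong_dvd_modulus dvd_trans)
  moreover have "int l ^ a dvd y * (s - 1)"
    using prime_power_dvd_of_geometric_sum[OF l] s t y dl
    by (meson cong_dvd_modulus dvd_trans)
  moreover have "int l ^ a dvd (x + y * s) - (z + y + x * t)"
    using eq dl by (meson cong_iff_dvd_diff dvd_trans)
  moreover have "z = y * (s - 1) - x * (t - 1) - ((x + y * s) - (z + y + x * t))"
    by (simp add: algebra_simps)
  ultimately have "int l ^ a dvd z" by (metis dvd_diff)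
  moreover have "coprime (int m) (int l)"
    using M(2) l(1) by (simp add: coprime_commute prime_imp_coprime)
  moreover have "int m dvd int l * z" using z M(1) by (metis dvd_mult_right of_nat_mult)
  ultimately have "int l ^ a * int m dvd z"
    by (metis coprime_commute coprime_dvd_mult_right_iff coprime_power_left_iff divides_mult)
  then show ?thesis using M(1) by simp
qed

section \<open>Galois action modulo principal units\<close>

context discrete_valuation
begin

text \<open>Congruence modulo the group \<open>1 + I\<close> of principal units.\<close>

definition eqv (infix \<open>\<doteq>\<close> 50) where
  "x \<doteq> y \<longleftrightarrow> x \<in> carrier K - {\<zero>} \<and> y \<in> carrier K - {\<zero>} \<and> val_ge K v (v y + 1) (x \<ominus> y)"

lemma eqv_refl: "\<lbrakk>x \<in> carrier K; x \<noteq> \<zero>\<rbrakk> \<Longrightarrow> x \<doteq> x"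
  by (simp add: eqv_def a_minus_def r_neg)

text \<open>The definition measures the difference against \<open>v y\<close> alone; equality of the
  two valuations is what makes the relation symmetric and transitive.\<close>

lemma eqv_val: assumes "x \<doteq> y" shows "v x = v y"
proof -
  have c: "x \<in> carrier K" "y \<in> carrier K" "y \<noteq> \<zero>" using assms by (auto simp: eqv_def)
  then have "y \<oplus> (x \<ominus> y) = x" by algebra
  then show ?thesis using val_add_eq(2)[of y "x \<ominus> y"] c assms by (auto simp: eqv_def)
qed

lemma eqv_sym: assumes "x \<doteq> y" shows "y \<doteq> x"
proof -
  have c: "x \<in> carrier K" "y \<in> carrier K" using assms by (auto simp: eqv_def)
  then have "y \<ominus> x = \<ominus> (x \<ominus> y)" by algebra
  then show ?thesis using assms eqv_val[OF assms] c val_ge_minus[of "x \<ominus> y"]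
    by (auto simp: eqv_def)
qed

lemma eqv_trans: assumes "x \<doteq> y" "y \<doteq> z" shows "x \<doteq> z"
proof -
  have c: "x \<in> carrier K" "y \<in> carrier K" "z \<in> carrier K" using assms by (auto simp: eqv_def)
  then have "x \<ominus> z = (x \<ominus> y) \<oplus> (y \<ominus> z)" by algebra
  then show ?thesis using assms eqv_val[OF assms(2)] c
    by (auto simp: eqv_def val_ge_add)
qed

lemma eqv_mult: assumes "x \<doteq> y" "x' \<doteq> y'" shows "x \<otimes> x' \<doteq> y \<otimes> y'"
proof -
  have c: "x \<in> carrier K - {\<zero>}" "y \<in> carrier K - {\<zero>}" "x' \<in> carrier K - {\<zero>}" "y' \<in> carrier K - {\<zero>}"
    using assms by (auto simp: eqv_def)
  then have "x \<otimes> x' \<ominus> y \<otimes> y' = x \<otimes> (x' \<ominus> y') \<oplus> (x \<ominus> y) \<otimes> y'"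
    by (simp add: a_minus_def) algebra
  moreover have "val_ge K v (v y + (v y' + 1)) (x \<otimes> (x' \<ominus> y'))"
    using c assms eqv_val[OF assms(1)] by (intro val_ge_mult) (auto simp: eqv_def val_ge_def)
  moreover have "val_ge K v ((v y + 1) + v y') ((x \<ominus> y) \<otimes> y')"
    using c assms by (intro val_ge_mult) (auto simp: eqv_def val_ge_def)
  ultimately have "val_ge K v (v y + v y' + 1) (x \<otimes> x' \<ominus> y \<otimes> y')"
    using c by (simp add: val_ge_add ac_simps)
  then show ?thesis using c val_mult[of y y'] by (auto simp: eqv_def integral_iff)
qed

lemma eqv_pow: assumes "x \<doteq> y" shows "x [^] (n::nat) \<doteq> y [^] n"
  using assms by (induction n) (auto intro: eqv_mult eqv_refl)

lemma eqv_cancel: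
  assumes c: "z \<in> carrier K" "z \<noteq> \<zero>" "x \<in> carrier K" "y \<in> carrier K" and e: "z \<otimes> x \<doteq> z \<otimes> y"
  shows "x \<doteq> y"
proof -
  have nz: "x \<noteq> \<zero>" "y \<noteq> \<zero>" using e c by (auto simp: eqv_def)
  have "z \<otimes> x \<ominus> z \<otimes> y = z \<otimes> (x \<ominus> y)" using c by (simp add: a_minus_def) algebra
  then have "val_ge K v (v z + (v y + 1)) (z \<otimes> (x \<ominus> y))"
    using e nz c val_mult[of z y] by (simp add: eqv_def ac_simps)
  then show ?thesis using nz c val_ge_mult_cancel[of z "x \<ominus> y"] by (auto simp: eqv_def)
qed

text \<open>\<open>g\<close> lifts a generator of the cyclic group of units of the finite residue
  field, and \<open>M\<close> is the order of that group. Units modulo principal units thereby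
  become exponents modulo \<open>M\<close>.\<close>

lemma residue_generator:
  assumes fin: "finite (carrier (residue_field K v))"
  obtains g M where "g \<in> carrier K" "g \<noteq> \<zero>" "v g = 0" "(M::nat) > 0"
    "\<And>u. \<lbrakk>u \<in> carrier K; u \<noteq> \<zero>; v u = 0\<rbrakk> \<Longrightarrow> \<exists>i::nat. u \<doteq> g [^] i"
    "\<And>i j. g [^] (i::nat) \<doteq> g [^] (j::nat) \<longleftrightarrow> [i = j] (mod M)"
proof -
  let ?k = "residue_field K v" and ?h = "\<lambda>x. I +>\<^bsub>V\<^esub> x"
  interpret R: field ?k by (rule field_residue_field)
  interpret h: ring_hom_cring V ?k ?h
    by (intro ring_hom_cringI ring_hom_ringI2 cring.axioms(1) cring_V R.is_cring residue_class_hom)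
  interpret m: group "Multiplicative_Group.mult_of ?k" by (rule R.field_mult_group)
  have unit_V: "x \<in> carrier V" if "x \<in> carrier K" "v x = 0" for x
    using that by (simp add: mem_V val_ge_def)
  have h0: "?h x = \<zero>\<^bsub>?k\<^esub> \<longleftrightarrow> val_ge K v 1 x" if "x \<in> carrier V" for x
    using residue_class_eq_iff[of x \<zero>] that h.R.zero_closed unfolding residue_field_simps
    by (simp add: mem_V a_minus_def)
  obtain a where a: "a \<in> carrier (Multiplicative_Group.mult_of ?k)" "carrier (Multiplicative_Group.mult_of ?k) = {a [^]\<^bsub>?k\<^esub> i | i::nat. i \<in> UNIV}"
    using R.finite_field_mult_group_has_gen[OF fin] by blast
  then obtain g where g: "g \<in> carrier V" "a = ?h g" by (auto simp: residue_field_simps)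
  have g': "g \<in> carrier K" "g \<noteq> \<zero>" "v g = 0"
    using g a(1) h0[OF g(1)] h0[of \<zero>] by (auto simp: mem_V val_ge_def)
  have pow: "g [^] (i::nat) \<in> carrier K" "g [^] i \<noteq> \<zero>" "v (g [^] i) = 0" for i
    using g' val_pow[of g i] pow_nonzero by auto
  have hpow: "?h (g [^] (i::nat)) = a [^]\<^bsub>?k\<^esub> i" for i
  proof (induction i)
    case (Suc i)
    then show ?case using h.hom_mult[OF unit_V[OF pow(1,3)[of i]] g(1)] g(2) by simp
  qed (simp add: residue_field_simps)
  \<comment> \<open>For elements of valuation zero the relation is just equality of residue
    classes.\<close>
  have e: "x \<doteq> y \<longleftrightarrow> ?h x = ?h y"
    if "x \<in> carrier K" "x \<noteq> \<zero>" "v x = 0" "y \<in> carrier K" "y \<noteq> \<zero>" "v y = 0" for x y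
    using residue_class_eq_iff[of x y] unit_V that by (simp add: eqv_def)
  show ?thesis
  proof (rule that[of g "m.ord a"])
    show "m.ord a > 0" using m.ord_ge_1[OF R.finite_mult_of[OF fin] a(1)] by simp
    fix u assume u: "u \<in> carrier K" "u \<noteq> \<zero>" "v u = 0"
    have "?h u \<in> carrier (Multiplicative_Group.mult_of ?k)"
      using h.hom_closed[OF unit_V] h0[OF unit_V] u by (auto simp: val_ge_def)
    then obtain i :: nat where "?h u = a [^]\<^bsub>?k\<^esub> i" using a(2) by auto
    then show "\<exists>i::nat. u \<doteq> g [^] i" using e u pow hpow by auto
  next
    fix i j :: nat
    have "g [^] i \<doteq> g [^] j \<longleftrightarrow> a [^]\<^bsub>?k\<^esub> i = a [^]\<^bsub>?k\<^esub> j" using e pow hpow by auto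
    also have "\<dots> \<longleftrightarrow> a [^]\<^bsub>Multiplicative_Group.mult_of ?k\<^esub> i = a [^]\<^bsub>Multiplicative_Group.mult_of ?k\<^esub> j"
      by (simp add: Multiplicative_Group.nat_pow_mult_of)
    also have "\<dots> \<longleftrightarrow> [i = j] (mod m.ord a)"
      using m.int_pow_eq[OF a(1), of "int i" "int j"]
      by (metis cong_iff_dvd_diff cong_int_iff cong_sym_eq int_pow_int)
    finally show "g [^] i \<doteq> g [^] j \<longleftrightarrow> [i = j] (mod m.ord a)" .
  qed (use g' in auto)
qed

section \<open>Field homomorphisms preserving the valuation\<close>

definition val_auto :: "('a \<Rightarrow> 'a) \<Rightarrow> bool" where
  "val_auto \<alpha> \<longleftrightarrow> \<alpha> \<in> ring_hom K K \<and> (\<forall>x\<in>carrier K - {\<zero>}. \<alpha> x \<noteq> \<zero> \<and> v (\<alpha> x) = v x)"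

lemma val_autoD:
  assumes "val_auto \<alpha>"
  shows "x \<in> carrier K \<Longrightarrow> \<alpha> x \<in> carrier K"
    and "\<lbrakk>x \<in> carrier K; y \<in> carrier K\<rbrakk> \<Longrightarrow> \<alpha> (x \<otimes> y) = \<alpha> x \<otimes> \<alpha> y"
    and "\<lbrakk>x \<in> carrier K; y \<in> carrier K\<rbrakk> \<Longrightarrow> \<alpha> (x \<oplus> y) = \<alpha> x \<oplus> \<alpha> y"
    and "\<lbrakk>x \<in> carrier K; y \<in> carrier K\<rbrakk> \<Longrightarrow> \<alpha> (x \<ominus> y) = \<alpha> x \<ominus> \<alpha> y"
    and "\<alpha> \<one> = \<one>" and "\<alpha> \<zero> = \<zero>"
    and "x \<in> carrier K \<Longrightarrow> \<alpha> (x [^] (n::nat)) = \<alpha> x [^] n"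
    and "x \<in> carrier K \<Longrightarrow> \<alpha> (add_pow K (n::nat) x) = add_pow K n (\<alpha> x)"
    and "\<lbrakk>x \<in> carrier K; x \<noteq> \<zero>\<rbrakk> \<Longrightarrow> \<alpha> x \<noteq> \<zero>"
    and "\<lbrakk>x \<in> carrier K; x \<noteq> \<zero>\<rbrakk> \<Longrightarrow> v (\<alpha> x) = v x"
    and "\<lbrakk>x \<in> carrier K; val_ge K v k x\<rbrakk> \<Longrightarrow> val_ge K v k (\<alpha> x)"
    and "\<lbrakk>x \<in> carrier K; x \<noteq> \<zero>\<rbrakk> \<Longrightarrow> \<alpha> x \<in> carrier K - {\<zero>}"
proof -
  have hom: "\<alpha> \<in> ring_hom K K" using assms by (simp add: val_auto_def)
  interpret h: ring_hom_cring K K \<alpha> by unfold_locales (rule hom)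
  show "x \<in> carrier K \<Longrightarrow> \<alpha> x \<in> carrier K" by simp
  show "\<lbrakk>x \<in> carrier K; y \<in> carrier K\<rbrakk> \<Longrightarrow> \<alpha> (x \<otimes> y) = \<alpha> x \<otimes> \<alpha> y" by simp
  show "\<lbrakk>x \<in> carrier K; y \<in> carrier K\<rbrakk> \<Longrightarrow> \<alpha> (x \<oplus> y) = \<alpha> x \<oplus> \<alpha> y" by simp
  show "\<lbrakk>x \<in> carrier K; y \<in> carrier K\<rbrakk> \<Longrightarrow> \<alpha> (x \<ominus> y) = \<alpha> x \<ominus> \<alpha> y"
    by (simp add: a_minus_def)
  show "\<alpha> \<one> = \<one>" "\<alpha> \<zero> = \<zero>" by simp_all
  show "x \<in> carrier K \<Longrightarrow> \<alpha> (x [^] (n::nat)) = \<alpha> x [^] n" by simp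
  show "x \<in> carrier K \<Longrightarrow> \<alpha> (add_pow K (n::nat) x) = add_pow K n (\<alpha> x)"
    by (induction n) simp_all
  show nz: "\<lbrakk>x \<in> carrier K; x \<noteq> \<zero>\<rbrakk> \<Longrightarrow> \<alpha> x \<noteq> \<zero>"
    and val: "\<lbrakk>x \<in> carrier K; x \<noteq> \<zero>\<rbrakk> \<Longrightarrow> v (\<alpha> x) = v x"
    using assms by (auto simp: val_auto_def)
  then show "\<lbrakk>x \<in> carrier K; x \<noteq> \<zero>\<rbrakk> \<Longrightarrow> \<alpha> x \<in> carrier K - {\<zero>}" by simp
  show "\<lbrakk>x \<in> carrier K; val_ge K v k x\<rbrakk> \<Longrightarrow> val_ge K v k (\<alpha> x)"
    using val \<open>\<alpha> \<zero> = \<zero>\<close> unfolding val_ge_def by metis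
qed

lemma val_auto_compow_closed: "\<lbrakk>val_auto \<alpha>; x \<in> carrier K\<rbrakk> \<Longrightarrow> (\<alpha> ^^ n) x \<in> carrier K"
  by (induction n) (auto simp: val_autoD(1))

lemma eqv_val_auto: "\<lbrakk>val_auto \<alpha>; x \<doteq> y\<rbrakk> \<Longrightarrow> \<alpha> x \<doteq> \<alpha> y"
  using val_autoD(4)[of \<alpha> x y] val_autoD(11)[of \<alpha> "x \<ominus> y"]
  by (auto simp: eqv_def val_autoD)

text \<open>As a product, the multiple has a valuation computable by
  \<open>val_mult\<close>.\<close>

lemma add_pow_as_mult: "x \<in> carrier K \<Longrightarrow> add_pow K (n::nat) x = add_pow K n \<one> \<otimes> x"
  by (induction n) (auto simp: l_distr)

text \<open>An automorphism of order prime to the residue characteristic which is trivial modulo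
  principal units is trivial: if \<open>y = c x - x\<close> were nonzero, then \<open>c\<^sup>l x - x\<close> would be
  \<open>l y\<close> up to terms of higher valuation.\<close>

lemma tame_eqv_imp_id:
  assumes c: "val_auto c" and l: "add_pow K (l::nat) \<one> \<noteq> \<zero>" "v (add_pow K l \<one>) = 0"
    and ord: "\<And>x. x \<in> carrier K \<Longrightarrow> (c ^^ l) x = x"
    and eqv: "\<And>x. \<lbrakk>x \<in> carrier K; x \<noteq> \<zero>\<rbrakk> \<Longrightarrow> c x \<doteq> x"
    and x: "x \<in> carrier K"
  shows "c x = x"
proof (rule ccontr)
  assume "c x \<noteq> x"
  define y where "y = c x \<ominus> x"
  have cx: "c x \<in> carrier K" and y: "y \<in> carrier K"
    using x val_autoD(1)[OF c] by (auto simp: y_def)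
  have y0: "y \<noteq> \<zero>" using \<open>c x \<noteq> x\<close> cx x by (simp add: y_def)
  \<comment> \<open>Invariant of the induction: \<open>c\<^sup>i x - x\<close> equals
    \<open>i y\<close> up to terms of valuation above \<open>v y\<close>.\<close>
  have step: "val_ge K v (v y + 1) (((c ^^ i) x \<ominus> x) \<ominus> add_pow K i y)" for i
  proof (induction i)
    case 0
    then show ?case using x by (simp add: a_minus_def r_neg)
  next
    case (Suc i)
    define d where "d = ((c ^^ i) x \<ominus> x) \<ominus> add_pow K i y"
    have ci: "(c ^^ i) x \<in> carrier K" by (rule val_auto_compow_closed[OF c x])
    have d: "d \<in> carrier K" using ci x y by (simp add: d_def)
    have cy: "c y \<in> carrier K" by (rule val_autoD(1)[OF c y])
    have "c d = ((c ((c ^^ i) x)) \<ominus> c x) \<ominus> add_pow K i (c y)"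
      using ci x y unfolding d_def by (simp add: val_autoD[OF c])
    \<comment> \<open>The cost of replacing \<open>c y\<close> by \<open>y\<close>; it is deep
      because \<open>c y \<doteq> y\<close> and integers have nonnegative valuation.\<close>
    moreover have "add_pow K i (c y) = add_pow K i y \<oplus> add_pow K i \<one> \<otimes> (c y \<ominus> y)"
    proof -
      have "c y = y \<oplus> (c y \<ominus> y)" using y cy by algebra
      then have "add_pow K i \<one> \<otimes> c y = add_pow K i \<one> \<otimes> (y \<oplus> (c y \<ominus> y))" by simp
      also have "\<dots> = add_pow K i \<one> \<otimes> y \<oplus> add_pow K i \<one> \<otimes> (c y \<ominus> y)"
        using y cy by (intro r_distr) auto
      finally show ?thesis using y cy by (simp add: add_pow_as_mult[of "c y"] add_pow_as_mult[of y])
    qed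
    moreover have "c x = y \<oplus> x" using cx x by (simp add: y_def minus_eq a_assoc l_neg)
    moreover have alg: "(A \<ominus> x) \<ominus> (P \<oplus> y) = ((A \<ominus> (y \<oplus> x)) \<ominus> (P \<oplus> Q)) \<oplus> Q"
      if "A \<in> carrier K" "P \<in> carrier K" "Q \<in> carrier K" for A P Q
      using that x y by algebra
    ultimately have "((c ^^ Suc i) x \<ominus> x) \<ominus> add_pow K (Suc i) y
        = c d \<oplus> add_pow K i \<one> \<otimes> (c y \<ominus> y)"
      using y cy alg[OF val_autoD(1)[OF c ci], of "add_pow K i y" "add_pow K i \<one> \<otimes> (c y \<ominus> y)"]
      by simp
    moreover have "val_ge K v (v y + 1) (c d)"
      using Suc.IH d by (auto simp: d_def[symmetric] val_autoD[OF c])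
    moreover have "val_ge K v (0 + (v y + 1)) (add_pow K i \<one> \<otimes> (c y \<ominus> y))"
      using eqv[OF y y0] cy y by (intro val_ge_mult val_ge_nat) (auto simp: eqv_def)
    ultimately show ?case using val_ge_add d cy y val_autoD(1)[OF c] by simp
  qed
  \<comment> \<open>At \<open>i = l\<close> the first difference vanishes, so \<open>l y\<close>
    would lie deeper than \<open>y\<close> although \<open>l\<close> has valuation zero.\<close>
  have "((c ^^ l) x \<ominus> x) \<ominus> add_pow K l y = \<ominus> (add_pow K l y)"
    using x y by (simp add: ord a_minus_def r_neg)
  then have "val_ge K v (v y + 1) (\<ominus> (add_pow K l y))" using step[of l] by simp
  then have "val_ge K v (v y + 1) (add_pow K l y)"
    using val_ge_minus[of "\<ominus> (add_pow K l y)"] y by simp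
  then show False using l y y0 val_mult[of "add_pow K l \<one>" y]
    by (simp add: add_pow_as_mult[of y] val_ge_def integral_iff)
qed

text \<open>On the classes of \<open>\<pi> g\<^sup>e\<close> the exponent undergoes the affine map
  \<open>e \<mapsto> x + s e\<close>; iterating it from zero produces the geometric sum.\<close>

lemma val_auto_uniformizer_pow:
  assumes \<alpha>: "val_auto \<alpha>" and g: "g \<in> carrier K" "g \<noteq> \<zero>" and p: "\<pi> \<in> carrier K" "\<pi> \<noteq> \<zero>"
    and s: "\<alpha> g \<doteq> g [^] (s::nat)" and x: "\<alpha> \<pi> \<doteq> \<pi> \<otimes> g [^] (x::nat)"
  shows "(\<alpha> ^^ n) g \<doteq> g [^] (s ^ n)" "(\<alpha> ^^ n) \<pi> \<doteq> \<pi> \<otimes> g [^] (x * (\<Sum>i<n. s ^ i))"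
proof -
  have pow: "\<alpha> (g [^] (e::nat)) \<doteq> g [^] (s * e)" for e
    using eqv_pow[OF s, of e] g by (simp add: val_autoD[OF \<alpha>] nat_pow_pow)
  show "(\<alpha> ^^ n) g \<doteq> g [^] (s ^ n)"
  proof (induction n)
    case 0
    then show ?case using g eqv_refl by simp
  next
    case (Suc n)
    then show ?case using eqv_trans[OF eqv_val_auto[OF \<alpha> Suc] pow] by simp
  qed
  show "(\<alpha> ^^ n) \<pi> \<doteq> \<pi> \<otimes> g [^] (x * (\<Sum>i<n. s ^ i))"
  proof (induction n)
    case 0
    then show ?case using p eqv_refl by simp
  next
    case (Suc n)
    let ?e = "x * (\<Sum>i<n. s ^ i)"
    have "\<alpha> (\<pi> \<otimes> g [^] ?e) \<doteq> (\<pi> \<otimes> g [^] x) \<otimes> g [^] (s * ?e)"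
      using eqv_mult[OF x pow[of ?e]] g p by (simp add: val_autoD[OF \<alpha>])
    also have "(\<pi> \<otimes> g [^] x) \<otimes> g [^] (s * ?e) = \<pi> \<otimes> g [^] (x + s * ?e)"
      using g p by (simp add: m_assoc nat_pow_mult)
    also have "x + s * ?e = x * (\<Sum>i<Suc n. s ^ i)"
      by (simp only: sum.lessThan_Suc_shift power_Suc sum_distrib_left[symmetric])
         (simp add: algebra_simps)
    finally show ?case using eqv_trans[OF eqv_val_auto[OF \<alpha> Suc]] by simp
  qed
qed

text \<open>The action on \<open>K\<^sup>* / (1 + I)\<close> is determined by exponents \<open>s\<close>, \<open>x\<close> with
  \<open>\<alpha> g = g\<^sup>s\<close> and \<open>\<alpha> \<pi> = \<pi> g\<^sup>x\<close>, where \<open>g\<close> generates the units of the residue field.\<close>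

lemma commutator_trivial:
  assumes fin: "finite (carrier (residue_field K v))"
    and l: "Factorial_Ring.prime l" "l \<noteq> 2" "add_pow K l \<one> \<noteq> \<zero>" "v (add_pow K l \<one>) = 0"
    and auto: "val_auto \<alpha>" "val_auto \<beta>" "val_auto c"
    and ord: "\<And>x. x \<in> carrier K \<Longrightarrow> (\<alpha> ^^ l) x = x" "\<And>x. x \<in> carrier K \<Longrightarrow> (\<beta> ^^ l) x = x"
      "\<And>x. x \<in> carrier K \<Longrightarrow> (c ^^ l) x = x"
    and comm: "\<And>x. x \<in> carrier K \<Longrightarrow> \<alpha> (\<beta> x) = c (\<beta> (\<alpha> x))"
    and x: "x \<in> carrier K"
  shows "c x = x"
proof -
  obtain g M where g: "g \<in> carrier K" "g \<noteq> \<zero>" "v g = 0" and M: "(M::nat) > 0"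
    and gen: "\<And>u. \<lbrakk>u \<in> carrier K; u \<noteq> \<zero>; v u = 0\<rbrakk> \<Longrightarrow> \<exists>i::nat. u \<doteq> g [^] i"
    and gcong: "\<And>i j. g [^] (i::nat) \<doteq> g [^] (j::nat) \<longleftrightarrow> [i = j] (mod M)"
    using residue_generator[OF fin] by blast
  obtain \<pi> where p: "\<pi> \<in> carrier K" "\<pi> \<noteq> \<zero>" "v \<pi> = 1" by (rule obtain_uniformizer)
  \<comment> \<open>\<open>s\<close> is the logarithm to base \<open>g\<close> of the unit
    \<open>\<rho> g\<close>, and \<open>x\<close> that of \<open>\<rho> \<pi> / \<pi>\<close>, a
    unit because \<open>\<rho>\<close> preserves the valuation.\<close>
  have exps: "\<exists>(s::nat) (x::nat). \<rho> g \<doteq> g [^] s \<and> \<rho> \<pi> \<doteq> \<pi> \<otimes> g [^] x" if \<rho>: "val_auto \<rho>" for \<rho>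
  proof -
    obtain s :: nat where s: "\<rho> g \<doteq> g [^] s" using gen[of "\<rho> g"] g by (auto simp: val_autoD[OF \<rho>])
    define u where "u = inv \<pi> \<otimes> \<rho> \<pi>"
    have i: "inv \<pi> \<in> carrier K" "inv \<pi> \<noteq> \<zero>" "\<pi> \<otimes> inv \<pi> = \<one>"
      using p field_Units nonzero_imp_inverse_nonzero by auto
    have u: "u \<in> carrier K" "u \<noteq> \<zero>" "v u = 0"
      using i p val_mult[of "inv \<pi>" "\<rho> \<pi>"] val_inv[of \<pi>]
      by (auto simp: u_def val_autoD[OF \<rho>] integral_iff)
    then obtain x :: nat where x: "u \<doteq> g [^] x" using gen by blast
    have "\<rho> \<pi> = \<pi> \<otimes> u" using i p by (simp add: u_def m_assoc[symmetric] val_autoD[OF \<rho>])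
    then have "\<rho> \<pi> \<doteq> \<pi> \<otimes> g [^] x" using eqv_mult[OF eqv_refl[OF p(1,2)] x] by simp
    with s show ?thesis by blast
  qed
  have gpow: "\<rho> (g [^] (e::nat)) \<doteq> g [^] (s * e)" if "val_auto \<rho>" "\<rho> g \<doteq> g [^] (s::nat)" for \<rho> s e
    using eqv_pow[OF that(2), of e] g by (simp add: val_autoD[OF that(1)] nat_pow_pow)
  have ppow: "\<rho> (\<pi> \<otimes> g [^] (e::nat)) \<doteq> \<pi> \<otimes> g [^] (x + s * e)"
    if "val_auto \<rho>" "\<rho> g \<doteq> g [^] (s::nat)" "\<rho> \<pi> \<doteq> \<pi> \<otimes> g [^] (x::nat)" for \<rho> s x e
    using eqv_mult[OF that(3) gpow[OF that(1,2)], of e] g p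
    by (simp add: val_autoD[OF that(1)] m_assoc nat_pow_mult)
  have pcancel: "[i = j] (mod M)" if "\<pi> \<otimes> g [^] (i::nat) \<doteq> \<pi> \<otimes> g [^] (j::nat)" for i j
    using eqv_cancel[OF p(1,2) _ _ that] g gcong by simp
  \<comment> \<open>Both relations come from evaluating the \<open>l\<close>-th iterate, which is
    the identity, at \<open>g\<close> and at \<open>\<pi>\<close>.\<close>
  have order: "[s ^ l = 1] (mod M)" "[x * (\<Sum>i<l. s ^ i) = 0] (mod M)"
    if "val_auto \<rho>" "\<rho> g \<doteq> g [^] (s::nat)" "\<rho> \<pi> \<doteq> \<pi> \<otimes> g [^] (x::nat)"
      "\<And>y. y \<in> carrier K \<Longrightarrow> (\<rho> ^^ l) y = y" for \<rho> s x
    using val_auto_uniformizer_pow[OF that(1) g(1,2) p(1,2) that(2,3), of l] that(4)[of g] that(4)[of \<pi>] g p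
      gcong[of 1 "s ^ l"] pcancel[of 0 "x * (\<Sum>i<l. s ^ i)"]
    by (auto simp: cong_sym_eq)
  obtain s x where s: "\<alpha> g \<doteq> g [^] (s::nat)" "\<alpha> \<pi> \<doteq> \<pi> \<otimes> g [^] (x::nat)" using exps auto(1) by blast
  obtain t y where t: "\<beta> g \<doteq> g [^] (t::nat)" "\<beta> \<pi> \<doteq> \<pi> \<otimes> g [^] (y::nat)" using exps auto(2) by blast
  obtain r z where r: "c g \<doteq> g [^] (r::nat)" "c \<pi> \<doteq> \<pi> \<otimes> g [^] (z::nat)" using exps auto(3) by blast
  note os = order[OF auto(1) s ord(1)] and ot = order[OF auto(2) t ord(2)] and oc = order[OF auto(3) r ord(3)]
  \<comment> \<open>The commutator relation is read at \<open>g\<close> first: it forces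
    \<open>r = 1\<close>, which simplifies the comparison at \<open>\<pi>\<close>
    afterwards.\<close>
  have "\<alpha> (\<beta> g) \<doteq> g [^] (s * t)"
    by (rule eqv_trans[OF eqv_val_auto[OF auto(1) t(1)] gpow[OF auto(1) s(1)]])
  moreover have "c (\<beta> (\<alpha> g)) \<doteq> g [^] (r * (t * s))"
    by (rule eqv_trans[OF eqv_val_auto[OF auto(3) eqv_trans[OF eqv_val_auto[OF auto(2) s(1)]
      gpow[OF auto(2) t(1)]]] gpow[OF auto(3) r(1)]])
  ultimately have "[s * t = r * (t * s)] (mod M)"
    using comm[OF g(1)] gcong eqv_trans eqv_sym by metis
  \<comment> \<open>\<open>s\<close> and \<open>t\<close> are invertible modulo \<open>M\<close>
    because their \<open>l\<close>-th powers are one, so they cancel.\<close>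
  moreover have "coprime (s * t) M"
  proof -
    have "coprime a M" if "[a ^ l = 1] (mod M)" for a
      using cong_imp_coprime[OF cong_sym[OF that]] prime_gt_0_nat[OF l(1)] by simp
    then show ?thesis using os ot by simp
  qed
  ultimately have r1: "[r = 1] (mod M)"
    using cong_mult_rcancel_nat[of "s * t" M r 1] by (simp add: mult.commute cong_sym_eq)
  have "c g \<doteq> g" using eqv_trans[OF r(1)] gcong[of r 1] r1 g by simp
  \<comment> \<open>With exponent one in place of \<open>r\<close>, the geometric sum for
    \<open>c\<close> is exactly \<open>l\<close> and yields \<open>M dvd l * z\<close>.\<close>
  then have r': "c g \<doteq> g [^] (1::nat)" using g by simp
  have "[z * (\<Sum>i<l. 1 ^ i) = 0] (mod M)" using order(2)[OF auto(3) r' r(2) ord(3)] by blast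
  then have zl: "M dvd l * z" by (simp add: cong_0_iff mult.commute)
  have "\<alpha> (\<beta> \<pi>) \<doteq> \<pi> \<otimes> g [^] (x + s * y)"
    by (rule eqv_trans[OF eqv_val_auto[OF auto(1) t(2)] ppow[OF auto(1) s]])
  moreover have "c (\<beta> (\<alpha> \<pi>)) \<doteq> \<pi> \<otimes> g [^] (z + 1 * (y + t * x))"
    by (rule eqv_trans[OF eqv_val_auto[OF auto(3) eqv_trans[OF eqv_val_auto[OF auto(2) s(2)]
      ppow[OF auto(2) t]]] ppow[OF auto(3) r' r(2)]])
  ultimately have "[x + s * y = z + (y + t * x)] (mod M)"
    using comm[OF p(1)] pcancel eqv_trans eqv_sym by (metis mult_1)
  then have "[int x + int y * int s = int z + int y + int x * int t] (mod int M)"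
    by (simp flip: cong_int_iff add: algebra_simps)
  note e = this
  have int_pow: "[int a ^ l = 1] (mod int M)" if "[a ^ l = 1] (mod M)" for a
    using that cong_int_iff[of "a ^ l" 1 M] by simp
  have int_sum: "int M dvd int b * (\<Sum>i<l. int a ^ i)" if "[b * (\<Sum>i<l. a ^ i) = 0] (mod M)" for a b
  proof -
    have "int M dvd int (b * (\<Sum>i<l. a ^ i))"
      using that by (simp only: int_dvd_int_iff cong_0_iff)
    then show ?thesis by simp
  qed
  have z: "int M dvd int l * int z" using zl int_dvd_int_iff[of M "l * z"] by simp
  then have "int M dvd int z"
    using commutator_exponent_dvd[OF l(1,2) M int_pow[OF os(1)] int_pow[OF ot(1)]
      int_sum[OF os(2)] int_sum[OF ot(2)] z e] by simp
  then have "[z = 0] (mod M)" by (simp add: cong_0_iff)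
  then have "\<pi> \<otimes> g [^] z \<doteq> \<pi> \<otimes> g [^] (0::nat)"
    using gcong[of z 0] eqv_mult[OF eqv_refl[OF p(1,2)]] by blast
  then have cp: "c \<pi> \<doteq> \<pi>" using eqv_trans[OF r(2)] p by simp
  have cu: "c u \<doteq> u" if u: "u \<in> carrier K" "u \<noteq> \<zero>" "v u = 0" for u
  proof -
    obtain i :: nat where i: "u \<doteq> g [^] i" using gen[OF u] by blast
    have "c u \<doteq> g [^] (1 * i)"
      by (rule eqv_trans[OF eqv_val_auto[OF auto(3) i] gpow[OF auto(3) r']])
    then show ?thesis using eqv_trans[OF _ eqv_sym[OF i]] by simp
  qed
  \<comment> \<open>Every element is a unit times a power of \<open>\<pi>\<close>. For negative
    valuation it is multiplied by a power of \<open>\<pi>\<close>, otherwise divided by one, so that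
    natural exponents suffice.\<close>
  have eqv: "c u \<doteq> u" if u: "u \<in> carrier K" "u \<noteq> \<zero>" for u
  proof (cases "v u \<ge> 0")
    case True
    then obtain n where n: "v u = int n" by (metis nonneg_int_cases)
    define q where "q = \<pi> [^] n"
    have q: "q \<in> carrier K" "q \<noteq> \<zero>" "v q = v u" "c q \<doteq> q"
      using p val_pow[of \<pi>] pow_nonzero n eqv_pow[OF cp, of n]
      by (auto simp: q_def val_autoD[OF auto(3)])
    have i: "inv q \<in> carrier K" "inv q \<noteq> \<zero>" "q \<otimes> inv q = \<one>"
      using q field_Units nonzero_imp_inverse_nonzero by auto
    define w where "w = inv q \<otimes> u"
    have w: "w \<in> carrier K" "w \<noteq> \<zero>" "v w = 0"
      using i u val_mult[of "inv q" u] val_inv[of q] q by (auto simp: w_def integral_iff)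
    have "u = q \<otimes> w" using i u q by (simp add: w_def m_assoc[symmetric])
    then show ?thesis using eqv_mult[OF q(4) cu[OF w]] w q by (simp add: val_autoD[OF auto(3)])
  next
    case False
    then obtain n where n: "v u = - int n" by (metis int_cases of_nat_0_le_iff)
    define q where "q = \<pi> [^] n"
    have q: "q \<in> carrier K" "q \<noteq> \<zero>" "v q = - v u" "c q \<doteq> q"
      using p val_pow[of \<pi>] pow_nonzero n eqv_pow[OF cp, of n]
      by (auto simp: q_def val_autoD[OF auto(3)])
    have w: "q \<otimes> u \<in> carrier K" "q \<otimes> u \<noteq> \<zero>" "v (q \<otimes> u) = 0"
      using u val_mult[of q u] q by (auto simp: integral_iff)
    have "q \<otimes> c u \<doteq> c q \<otimes> c u"
      using eqv_mult[OF eqv_sym[OF q(4)] eqv_refl[of "c u"]] u by (simp add: val_autoD[OF auto(3)])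
    moreover have "c q \<otimes> c u \<doteq> q \<otimes> u" using cu[OF w] u q by (simp add: val_autoD[OF auto(3)])
    ultimately have "q \<otimes> c u \<doteq> q \<otimes> u" using eqv_trans by blast
    then show ?thesis using eqv_cancel[OF q(1,2)] u by (simp add: val_autoD[OF auto(3)])
  qed
  show ?thesis using tame_eqv_imp_id[OF auto(3) l(3,4) ord(3) eqv x] by blast
qed

end

section \<open>A Galois-stable order\<close>

lemma (in field) nonzero_inv:
  assumes "x \<in> carrier R" "x \<noteq> \<zero>"
  shows "inv x \<in> carrier R" "inv x \<noteq> \<zero>" "x \<otimes> inv x = \<one>"
proof -
  show i: "inv x \<in> carrier R" "x \<otimes> inv x = \<one>" using assms field_Units by auto
  show "inv x \<noteq> \<zero>" using i assms by auto
qed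

text \<open>
  The base field \<open>F\<close> is a subset of \<open>L\<close>, with valuation \<open>v\<close> (arbitrary at zero), valuation ring
  \<open>Ov\<close> and uniformizer \<open>\<pi>\<close>; completeness is convergence of the series \<open>\<Sum>i. \<pi>\<^sup>i d\<^sub>i\<close>.
\<close>

locale galois_over_complete = field L for L (structure) +
  fixes F Ov :: "'a set" and \<pi> :: 'a and v :: "'a \<Rightarrow> int" and G :: "('a \<Rightarrow> 'a) set"
  assumes subfield_F: "subfield F L"
    and v_mult: "\<lbrakk>x \<in> F - {\<zero>}; y \<in> F - {\<zero>}\<rbrakk> \<Longrightarrow> v (x \<otimes> y) = v x + v y"
    and Ov_eq: "Ov = {x \<in> F. x = \<zero> \<or> 0 \<le> v x}"
    and Ov_add: "\<lbrakk>x \<in> Ov; y \<in> Ov\<rbrakk> \<Longrightarrow> x \<oplus> y \<in> Ov"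
    and unif: "\<pi> \<in> F" "\<pi> \<noteq> \<zero>" "v \<pi> = 1"
    and Ov_finite: "\<exists>S. finite S \<and> S \<subseteq> Ov \<and> (\<forall>x\<in>Ov. \<exists>s\<in>S. \<exists>y\<in>Ov. x = s \<oplus> \<pi> \<otimes> y)"
    and Ov_complete: "\<And>d. (\<And>i. d i \<in> Ov) \<Longrightarrow>
      \<exists>y\<in>Ov. \<forall>m. \<exists>r\<in>Ov. y = (rec_nat \<zero> (\<lambda>i s. s \<oplus> \<pi> [^] i \<otimes> d i) m) \<oplus> \<pi> [^] m \<otimes> r"
    and finite_G: "finite G"
    and id_G: "(\<lambda>x\<in>carrier L. x) \<in> G"
    and comp_G: "\<lbrakk>\<alpha> \<in> G; \<beta> \<in> G\<rbrakk> \<Longrightarrow> compose (carrier L) \<alpha> \<beta> \<in> G"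
    and bij_G: "\<alpha> \<in> G \<Longrightarrow> \<alpha> \<in> Bij (carrier L)"
    and hom_G: "\<alpha> \<in> G \<Longrightarrow> \<alpha> \<in> ring_hom L L"
    and G_fixes: "\<lbrakk>\<alpha> \<in> G; x \<in> F\<rbrakk> \<Longrightarrow> \<alpha> x = x"
    and G_fixed: "\<lbrakk>x \<in> carrier L; \<And>\<alpha>. \<alpha> \<in> G \<Longrightarrow> \<alpha> x = x\<rbrakk> \<Longrightarrow> x \<in> F"
    and finite_span: "\<exists>us. set us \<subseteq> carrier L \<and> Span F us = carrier L"
    and card_G: "add_pow L (card G) \<one> \<noteq> \<zero>"
begin

section \<open>Arithmetic of the base field and of its valuation ring\<close>

definition partial_sum :: "(nat \<Rightarrow> 'a) \<Rightarrow> nat \<Rightarrow> 'a" where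
  "partial_sum d = rec_nat \<zero> (\<lambda>i s. s \<oplus> \<pi> [^] i \<otimes> d i)"

lemma partial_sum_simps [simp]: "partial_sum d 0 = \<zero>" "partial_sum d (Suc m) = partial_sum d m \<oplus> \<pi> [^] m \<otimes> d m"
  by (simp_all add: partial_sum_def)

lemma F_carrier: "x \<in> F \<Longrightarrow> x \<in> carrier L"
  using subfieldE(3)[OF subfield_F] by blast

lemma F_closed:
  "\<zero> \<in> F" "\<one> \<in> F" "\<lbrakk>x \<in> F; y \<in> F\<rbrakk> \<Longrightarrow> x \<oplus> y \<in> F" "\<lbrakk>x \<in> F; y \<in> F\<rbrakk> \<Longrightarrow> x \<otimes> y \<in> F"
  "x \<in> F \<Longrightarrow> \<ominus> x \<in> F"
  using subringE[OF subfieldE(1)[OF subfield_F]] by auto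

lemma F_inv: "\<lbrakk>x \<in> F; x \<noteq> \<zero>\<rbrakk> \<Longrightarrow> inv x \<in> F"
  using subfield_m_inv(1)[OF subfield_F, of x] by auto

lemma F_pow: "x \<in> F \<Longrightarrow> x [^] (n::nat) \<in> F"
  by (induction n) (auto intro: F_closed)

lemma v_one: "v \<one> = 0"
  using v_mult[of \<one> \<one>] F_closed by simp

lemma v_pow: "\<lbrakk>x \<in> F; x \<noteq> \<zero>\<rbrakk> \<Longrightarrow> v (x [^] (n::nat)) = int n * v x"
proof (induction n)
  case (Suc n)
  then have "x [^] n \<noteq> \<zero>" using pow_nonzero F_carrier by blast
  with Suc show ?case by (simp add: v_mult F_pow algebra_simps)
qed (simp add: v_one)

lemma v_inv: "\<lbrakk>x \<in> F; x \<noteq> \<zero>\<rbrakk> \<Longrightarrow> v (inv x) = - v x"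
proof -
  assume x: "x \<in> F" "x \<noteq> \<zero>"
  then have "inv x \<noteq> \<zero>" "x \<otimes> inv x = \<one>"
    using nonzero_inv[OF F_carrier] by auto
  then show ?thesis using v_mult[of x "inv x"] x F_inv v_one by auto
qed

lemma unif_carrier: "\<pi> \<in> carrier L" by (rule F_carrier[OF unif(1)])

lemma unif_pow: "\<pi> [^] (n::nat) \<in> carrier L" "\<pi> [^] n \<in> F" "\<pi> [^] n \<noteq> \<zero>" "v (\<pi> [^] n) = int n"
  "\<pi> [^] n \<in> Ov"
  using unif F_pow pow_nonzero unif_carrier v_pow by (auto simp: Ov_eq)

lemma Ov_carrier: "x \<in> Ov \<Longrightarrow> x \<in> carrier L" by (simp add: Ov_eq F_carrier)

lemma Ov_mult: assumes "x \<in> Ov" "y \<in> Ov" shows "x \<otimes> y \<in> Ov"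
proof (cases "x = \<zero> \<or> y = \<zero>")
  case False
  with assms v_mult[of x y] F_closed(4)[of x y] show ?thesis by (auto simp: Ov_eq)
qed (use assms F_carrier in \<open>auto simp: Ov_eq F_closed\<close>)

lemma Ov_consts: "\<zero> \<in> Ov" "\<one> \<in> Ov" "\<ominus> \<one> \<in> Ov" "\<pi> \<in> Ov"
proof -
  have "v (\<ominus> \<one>) + v (\<ominus> \<one>) = v (\<ominus> \<one> \<otimes> \<ominus> \<one>)"
    by (subst v_mult) (auto simp: F_closed)
  also have "\<ominus> \<one> \<otimes> \<ominus> \<one> = \<one>" by algebra
  finally show "\<ominus> \<one> \<in> Ov" by (simp add: Ov_eq F_closed v_one)
qed (auto simp: Ov_eq F_closed v_one unif)

lemma Ov_scale:
  assumes "x \<in> F"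
  shows "\<exists>k::nat. \<pi> [^] k \<otimes> x \<in> Ov"
proof (cases "x = \<zero>")
  case False
  then have "\<pi> [^] nat \<bar>v x\<bar> \<otimes> x \<in> Ov"
    using assms unif_pow[of "nat \<bar>v x\<bar>"] v_mult[of "\<pi> [^] nat \<bar>v x\<bar>" x]
    unfolding Ov_eq by (auto simp: F_closed simp del: pow_nat)
  then show ?thesis by blast
qed (use Ov_consts unif_carrier in auto)

lemma G_hom:
  assumes "\<alpha> \<in> G"
  shows "x \<in> carrier L \<Longrightarrow> \<alpha> x \<in> carrier L"
    and "\<lbrakk>x \<in> carrier L; y \<in> carrier L\<rbrakk> \<Longrightarrow> \<alpha> (x \<otimes> y) = \<alpha> x \<otimes> \<alpha> y"
    and "\<lbrakk>x \<in> carrier L; y \<in> carrier L\<rbrakk> \<Longrightarrow> \<alpha> (x \<oplus> y) = \<alpha> x \<oplus> \<alpha> y"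
    and "\<alpha> \<one> = \<one>" and "\<alpha> \<zero> = \<zero>" and "\<lbrakk>x \<in> carrier L; x \<noteq> \<zero>\<rbrakk> \<Longrightarrow> \<alpha> x \<noteq> \<zero>"
proof -
  interpret h: ring_hom_cring L L \<alpha> by unfold_locales (rule hom_G[OF assms])
  show "x \<in> carrier L \<Longrightarrow> \<alpha> x \<in> carrier L"
    and "\<lbrakk>x \<in> carrier L; y \<in> carrier L\<rbrakk> \<Longrightarrow> \<alpha> (x \<otimes> y) = \<alpha> x \<otimes> \<alpha> y"
    and "\<lbrakk>x \<in> carrier L; y \<in> carrier L\<rbrakk> \<Longrightarrow> \<alpha> (x \<oplus> y) = \<alpha> x \<oplus> \<alpha> y"
    and "\<alpha> \<one> = \<one>" and z: "\<alpha> \<zero> = \<zero>" by simp_all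
  have "inj_on \<alpha> (carrier L)" using bij_G[OF assms] by (simp add: Bij_def bij_betw_def)
  then show "\<lbrakk>x \<in> carrier L; x \<noteq> \<zero>\<rbrakk> \<Longrightarrow> \<alpha> x \<noteq> \<zero>"
    using z by (metis inj_onD zero_closed)
qed

section \<open>Finitely generated modules over the valuation ring\<close>

definition Ov_module :: "'a set \<Rightarrow> bool" where
  "Ov_module M \<longleftrightarrow> M \<subseteq> carrier L \<and> \<zero> \<in> M \<and> (\<forall>x\<in>M. \<forall>y\<in>M. x \<oplus> y \<in> M) \<and> (\<forall>c\<in>Ov. \<forall>x\<in>M. c \<otimes> x \<in> M)"

lemma Ov_moduleI:
  "\<lbrakk>M \<subseteq> carrier L; \<zero> \<in> M; \<And>x y. \<lbrakk>x \<in> M; y \<in> M\<rbrakk> \<Longrightarrow> x \<oplus> y \<in> M;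
    \<And>c x. \<lbrakk>c \<in> Ov; x \<in> M\<rbrakk> \<Longrightarrow> c \<otimes> x \<in> M\<rbrakk> \<Longrightarrow> Ov_module M"
  by (simp add: Ov_module_def)

lemma Ov_moduleD:
  assumes "Ov_module M"
  shows "x \<in> M \<Longrightarrow> x \<in> carrier L" "\<zero> \<in> M" "\<lbrakk>x \<in> M; y \<in> M\<rbrakk> \<Longrightarrow> x \<oplus> y \<in> M"
    "\<lbrakk>c \<in> Ov; x \<in> M\<rbrakk> \<Longrightarrow> c \<otimes> x \<in> M"
  using assms by (auto simp: Ov_module_def)

text \<open>\<open>Span\<close> is applied to the ring \<open>Ov\<close> as well as to the field
  \<open>F\<close>. This unfolding holds for any set of coefficients and carries the inductions
  below.\<close>

lemma Span_Cons_iff: "x \<in> Span A (u # us) \<longleftrightarrow> (\<exists>c\<in>A. \<exists>y\<in>Span A us. x = c \<otimes> u \<oplus> y)"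
  by (simp add: line_extension_mem_iff)

lemma Span_Nil: "Span A [] = {\<zero>}" by simp

declare Span.simps [simp del]

lemma Ov_module_Span: "set us \<subseteq> carrier L \<Longrightarrow> Ov_module (Span Ov us)"
proof (induction us)
  case Nil
  then show ?case by (auto intro!: Ov_moduleI simp: Span_Nil Ov_carrier)
next
  case (Cons u us)
  then have IH: "Ov_module (Span Ov us)" and u: "u \<in> carrier L" by auto
  show ?case
  proof (rule Ov_moduleI)
    show "Span Ov (u # us) \<subseteq> carrier L"
      using u Ov_moduleD(1)[OF IH] by (auto simp: Span_Cons_iff Ov_carrier)
    have "\<zero> = \<zero> \<otimes> u \<oplus> \<zero>" using u by simp
    then show "\<zero> \<in> Span Ov (u # us)" using Ov_consts(1) Ov_moduleD(2)[OF IH] unfolding Span_Cons_iff by blast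
  next
    fix x y assume "x \<in> Span Ov (u # us)" "y \<in> Span Ov (u # us)"
    then obtain c a d b where *: "c \<in> Ov" "a \<in> Span Ov us" "x = c \<otimes> u \<oplus> a"
      "d \<in> Ov" "b \<in> Span Ov us" "y = d \<otimes> u \<oplus> b" unfolding Span_Cons_iff by blast
    moreover have "a \<in> carrier L" "b \<in> carrier L" using * Ov_moduleD(1)[OF IH] by auto
    ultimately have "x \<oplus> y = (c \<oplus> d) \<otimes> u \<oplus> (a \<oplus> b)"
      using u Ov_carrier[of c] Ov_carrier[of d] by simp algebra
    then show "x \<oplus> y \<in> Span Ov (u # us)"
      using * Ov_add Ov_moduleD(3)[OF IH] unfolding Span_Cons_iff by blast
  next
    fix e x assume e: "e \<in> Ov" and "x \<in> Span Ov (u # us)"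
    then obtain c a where *: "c \<in> Ov" "a \<in> Span Ov us" "x = c \<otimes> u \<oplus> a"
      unfolding Span_Cons_iff by blast
    moreover have "a \<in> carrier L" using * Ov_moduleD(1)[OF IH] by auto
    ultimately have "e \<otimes> x = (e \<otimes> c) \<otimes> u \<oplus> (e \<otimes> a)"
      using u Ov_carrier[of c] Ov_carrier[of e] e by simp algebra
    then show "e \<otimes> x \<in> Span Ov (u # us)"
      using * e Ov_mult Ov_moduleD(4)[OF IH] unfolding Span_Cons_iff by blast
  qed
qed

lemma Span_least: "\<lbrakk>Ov_module M; set us \<subseteq> M\<rbrakk> \<Longrightarrow> Span Ov us \<subseteq> M"
proof (induction us)
  case (Cons u us)
  then have IH: "Span Ov us \<subseteq> M" and u: "u \<in> M" by auto
  show ?case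
  proof
    fix x assume "x \<in> Span Ov (u # us)"
    then obtain c y where "c \<in> Ov" "y \<in> Span Ov us" "x = c \<otimes> u \<oplus> y" unfolding Span_Cons_iff by blast
    then show "x \<in> M" using IH u Ov_moduleD(3,4)[OF Cons.prems(1)] by blast
  qed
qed (simp add: Span_Nil Ov_moduleD)

lemma Span_incl: "\<lbrakk>set us \<subseteq> carrier L; u \<in> set us\<rbrakk> \<Longrightarrow> u \<in> Span Ov us"
proof (induction us)
  case (Cons a us)
  have m: "Ov_module (Span Ov us)" using Ov_module_Span Cons.prems by simp
  show ?case
  proof (cases "u = a")
    case True
    then have "u = \<one> \<otimes> a \<oplus> \<zero>" using Cons.prems by simp
    then show ?thesis using Ov_consts Ov_moduleD(2)[OF m] unfolding Span_Cons_iff by blast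
  next
    case False
    then have u: "u \<in> Span Ov us" using Cons by auto
    then have "u = \<zero> \<otimes> a \<oplus> u" using Cons.prems Ov_moduleD(1)[OF m u] by simp
    then show ?thesis using Ov_consts u unfolding Span_Cons_iff by blast
  qed
qed simp

lemma unif_pow_le:
  assumes M: "Ov_module M" and "x \<in> carrier L" "\<pi> [^] (k::nat) \<otimes> x \<in> M" "k \<le> n"
  shows "\<pi> [^] n \<otimes> x \<in> M"
proof -
  have "\<pi> [^] n = \<pi> [^] (n - k) \<otimes> \<pi> [^] k" using assms(4) unif_carrier by (simp add: nat_pow_mult)
  then have "\<pi> [^] n \<otimes> x = \<pi> [^] (n - k) \<otimes> (\<pi> [^] k \<otimes> x)"
    using assms unif_pow by (simp add: m_assoc)
  then show ?thesis using Ov_moduleD(4)[OF M unif_pow(5) assms(3)] by simp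
qed

text \<open>Clearing denominators: there are finitely many coefficients, and adding the exponents
  gives a common one.\<close>

lemma Span_F_scale:
  "\<lbrakk>set us \<subseteq> carrier L; x \<in> Span F us\<rbrakk> \<Longrightarrow> x \<in> carrier L \<and> (\<exists>k::nat. \<pi> [^] k \<otimes> x \<in> Span Ov us)"
proof (induction us arbitrary: x)
  case Nil
  then show ?case by (simp add: Span_Nil unif_pow)
next
  case (Cons u us)
  then obtain c y where cy: "c \<in> F" "y \<in> Span F us" "x = c \<otimes> u \<oplus> y" unfolding Span_Cons_iff by blast
  have u: "u \<in> carrier L" and us: "set us \<subseteq> carrier L" using Cons.prems by auto
  obtain k where y: "y \<in> carrier L" and k: "\<pi> [^] (k::nat) \<otimes> y \<in> Span Ov us"
    using Cons.IH[OF us cy(2)] by blast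
  obtain j where j: "\<pi> [^] (j::nat) \<otimes> c \<in> Ov" using Ov_scale cy(1) by blast
  have M: "Ov_module (Span Ov us)" by (rule Ov_module_Span[OF us])
  have O: "Ov_module Ov" by (rule Ov_moduleI) (auto simp: Ov_add Ov_mult Ov_carrier Ov_consts)
  let ?n = "j + k"
  have "\<pi> [^] ?n \<otimes> c \<in> Ov" "\<pi> [^] ?n \<otimes> y \<in> Span Ov us"
    using unif_pow_le[OF M y k, of ?n] unif_pow_le[OF O _ j, of ?n] F_carrier[OF cy(1)] by auto
  moreover have "\<pi> [^] ?n \<otimes> x = (\<pi> [^] ?n \<otimes> c) \<otimes> u \<oplus> \<pi> [^] ?n \<otimes> y"
    using cy u y F_carrier[OF cy(1)] unif_pow[of ?n] by (simp add: r_distr m_assoc)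
  ultimately have "\<pi> [^] ?n \<otimes> x \<in> Span Ov (u # us)" unfolding Span_Cons_iff by blast
  then show ?case using cy u y F_carrier by blast
qed

text \<open>Combining representatives of the coordinates gives representatives of the combination,
  whatever relations hold among the generators.\<close>

lemma Span_finite:
  "set us \<subseteq> carrier L \<Longrightarrow>
    \<exists>S. finite S \<and> S \<subseteq> Span Ov us \<and> (\<forall>x\<in>Span Ov us. \<exists>s\<in>S. \<exists>y\<in>Span Ov us. x = s \<oplus> \<pi> \<otimes> y)"
proof (induction us)
  case Nil
  have "\<zero> = \<zero> \<oplus> \<pi> \<otimes> \<zero>" using unif_carrier by simp
  then show ?case unfolding Span_Nil by blast
next
  case (Cons u us)
  then obtain S where S: "finite S" "S \<subseteq> Span Ov us" "\<And>x. x \<in> Span Ov us \<Longrightarrow> \<exists>s\<in>S. \<exists>y\<in>Span Ov us. x = s \<oplus> \<pi> \<otimes> y"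
    by auto
  obtain S' where S': "finite S'" "S' \<subseteq> Ov" "\<And>x. x \<in> Ov \<Longrightarrow> \<exists>s\<in>S'. \<exists>y\<in>Ov. x = s \<oplus> \<pi> \<otimes> y"
    using Ov_finite by blast
  have M: "Ov_module (Span Ov us)" using Ov_module_Span Cons.prems by simp
  have u: "u \<in> carrier L" using Cons.prems by simp
  let ?S = "(\<lambda>(c, s). c \<otimes> u \<oplus> s) ` (S' \<times> S)"
  have "\<exists>s\<in>?S. \<exists>y\<in>Span Ov (u # us). x = s \<oplus> \<pi> \<otimes> y" if x: "x \<in> Span Ov (u # us)" for x
  proof -
    obtain c y where cy: "c \<in> Ov" "y \<in> Span Ov us" "x = c \<otimes> u \<oplus> y" using x unfolding Span_Cons_iff by blast
    obtain s z where s: "s \<in> S" "z \<in> Span Ov us" "y = s \<oplus> \<pi> \<otimes> z" using S(3)[OF cy(2)] by blast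
    obtain s' z' where s': "s' \<in> S'" "z' \<in> Ov" "c = s' \<oplus> \<pi> \<otimes> z'" using S'(3)[OF cy(1)] by blast
    have c: "s \<in> carrier L" "z \<in> carrier L" "s' \<in> carrier L" "z' \<in> carrier L"
      using s s' S(2) S'(2) Ov_moduleD(1)[OF M] Ov_carrier by auto
    have "x = (s' \<otimes> u \<oplus> s) \<oplus> \<pi> \<otimes> (z' \<otimes> u \<oplus> z)"
      unfolding cy s s' using c u unif_carrier by algebra
    moreover have "s' \<otimes> u \<oplus> s \<in> ?S" using s(1) s'(1) by force
    moreover have "z' \<otimes> u \<oplus> z \<in> Span Ov (u # us)" using s(2) s'(2) unfolding Span_Cons_iff by blast
    ultimately show ?thesis by blast
  qed
  moreover have "?S \<subseteq> Span Ov (u # us)" using S(2) S'(2) by (fastforce simp: Span_Cons_iff)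
  ultimately show ?case using S(1) S'(1) by (intro exI[of _ ?S]) auto
qed

lemma partial_sum_carrier: "(\<And>i. d i \<in> carrier L) \<Longrightarrow> partial_sum d m \<in> carrier L"
  by (induction m) (auto simp: unif_pow)

lemma partial_sum_line:
  assumes "\<And>i. c i \<in> carrier L" "u \<in> carrier L" "\<And>i. e i \<in> carrier L"
  shows "partial_sum (\<lambda>i. c i \<otimes> u \<oplus> e i) m = partial_sum c m \<otimes> u \<oplus> partial_sum e m"
proof (induction m)
  case (Suc m)
  then show ?case
    using assms(2) assms(1,3)[of m] partial_sum_carrier[of c m, OF assms(1)] partial_sum_carrier[of e m, OF assms(3)] unif_pow[of m]
    by simp algebra
qed (use assms in simp)

text \<open>Coefficients of each \<open>d i\<close> are chosen arbitrarily, and every coordinate is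
  then a series converging in \<open>Ov\<close>. Relations among the generators do no harm, as only
  the existence of a limit is claimed.\<close>

lemma Span_complete:
  "\<lbrakk>set us \<subseteq> carrier L; \<And>i. d i \<in> Span Ov us\<rbrakk> \<Longrightarrow>
    \<exists>y\<in>Span Ov us. \<forall>m. \<exists>r\<in>Span Ov us. y = partial_sum d m \<oplus> \<pi> [^] m \<otimes> r"
proof (induction us arbitrary: d)
  case Nil
  then have "d = (\<lambda>i. \<zero>)" by (auto simp: Span_Nil)
  moreover have "partial_sum (\<lambda>i. \<zero>) m = \<zero>" for m by (induction m) (auto simp: unif_pow)
  ultimately show ?case by (auto simp: Span_Nil unif_pow)
next
  case (Cons u us)
  then have us: "set us \<subseteq> carrier L" and u: "u \<in> carrier L" by auto
  have M: "Ov_module (Span Ov us)" by (rule Ov_module_Span[OF us])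
  have "\<forall>i. \<exists>c e. c \<in> Ov \<and> e \<in> Span Ov us \<and> d i = c \<otimes> u \<oplus> e"
    using Cons.prems(2) unfolding Span_Cons_iff by blast
  then obtain c e where ce: "\<And>i. c i \<in> Ov" "\<And>i. e i \<in> Span Ov us" "\<And>i. d i = c i \<otimes> u \<oplus> e i" by metis
  have cc: "\<And>i. c i \<in> carrier L" and ec: "\<And>i. e i \<in> carrier L"
    using ce Ov_carrier Ov_moduleD(1)[OF M] by auto
  obtain y where y: "y \<in> Span Ov us" "\<And>m. \<exists>r\<in>Span Ov us. y = partial_sum e m \<oplus> \<pi> [^] m \<otimes> r"
    using Cons.IH[of e, OF us ce(2)] by auto
  obtain z where z: "z \<in> Ov" "\<And>m. \<exists>r\<in>Ov. z = partial_sum c m \<oplus> \<pi> [^] m \<otimes> r"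
    using Ov_complete[of c, OF ce(1)] unfolding partial_sum_def by auto
  have "d = (\<lambda>i. c i \<otimes> u \<oplus> e i)" using ce(3) by auto
  then have p: "partial_sum d m = partial_sum c m \<otimes> u \<oplus> partial_sum e m" for m using partial_sum_line[OF cc u ec] by simp
  have "\<exists>r\<in>Span Ov (u # us). z \<otimes> u \<oplus> y = partial_sum d m \<oplus> \<pi> [^] m \<otimes> r" for m
  proof -
    obtain r where r: "r \<in> Span Ov us" "y = partial_sum e m \<oplus> \<pi> [^] m \<otimes> r" using y(2) by blast
    obtain q where q: "q \<in> Ov" "z = partial_sum c m \<oplus> \<pi> [^] m \<otimes> q" using z(2) by blast
    have "(pc \<oplus> p \<otimes> q) \<otimes> u \<oplus> (pe \<oplus> p \<otimes> r) = (pc \<otimes> u \<oplus> pe) \<oplus> p \<otimes> (q \<otimes> u \<oplus> r)"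
      if "pc \<in> carrier L" "p \<in> carrier L" "pe \<in> carrier L" for pc p pe
      using that u Ov_carrier[OF q(1)] Ov_moduleD(1)[OF M r(1)] by algebra
    from this[OF partial_sum_carrier[of c m, OF cc] unif_pow(1)[of m] partial_sum_carrier[of e m, OF ec]]
    have "z \<otimes> u \<oplus> y = partial_sum d m \<oplus> \<pi> [^] m \<otimes> (q \<otimes> u \<oplus> r)"
      unfolding p r(2)[symmetric] q(2)[symmetric] .
    moreover have "q \<otimes> u \<oplus> r \<in> Span Ov (u # us)" using q(1) r(1) unfolding Span_Cons_iff by blast
    ultimately show ?thesis by (rule bexI)
  qed
  moreover have "z \<otimes> u \<oplus> y \<in> Span Ov (u # us)" using z y unfolding Span_Cons_iff by blast
  ultimately show ?case by blast
qed

section \<open>Trace and norm\<close>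

lemma G_ext: "\<lbrakk>\<alpha> \<in> G; \<beta> \<in> G; \<And>x. x \<in> carrier L \<Longrightarrow> \<alpha> x = \<beta> x\<rbrakk> \<Longrightarrow> \<alpha> = \<beta>"
  using bij_G by (auto simp: Bij_def intro: extensionalityI)

text \<open>Translation is injective, hence a permutation of the finite set \<open>G\<close>; it
  reindexes the sum and the product that define trace and norm.\<close>

lemma compose_left_G:
  assumes "\<alpha> \<in> G"
  shows "inj_on (compose (carrier L) \<alpha>) G" "compose (carrier L) \<alpha> ` G = G"
proof -
  have i: "inj_on \<alpha> (carrier L)" using bij_G[OF assms] by (simp add: Bij_def bij_betw_def)
  show inj: "inj_on (compose (carrier L) \<alpha>) G"
  proof (rule inj_onI)
    fix \<beta> \<gamma> assume *: "\<beta> \<in> G" "\<gamma> \<in> G" "compose (carrier L) \<alpha> \<beta> = compose (carrier L) \<alpha> \<gamma>"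
    have "\<alpha> (\<beta> x) = \<alpha> (\<gamma> x)" if "x \<in> carrier L" for x
      using fun_cong[OF *(3), of x] that by (simp add: compose_eq)
    then have "\<beta> x = \<gamma> x" if "x \<in> carrier L" for x
      using inj_onD[OF i] G_hom(1)[OF *(1) that] G_hom(1)[OF *(2) that] that by blast
    then show "\<beta> = \<gamma>" using G_ext * by blast
  qed
  show "compose (carrier L) \<alpha> ` G = G"
    by (rule endo_inj_surj[OF finite_G _ inj]) (use comp_G assms in auto)
qed

lemma compose_right_G:
  assumes "\<alpha> \<in> G"
  shows "inj_on (\<lambda>\<beta>. compose (carrier L) \<beta> \<alpha>) G" "(\<lambda>\<beta>. compose (carrier L) \<beta> \<alpha>) ` G = G"
proof -
  have s: "\<alpha> ` carrier L = carrier L" using bij_G[OF assms] by (simp add: Bij_def bij_betw_def)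
  show inj: "inj_on (\<lambda>\<beta>. compose (carrier L) \<beta> \<alpha>) G"
  proof (rule inj_onI)
    fix \<beta> \<gamma> assume *: "\<beta> \<in> G" "\<gamma> \<in> G" "compose (carrier L) \<beta> \<alpha> = compose (carrier L) \<gamma> \<alpha>"
    have "\<beta> (\<alpha> x) = \<gamma> (\<alpha> x)" if "x \<in> carrier L" for x
      using fun_cong[OF *(3), of x] that by (simp add: compose_eq)
    then have "\<beta> x = \<gamma> x" if "x \<in> carrier L" for x using s that by (metis imageE)
    then show "\<beta> = \<gamma>" using G_ext * by blast
  qed
  show "(\<lambda>\<beta>. compose (carrier L) \<beta> \<alpha>) ` G = G"
    by (rule endo_inj_surj[OF finite_G _ inj]) (use comp_G assms in auto)
qed

definition field_trace :: "'a \<Rightarrow> 'a" where "field_trace x = finsum L (\<lambda>\<alpha>. \<alpha> x) G"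
definition field_norm :: "'a \<Rightarrow> 'a" where "field_norm x = finprod L (\<lambda>\<alpha>. \<alpha> x) G"

lemma orbit_funcset: "x \<in> carrier L \<Longrightarrow> (\<lambda>\<alpha>. \<alpha> x) \<in> G \<rightarrow> carrier L"
  by (simp add: G_hom)

lemma field_trace_carrier: "x \<in> carrier L \<Longrightarrow> field_trace x \<in> carrier L"
  unfolding field_trace_def by (intro finsum_closed orbit_funcset)

lemma field_norm_carrier: "x \<in> carrier L \<Longrightarrow> field_norm x \<in> carrier L"
  unfolding field_norm_def by (intro finprod_closed orbit_funcset)

lemma field_trace_in_F: assumes x: "x \<in> carrier L" shows "field_trace x \<in> F"
proof (rule G_fixed[OF field_trace_carrier[OF x]])
  fix \<alpha> assume \<alpha>: "\<alpha> \<in> G"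
  interpret h: ring_hom_cring L L \<alpha> by unfold_locales (rule hom_G[OF \<alpha>])
  have "\<alpha> (field_trace x) = finsum L (\<lambda>\<beta>. compose (carrier L) \<alpha> \<beta> x) G"
    unfolding field_trace_def using orbit_funcset[OF x] x by (simp add: comp_def compose_eq)
  also have "\<dots> = finsum L (\<lambda>\<beta>. \<beta> x) (compose (carrier L) \<alpha> ` G)"
    by (rule add.finprod_reindex[symmetric]) (use orbit_funcset[OF x] compose_left_G[OF \<alpha>] in auto)
  finally show "\<alpha> (field_trace x) = field_trace x" by (simp add: compose_left_G[OF \<alpha>] field_trace_def)
qed

lemma field_norm_in_F: assumes x: "x \<in> carrier L" shows "field_norm x \<in> F"
proof (rule G_fixed[OF field_norm_carrier[OF x]])
  fix \<alpha> assume \<alpha>: "\<alpha> \<in> G"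
  interpret h: ring_hom_cring L L \<alpha> by unfold_locales (rule hom_G[OF \<alpha>])
  have "\<alpha> (field_norm x) = finprod L (\<lambda>\<beta>. compose (carrier L) \<alpha> \<beta> x) G"
    unfolding field_norm_def using orbit_funcset[OF x] x by (simp add: h.hom_finprod comp_def compose_eq)
  also have "\<dots> = finprod L (\<lambda>\<beta>. \<beta> x) (compose (carrier L) \<alpha> ` G)"
    by (rule finprod_reindex[symmetric]) (use orbit_funcset[OF x] compose_left_G[OF \<alpha>] in auto)
  finally show "\<alpha> (field_norm x) = field_norm x" by (simp add: compose_left_G[OF \<alpha>] field_norm_def)
qed

text \<open>Right translation permutes the factors. The invariance of the extended valuation under
  \<open>G\<close> rests on this.\<close>

lemma field_norm_G: assumes \<alpha>: "\<alpha> \<in> G" and x: "x \<in> carrier L" shows "field_norm (\<alpha> x) = field_norm x"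
proof -
  have "field_norm (\<alpha> x) = finprod L (\<lambda>\<beta>. compose (carrier L) \<beta> \<alpha> x) G"
    unfolding field_norm_def using x by (simp add: compose_eq)
  also have "\<dots> = finprod L (\<lambda>\<beta>. \<beta> x) ((\<lambda>\<beta>. compose (carrier L) \<beta> \<alpha>) ` G)"
    by (rule finprod_reindex[symmetric]) (use orbit_funcset[OF x] compose_right_G[OF \<alpha>] in auto)
  finally show ?thesis by (simp add: compose_right_G[OF \<alpha>] field_norm_def)
qed

lemma field_norm_mult: "\<lbrakk>x \<in> carrier L; y \<in> carrier L\<rbrakk> \<Longrightarrow> field_norm (x \<otimes> y) = field_norm x \<otimes> field_norm y"
proof -
  assume x: "x \<in> carrier L" and y: "y \<in> carrier L"
  have "field_norm (x \<otimes> y) = finprod L (\<lambda>\<alpha>. \<alpha> x \<otimes> \<alpha> y) G"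
    unfolding field_norm_def using x y by (intro finprod_cong') (auto simp: G_hom)
  also have "\<dots> = field_norm x \<otimes> field_norm y"
    unfolding field_norm_def by (rule finprod_multf) (use orbit_funcset x y in auto)
  finally show ?thesis .
qed

lemma field_norm_F: "x \<in> F \<Longrightarrow> field_norm x = x [^] card G"
proof -
  assume x: "x \<in> F"
  have "field_norm x = finprod L (\<lambda>_. x) G"
    unfolding field_norm_def using x F_carrier[OF x] by (intro finprod_cong') (auto simp: G_fixes)
  then show ?thesis using finprod_const[OF F_carrier[OF x]] by simp
qed

lemma field_norm_nonzero: assumes "x \<in> carrier L" "x \<noteq> \<zero>" shows "field_norm x \<noteq> \<zero>"
proof
  assume "field_norm x = \<zero>"
  then have "field_norm (x \<otimes> inv x) = \<zero>"
    using assms nonzero_inv(1)[OF assms] field_norm_carrier by (simp only: field_norm_mult l_null)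
  then show False using nonzero_inv[OF assms] field_norm_F[of \<one>] F_closed by simp
qed

lemma field_trace_add: "\<lbrakk>x \<in> carrier L; y \<in> carrier L\<rbrakk> \<Longrightarrow> field_trace (x \<oplus> y) = field_trace x \<oplus> field_trace y"
proof -
  assume x: "x \<in> carrier L" and y: "y \<in> carrier L"
  have "field_trace (x \<oplus> y) = finsum L (\<lambda>\<alpha>. \<alpha> x \<oplus> \<alpha> y) G"
    unfolding field_trace_def using x y by (intro finsum_cong') (auto simp: G_hom)
  also have "\<dots> = field_trace x \<oplus> field_trace y"
    unfolding field_trace_def by (rule finsum_addf) (use orbit_funcset x y in auto)
  finally show ?thesis .
qed

lemma field_trace_scale:
  assumes "a \<in> F" "x \<in> carrier L" shows "field_trace (a \<otimes> x) = a \<otimes> field_trace x"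
proof -
  have "a \<otimes> field_trace x = finsum L (\<lambda>\<alpha>. a \<otimes> \<alpha> x) G"
    unfolding field_trace_def using assms finite_G F_carrier orbit_funcset by (intro finsum_rdistr) auto
  also have "\<dots> = field_trace (a \<otimes> x)"
    unfolding field_trace_def using assms F_carrier by (intro finsum_cong') (auto simp: G_hom G_fixes)
  finally show ?thesis by simp
qed

lemma field_trace_F: assumes "a \<in> F" shows "field_trace a = a \<otimes> field_trace \<one>"
  using field_trace_scale[OF assms one_closed] F_carrier[OF assms] by simp

text \<open>The trace of one is the order of \<open>G\<close>, nonzero by \<open>card_G\<close>. It
  therefore has a definite valuation, against which \<open>R_F\<close> balances
  denominators.\<close>

lemma field_trace_one: "field_trace \<one> \<noteq> \<zero>"
proof -
  have "field_trace \<one> = finsum L (\<lambda>_. \<one>) G"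
    unfolding field_trace_def by (intro finsum_cong') (auto simp: G_hom)
  also have "\<dots> = add_pow L (card G) \<one>" by (simp add: add.finprod_const)
  finally show ?thesis using card_G by simp
qed

section \<open>Construction of the order\<close>

lemma uniform_scale:
  assumes "finite A" "A \<subseteq> carrier L" and M: "Ov_module M"
    and "\<And>z. z \<in> A \<Longrightarrow> \<exists>k::nat. \<pi> [^] k \<otimes> z \<in> M"
  shows "\<exists>k::nat. \<forall>z\<in>A. \<pi> [^] k \<otimes> z \<in> M"
proof -
  have "\<forall>z\<in>A. \<exists>k::nat. \<pi> [^] k \<otimes> z \<in> M" using assms(4) by blast
  then obtain f where f: "\<And>z. z \<in> A \<Longrightarrow> \<pi> [^] (f z :: nat) \<otimes> z \<in> M" by metis
  have "\<pi> [^] Max (f ` A) \<otimes> z \<in> M" if z: "z \<in> A" for z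
  proof (rule unif_pow_le[OF M _ f[OF z]])
    show "f z \<le> Max (f ` A)" using z assms(1) by simp
  qed (use z assms(2) in auto)
  then show ?thesis by (intro exI[of _ "Max (f ` A)"]) simp
qed

text \<open>Together with \<open>Span_least\<close> this lets inclusions be checked on generators
  only; \<open>h\<close> will be multiplication by an element, an automorphism, or a multiple of the
  trace.\<close>

lemma Ov_module_vimage:
  assumes M: "Ov_module M" and h: "\<And>x. x \<in> carrier L \<Longrightarrow> h x \<in> carrier L"
    "\<And>x y. \<lbrakk>x \<in> carrier L; y \<in> carrier L\<rbrakk> \<Longrightarrow> h (x \<oplus> y) = h x \<oplus> h y"
    "\<And>c x. \<lbrakk>c \<in> Ov; x \<in> carrier L\<rbrakk> \<Longrightarrow> h (c \<otimes> x) = c \<otimes> h x"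
  shows "Ov_module {x \<in> carrier L. h x \<in> M}"
proof (rule Ov_moduleI)
  have "h \<zero> = \<zero>" using h(3)[of \<zero> \<zero>] Ov_consts h(1)[of \<zero>] by simp
  then show "\<zero> \<in> {x \<in> carrier L. h x \<in> M}" using Ov_moduleD(2)[OF M] by simp
qed (use h Ov_moduleD[OF M] Ov_carrier in auto)

lemma Ov_module_mult: "\<lbrakk>Ov_module M; z \<in> carrier L\<rbrakk> \<Longrightarrow> Ov_module {x \<in> carrier L. z \<otimes> x \<in> M}"
  by (rule Ov_module_vimage) (auto simp: r_distr Ov_carrier m_lcomm)

lemma Ov_module_Ov: "Ov_module Ov" by (rule Ov_moduleI) (auto simp: Ov_add Ov_mult Ov_carrier Ov_consts)

text \<open>The \<open>Ov\<close>-span \<open>M\<close> of the \<open>G\<close>-orbit of a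
  generating set is \<open>G\<close>-stable but need not be closed under products. If
  \<open>\<pi>\<^sup>k\<close> carries all products of generators into \<open>M\<close>, then
  \<open>R = Ov + \<pi>\<^sup>k M\<close> is a ring, since \<open>(\<pi>\<^sup>k a) (\<pi>\<^sup>k
  b) = \<pi>\<^sup>k (\<pi>\<^sup>k a b)\<close>.\<close>

lemma order_exists:
  obtains R where "Ov_module R" "\<one> \<in> R" "\<And>x y. \<lbrakk>x \<in> R; y \<in> R\<rbrakk> \<Longrightarrow> x \<otimes> y \<in> R"
    "\<And>\<alpha> x. \<lbrakk>\<alpha> \<in> G; x \<in> R\<rbrakk> \<Longrightarrow> \<alpha> x \<in> R"
    "\<And>z. z \<in> carrier L \<Longrightarrow> \<exists>k::nat. \<pi> [^] k \<otimes> z \<in> R"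
    "\<exists>S. finite S \<and> S \<subseteq> R \<and> (\<forall>x\<in>R. \<exists>s\<in>S. \<exists>y\<in>R. x = s \<oplus> \<pi> \<otimes> y)"
    "\<And>d. (\<And>i. d i \<in> R) \<Longrightarrow> \<exists>y\<in>R. \<forall>m. \<exists>r\<in>R. y = partial_sum d m \<oplus> \<pi> [^] m \<otimes> r"
    "\<exists>k::nat. \<forall>x\<in>R. \<pi> [^] k \<otimes> field_trace x \<in> Ov"
proof -
  obtain bs where bs: "set bs \<subseteq> carrier L" "Span F bs = carrier L" using finite_span by blast
  have "finite ((\<lambda>(\<alpha>, b). \<alpha> b) ` (G \<times> set bs))" using finite_G by simp
  then obtain us where us: "set us = (\<lambda>(\<alpha>, b). \<alpha> b) ` (G \<times> set bs)" by (metis finite_list)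
  have usc: "set us \<subseteq> carrier L" using bs(1) G_hom(1) by (auto simp: us)
  have bs_us: "set bs \<subseteq> set us"
  proof
    fix b assume "b \<in> set bs"
    then show "b \<in> set us" unfolding us using id_G bs(1) by (intro image_eqI[of _ _ "(\<lambda>x\<in>carrier L. x, b)"]) auto
  qed
  have us_G: "\<alpha> u \<in> set us" if \<alpha>: "\<alpha> \<in> G" and u: "u \<in> set us" for \<alpha> u
  proof -
    obtain \<beta> b where b: "\<beta> \<in> G" "b \<in> set bs" "u = \<beta> b" using u us by auto
    then have "\<alpha> u = compose (carrier L) \<alpha> \<beta> b" using bs(1) by (auto simp: compose_eq)
    then show ?thesis unfolding us using comp_G[OF \<alpha> b(1)] b(2)
      by (intro image_eqI[of _ _ "(compose (carrier L) \<alpha> \<beta>, b)"]) auto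
  qed
  define M where "M = Span Ov us"
  have M: "Ov_module M" unfolding M_def by (rule Ov_module_Span[OF usc])
  have us_M: "set us \<subseteq> M" unfolding M_def using Span_incl[OF usc] by blast
  have scale_M: "\<exists>k::nat. \<pi> [^] k \<otimes> z \<in> M" if z: "z \<in> carrier L" for z
  proof -
    have "Span Ov bs \<subseteq> M" using Span_least[OF M, of bs] bs_us us_M by blast
    then show ?thesis using Span_F_scale[OF bs(1), of z] bs(2) z by blast
  qed
  \<comment> \<open>The finitely many products of two generators share one exponent.\<close>
  have "\<exists>k::nat. \<forall>z\<in>(\<lambda>(x, y). x \<otimes> y) ` (set us \<times> set us). \<pi> [^] k \<otimes> z \<in> M"
    using usc by (intro uniform_scale[OF _ _ M] scale_M) auto
  then obtain k :: nat where k: "\<And>x y. \<lbrakk>x \<in> set us; y \<in> set us\<rbrakk> \<Longrightarrow> \<pi> [^] k \<otimes> (x \<otimes> y) \<in> M" by fastforce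
  let ?p = "\<pi> [^] k"
  define ws where "ws = \<one> # map (\<lambda>u. ?p \<otimes> u) us"
  define R where "R = Span Ov ws"
  have wsc: "set ws \<subseteq> carrier L" using usc unif_pow by (auto simp: ws_def)
  have R: "Ov_module R" unfolding R_def by (rule Ov_module_Span[OF wsc])
  have ws_R: "set ws \<subseteq> R" unfolding R_def using Span_incl[OF wsc] by blast
  have Rc: "R \<subseteq> carrier L" using Ov_moduleD(1)[OF R] by blast
  have M_R: "?p \<otimes> x \<in> R" if x: "x \<in> M" for x
  proof -
    have "M \<subseteq> {x \<in> carrier L. ?p \<otimes> x \<in> R}"
      unfolding M_def by (rule Span_least[OF Ov_module_mult[OF R unif_pow(1)]]) (use usc ws_R in \<open>auto simp: ws_def\<close>)
    then show ?thesis using x by blast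
  qed
  have one: "\<one> \<in> R" using ws_R by (simp add: ws_def)
  have ww: "x \<otimes> y \<in> R" if "x \<in> set ws" "y \<in> set ws" for x y
  proof -
    have "(?p \<otimes> a) \<otimes> (?p \<otimes> b) \<in> R" if ab: "a \<in> set us" "b \<in> set us" for a b
    proof -
      have "a \<in> carrier L" "b \<in> carrier L" using ab usc by auto
      then have "(?p \<otimes> a) \<otimes> (?p \<otimes> b) = ?p \<otimes> (?p \<otimes> (a \<otimes> b))" using unif_pow(1)[of k] by algebra
      then show ?thesis using M_R[OF k[OF ab]] by simp
    qed
    moreover have "z \<in> R \<and> z \<in> carrier L" if "z \<in> set ws" for z using that ws_R wsc by blast
    ultimately show ?thesis using that by (auto simp: ws_def)
  qed
  \<comment> \<open>Closure under products in two rounds: a generator times an element, then, by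
    commutativity, two elements.\<close>
  have wR: "x \<otimes> y \<in> R" if x: "x \<in> set ws" and y: "y \<in> R" for x y
  proof -
    have "R \<subseteq> {y \<in> carrier L. x \<otimes> y \<in> R}"
      unfolding R_def[of] by (rule Span_least[OF Ov_module_mult[OF R[unfolded R_def]]])
        (use x wsc ww in \<open>auto simp: R_def\<close>)
    then show ?thesis using y by blast
  qed
  have mult: "x \<otimes> y \<in> R" if x: "x \<in> R" and y: "y \<in> R" for x y
  proof -
    have "R \<subseteq> {y \<in> carrier L. x \<otimes> y \<in> R}"
    proof -
      have "set ws \<subseteq> {y \<in> carrier L. x \<otimes> y \<in> R}"
        using wR[OF _ x] wsc Rc x by (auto simp: m_comm subset_iff)
      then show ?thesis
        using Span_least[OF Ov_module_mult[OF R], of x ws] Rc x by (auto simp: R_def)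
    qed
    then show ?thesis using y by blast
  qed
  show ?thesis
  proof (rule that[OF R one mult])
    fix \<alpha> x assume \<alpha>: "\<alpha> \<in> G" and x: "x \<in> R"
    have "Ov_module {x \<in> carrier L. \<alpha> x \<in> R}"
      using G_hom[OF \<alpha>] G_fixes[OF \<alpha>] Ov_carrier by (intro Ov_module_vimage[OF R]) (auto simp: Ov_eq)
    moreover have "set ws \<subseteq> {x \<in> carrier L. \<alpha> x \<in> R}"
      using one us_G[OF \<alpha>] ws_R usc G_hom[OF \<alpha>] G_fixes[OF \<alpha> unif_pow(2)] unif_pow(1)
      by (auto simp: ws_def subset_iff)
    ultimately show "\<alpha> x \<in> R" using Span_least x unfolding R_def by blast
  next
    fix z assume z: "z \<in> carrier L"
    then obtain j :: nat where "\<pi> [^] j \<otimes> z \<in> M" using scale_M by blast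
    then have "?p \<otimes> (\<pi> [^] j \<otimes> z) \<in> R" by (rule M_R)
    then have "\<pi> [^] (k + j) \<otimes> z \<in> R" using z unif_carrier by (simp add: m_assoc[symmetric] nat_pow_mult)
    then show "\<exists>k::nat. \<pi> [^] k \<otimes> z \<in> R" by blast
  next
    show "\<exists>S. finite S \<and> S \<subseteq> R \<and> (\<forall>x\<in>R. \<exists>s\<in>S. \<exists>y\<in>R. x = s \<oplus> \<pi> \<otimes> y)"
      unfolding R_def by (rule Span_finite[OF wsc])
  next
    fix d :: "nat \<Rightarrow> 'a" assume "\<And>i. d i \<in> R"
    then show "\<exists>y\<in>R. \<forall>m. \<exists>r\<in>R. y = partial_sum d m \<oplus> \<pi> [^] m \<otimes> r"
      unfolding R_def by (rule Span_complete[OF wsc])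
  next
    \<comment> \<open>One exponent clears the denominators of the traces of all generators;
      linearity of the trace extends it to \<open>R\<close>.\<close>
    have "\<exists>k::nat. \<forall>z\<in>field_trace ` set ws. \<pi> [^] k \<otimes> z \<in> Ov"
      using wsc field_trace_carrier by (intro uniform_scale[OF _ _ Ov_module_Ov]) (auto intro!: Ov_scale field_trace_in_F)
    then obtain n :: nat where n: "\<And>x. x \<in> set ws \<Longrightarrow> \<pi> [^] n \<otimes> field_trace x \<in> Ov" by blast
    have "Ov_module {x \<in> carrier L. \<pi> [^] n \<otimes> field_trace x \<in> Ov}"
    proof (rule Ov_module_vimage[OF Ov_module_Ov])
      fix c x assume c: "c \<in> Ov" and x: "x \<in> carrier L"
      then have "field_trace (c \<otimes> x) = c \<otimes> field_trace x" using field_trace_scale by (simp add: Ov_eq)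
      then show "\<pi> [^] n \<otimes> field_trace (c \<otimes> x) = c \<otimes> (\<pi> [^] n \<otimes> field_trace x)"
        using c x field_trace_carrier[OF x] Ov_carrier unif_pow(1) by (simp add: m_lcomm)
    qed (auto simp: field_trace_carrier unif_pow field_trace_add r_distr)
    then have "R \<subseteq> {x \<in> carrier L. \<pi> [^] n \<otimes> field_trace x \<in> Ov}"
      unfolding R_def using n wsc by (intro Span_least) auto
    then show "\<exists>k::nat. \<forall>x\<in>R. \<pi> [^] k \<otimes> field_trace x \<in> Ov" by blast
  qed
qed

end

section \<open>Extension of the valuation\<close>

text \<open>Meant for the value group of the norm valuation, a nonzero subgroup of the integers.
  \<open>d\<close> is its least positive element, and division with remainder does the rest.\<close>

lemma int_subgroup_cyclic:
  fixes H :: "int set"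
  assumes diff: "\<And>a b. \<lbrakk>a \<in> H; b \<in> H\<rbrakk> \<Longrightarrow> a - b \<in> H" and c: "c \<in> H" "c \<noteq> 0"
  obtains d where "d > 0" "H = range ((*) d)"
proof -
  have zero: "0 \<in> H" using diff[OF c(1) c(1)] by simp
  have uminus: "- a \<in> H" if "a \<in> H" for a using diff[OF zero that] by simp
  have add: "a + b \<in> H" if "a \<in> H" "b \<in> H" for a b using diff[OF that(1) uminus[OF that(2)]] by simp
  define d where "d = (LEAST k::nat. 0 < k \<and> int k \<in> H)"
  have "0 < nat \<bar>c\<bar> \<and> int (nat \<bar>c\<bar>) \<in> H" using c uminus[OF c(1)] by (auto simp: abs_if)
  then have "0 < d \<and> int d \<in> H" unfolding d_def by (rule LeastI)
  then have d: "0 < d" "int d \<in> H" by auto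
  have d_le: "d \<le> k" if "0 < k" "int k \<in> H" for k
    unfolding d_def using that by (intro Least_le) simp
  have mult_nat: "int d * int n \<in> H" for n
    by (induction n) (auto simp: zero algebra_simps intro: add d)
  have mult: "int d * k \<in> H" for k
    using mult_nat[of "nat k"] uminus[OF mult_nat[of "nat (- k)"]] by (cases "k \<ge> 0") auto
  have "a \<in> range ((*) (int d))" if a: "a \<in> H" for a
  proof -
    have "a mod int d = a - int d * (a div int d)" by (simp add: minus_mult_div_eq_mod)
    then have m: "a mod int d \<in> H" using diff[OF a mult] by simp
    have lt: "0 \<le> a mod int d" "a mod int d < int d" using d by auto
    have "a mod int d = 0"
    proof (rule ccontr)
      assume "a mod int d \<noteq> 0"
      then have "d \<le> nat (a mod int d)" using lt m by (intro d_le) auto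
      then show False using lt by linarith
    qed
    then show ?thesis by (auto elim!: dvdE simp: mod_eq_0_iff_dvd)
  qed
  then have "H = range ((*) (int d))" using mult by auto
  then show ?thesis using that[of "int d"] d by simp
qed

text \<open>Fixes an order as supplied by \<open>order_exists\<close>. Its finite generation
  survives only through the finiteness, completeness and trace clauses.\<close>

locale galois_order = galois_over_complete +
  fixes R :: "'a set"
  assumes Ov_module_R: "Ov_module R" and R_one: "\<one> \<in> R" and R_mult: "\<lbrakk>x \<in> R; y \<in> R\<rbrakk> \<Longrightarrow> x \<otimes> y \<in> R"
    and R_G: "\<lbrakk>\<alpha> \<in> G; x \<in> R\<rbrakk> \<Longrightarrow> \<alpha> x \<in> R"
    and R_scale: "z \<in> carrier L \<Longrightarrow> \<exists>k::nat. \<pi> [^] k \<otimes> z \<in> R"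
    and R_finite: "\<exists>S. finite S \<and> S \<subseteq> R \<and> (\<forall>x\<in>R. \<exists>s\<in>S. \<exists>y\<in>R. x = s \<oplus> \<pi> \<otimes> y)"
    and R_complete: "(\<And>i. d i \<in> R) \<Longrightarrow> \<exists>y\<in>R. \<forall>m. \<exists>r\<in>R. y = partial_sum d m \<oplus> \<pi> [^] m \<otimes> r"
    and R_trace: "\<exists>k::nat. \<forall>x\<in>R. \<pi> [^] k \<otimes> field_trace x \<in> Ov"
begin

lemmas R_carrier = Ov_moduleD(1)[OF Ov_module_R] and R_zero = Ov_moduleD(2)[OF Ov_module_R]
  and R_add = Ov_moduleD(3)[OF Ov_module_R] and R_smult = Ov_moduleD(4)[OF Ov_module_R]

lemma R_minus: assumes "x \<in> R" shows "\<ominus> x \<in> R"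
proof -
  have "\<ominus> x = \<ominus> \<one> \<otimes> x" using R_carrier[OF assms] by algebra
  then show ?thesis using R_smult[OF Ov_consts(3) assms] by simp
qed

lemma Ov_R: "x \<in> Ov \<Longrightarrow> x \<in> R"
  using R_smult[OF _ R_one, of x] Ov_carrier by simp

lemma R_pow: "x \<in> R \<Longrightarrow> x [^] (n::nat) \<in> R"
  by (induction n) (auto simp: R_one R_mult)

section \<open>Congruences modulo powers of the uniformizer\<close>

definition cong_pow :: "nat \<Rightarrow> 'a \<Rightarrow> 'a \<Rightarrow> bool" where
  "cong_pow m x y \<longleftrightarrow> (\<exists>r\<in>R. x = y \<oplus> \<pi> [^] m \<otimes> r)"

lemma cong_pow_refl: "x \<in> carrier L \<Longrightarrow> cong_pow m x x"
  unfolding cong_pow_def using R_zero unif_pow by (intro bexI[of _ \<zero>]) auto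

lemma cong_pow_sym: assumes "cong_pow m x y" "y \<in> carrier L" shows "cong_pow m y x"
proof -
  obtain r where r: "r \<in> R" "x = y \<oplus> \<pi> [^] m \<otimes> r" using assms(1) cong_pow_def by blast
  have "y = (y \<oplus> \<pi> [^] m \<otimes> r) \<oplus> \<pi> [^] m \<otimes> (\<ominus> r)"
    using assms(2) R_carrier[OF r(1)] unif_pow(1)[of m] by algebra
  then show ?thesis using R_minus[OF r(1)] r(2) unfolding cong_pow_def by blast
qed

lemma cong_pow_trans: assumes "cong_pow m x y" "cong_pow m y z" "z \<in> carrier L" shows "cong_pow m x z"
proof -
  obtain r where r: "r \<in> R" "x = y \<oplus> \<pi> [^] m \<otimes> r" using assms(1) cong_pow_def by blast
  obtain s where s: "s \<in> R" "y = z \<oplus> \<pi> [^] m \<otimes> s" using assms(2) cong_pow_def by blast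
  have "x = z \<oplus> \<pi> [^] m \<otimes> (s \<oplus> r)"
    unfolding r(2) s(2) using assms(3) R_carrier[OF r(1)] R_carrier[OF s(1)] unif_pow(1)[of m] by algebra
  then show ?thesis using R_add[OF s(1) r(1)] unfolding cong_pow_def by blast
qed

lemma cong_pow_mult:
  assumes "cong_pow m x y" "cong_pow m x' y'" "y \<in> R" "y' \<in> R" shows "cong_pow m (x \<otimes> x') (y \<otimes> y')"
proof -
  obtain r where r: "r \<in> R" "x = y \<oplus> \<pi> [^] m \<otimes> r" using assms(1) cong_pow_def by blast
  obtain s where s: "s \<in> R" "x' = y' \<oplus> \<pi> [^] m \<otimes> s" using assms(2) cong_pow_def by blast
  have "x \<otimes> x' = y \<otimes> y' \<oplus> \<pi> [^] m \<otimes> (y \<otimes> s \<oplus> r \<otimes> y' \<oplus> \<pi> [^] m \<otimes> (r \<otimes> s))"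
    unfolding r(2) s(2)
    using assms(3,4)[THEN R_carrier] R_carrier[OF r(1)] R_carrier[OF s(1)] unif_pow(1)[of m] by algebra
  moreover have "y \<otimes> s \<oplus> r \<otimes> y' \<oplus> \<pi> [^] m \<otimes> (r \<otimes> s) \<in> R"
    using r s assms unif_pow(5) by (intro R_add R_smult R_mult) auto
  ultimately show ?thesis unfolding cong_pow_def by blast
qed

text \<open>Membership in \<open>R\<close> is carried through the induction because
  \<open>cong_pow_mult\<close> asks for it.\<close>

lemma cong_pow_finprod:
  assumes "finite A" "\<And>a. a \<in> A \<Longrightarrow> f a \<in> R" "\<And>a. a \<in> A \<Longrightarrow> g a \<in> R" "\<And>a. a \<in> A \<Longrightarrow> cong_pow m (f a) (g a)"
  shows "finprod L f A \<in> R \<and> finprod L g A \<in> R \<and> cong_pow m (finprod L f A) (finprod L g A)"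
  using assms
proof (induction A rule: finite_induct)
  case empty
  then show ?case by (simp add: R_one cong_pow_refl)
next
  case (insert a A)
  then have "f \<in> A \<rightarrow> carrier L" "g \<in> A \<rightarrow> carrier L" "f a \<in> carrier L" "g a \<in> carrier L"
    using R_carrier by auto
  with insert show ?case by (simp add: R_mult cong_pow_mult)
qed

lemma field_norm_R: "x \<in> R \<Longrightarrow> field_norm x \<in> R"
  unfolding field_norm_def using cong_pow_finprod[OF finite_G, of "\<lambda>\<alpha>. \<alpha> x" "\<lambda>\<alpha>. \<alpha> x" 0] R_G cong_pow_refl R_carrier by blast

text \<open>Continuity of the norm: automorphisms in \<open>G\<close> fix \<open>\<pi>\<close> and
  preserve \<open>R\<close>, so conjugates of congruent elements are congruent.\<close>

lemma field_norm_cong_pow: assumes "x \<in> R" "y \<in> R" "cong_pow m x y" shows "cong_pow m (field_norm x) (field_norm y)"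
proof -
  have "cong_pow m (\<alpha> x) (\<alpha> y)" if \<alpha>: "\<alpha> \<in> G" for \<alpha>
  proof -
    obtain r where r: "r \<in> R" "x = y \<oplus> \<pi> [^] m \<otimes> r" using assms(3) cong_pow_def by blast
    have "\<alpha> x = \<alpha> y \<oplus> \<pi> [^] m \<otimes> \<alpha> r"
      unfolding r(2) using R_carrier[OF r(1)] R_carrier[OF assms(2)] unif_pow(1,2)[of m]
      by (simp add: G_hom[OF \<alpha>] G_fixes[OF \<alpha>])
    then show ?thesis using R_G[OF \<alpha> r(1)] cong_pow_def by blast
  qed
  then show ?thesis
    unfolding field_norm_def using cong_pow_finprod[OF finite_G, of "\<lambda>\<alpha>. \<alpha> x" "\<lambda>\<alpha>. \<alpha> y" m] R_G assms by blast
qed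

text \<open>The traces of the powers of an element of \<open>F\<close> outside \<open>Ov\<close> have unbounded denominators.\<close>

lemma R_F: assumes "x \<in> R" "x \<in> F" shows "x \<in> Ov"
proof (rule ccontr)
  assume "x \<notin> Ov"
  then have x: "x \<noteq> \<zero>" "v x < 0" using assms(2) by (auto simp: Ov_eq)
  obtain k :: nat where k: "\<And>y. y \<in> R \<Longrightarrow> \<pi> [^] k \<otimes> field_trace y \<in> Ov" using R_trace by blast
  \<comment> \<open>Chosen so that \<open>k + n * v x + v (field_trace \<one>)\<close> is negative,
    as \<open>v x\<close> is at most -1.\<close>
  define n where "n = Suc (k + nat \<bar>v (field_trace \<one>)\<bar>)"
  have xn: "x [^] n \<in> F" "x [^] n \<noteq> \<zero>" using assms x F_pow pow_nonzero F_carrier by auto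
  have t: "field_trace \<one> \<in> F" "field_trace \<one> \<noteq> \<zero>" using field_trace_in_F field_trace_one by auto
  have xt: "x [^] n \<otimes> field_trace \<one> \<in> F" "x [^] n \<otimes> field_trace \<one> \<noteq> \<zero>"
    using xn t F_carrier by (auto simp: integral_iff intro: F_closed)
  have nz: "\<pi> [^] k \<otimes> (x [^] n \<otimes> field_trace \<one>) \<noteq> \<zero>"
    using xt unif_pow F_carrier by (auto simp: integral_iff)
  have "v (\<pi> [^] k \<otimes> (x [^] n \<otimes> field_trace \<one>)) = int k + (int n * v x + v (field_trace \<one>))"
    using v_mult[of "\<pi> [^] k" "x [^] n \<otimes> field_trace \<one>"] v_mult[of "x [^] n" "field_trace \<one>"] xn t xt unif_pow
      v_pow[OF assms(2) x(1)] by simp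
  moreover have "\<pi> [^] k \<otimes> (x [^] n \<otimes> field_trace \<one>) \<in> Ov" using k[OF R_pow[OF assms(1), of n]] field_trace_F[OF xn(1)] by simp
  ultimately have "0 \<le> int k + (int n * v x + v (field_trace \<one>))" using nz by (simp add: Ov_eq)
  moreover have "int n * v x \<le> int n * (-1)" using x(2) by (intro mult_left_mono) auto
  moreover have "int n = 1 + int k + \<bar>v (field_trace \<one>)\<bar>" by (simp add: n_def)
  ultimately show False by linarith
qed

text \<open>A nonzero \<open>x\<close> divisible by all powers of \<open>\<pi>\<close> would make
  \<open>\<pi>\<close> invertible in \<open>R\<close>; by \<open>R_F\<close> the inverse would then
  lie in \<open>Ov\<close>, but its valuation is -1.\<close>

lemma R_separated:
  assumes x: "x \<in> carrier L" "\<And>m. \<exists>r\<in>R. x = \<pi> [^] (m::nat) \<otimes> r"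
  shows "x = \<zero>"
proof (rule ccontr)
  assume nz: "x \<noteq> \<zero>"
  note i = nonzero_inv[OF x(1) nz]
  obtain j :: nat where j: "\<pi> [^] j \<otimes> inv x \<in> R" using R_scale[OF i(1)] by blast
  \<comment> \<open>One power beyond \<open>\<pi>\<^sup>j\<close>, so that \<open>?s\<close> becomes
    the inverse of \<open>\<pi>\<close>.\<close>
  obtain r where r: "r \<in> R" "x = \<pi> [^] Suc j \<otimes> r" using x(2) by blast
  let ?s = "r \<otimes> (\<pi> [^] j \<otimes> inv x)"
  have s: "?s \<in> R" "?s \<in> carrier L" using R_mult[OF r(1) j] R_carrier by auto
  have "\<pi> [^] j \<otimes> (\<pi> \<otimes> ?s) = \<pi> [^] j \<otimes> ((\<pi> [^] Suc j \<otimes> r) \<otimes> inv x)"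
  proof -
    have "p \<otimes> (\<pi> \<otimes> (r \<otimes> (p \<otimes> y))) = p \<otimes> (((p \<otimes> \<pi>) \<otimes> r) \<otimes> y)" if "p \<in> carrier L" "y \<in> carrier L" for p y
      using that unif_carrier R_carrier[OF r(1)] by algebra
    from this[OF unif_pow(1)[of j] i(1)] show ?thesis by simp
  qed
  also have "\<dots> = \<pi> [^] j \<otimes> \<one>" unfolding r(2)[symmetric] i(3) by simp
  finally have "\<pi> \<otimes> ?s = \<one>"
    using s unif_carrier unif_pow[of j] m_lcancel[of "\<pi> [^] j" "\<pi> \<otimes> ?s" \<one>] by simp
  then have inv: "?s = inv \<pi>" using comm_inv_char[OF unif_carrier s(2)] by simp
  then have "inv \<pi> \<in> Ov" using R_F[OF s(1)] F_inv unif by simp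
  then show False using v_inv unif nonzero_inv[OF unif_carrier] by (simp add: Ov_eq)
qed

lemma div_unif:
  assumes "a \<in> F" "a \<noteq> \<zero>" "int m \<le> v a" obtains c where "c \<in> Ov" "a = \<pi> [^] m \<otimes> c"
proof
  let ?c = "inv (\<pi> [^] m) \<otimes> a"
  note i = nonzero_inv[OF unif_pow(1,3)[of m]]
  have iF: "inv (\<pi> [^] m) \<in> F" by (rule F_inv[OF unif_pow(2,3)])
  have "v ?c = - int m + v a"
    using v_mult[of "inv (\<pi> [^] m)" a] v_inv[OF unif_pow(2,3)] iF i assms unif_pow(4) by simp
  then show "?c \<in> Ov" using assms F_closed(4)[OF iF] by (simp add: Ov_eq)
  show "a = \<pi> [^] m \<otimes> ?c" using i assms F_carrier unif_pow(1) by (simp add: m_assoc[symmetric])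
qed

section \<open>The valuation of the norm\<close>

definition w :: "'a \<Rightarrow> int" where "w x = v (field_norm x)"

lemma w_mult: "\<lbrakk>x \<in> carrier L; x \<noteq> \<zero>; y \<in> carrier L; y \<noteq> \<zero>\<rbrakk> \<Longrightarrow> w (x \<otimes> y) = w x + w y"
  unfolding w_def using v_mult[of "field_norm x" "field_norm y"] field_norm_mult field_norm_in_F field_norm_nonzero by simp

lemma w_one: "w \<one> = 0" using w_mult[of \<one> \<one>] by simp

lemma w_inv: "\<lbrakk>x \<in> carrier L; x \<noteq> \<zero>\<rbrakk> \<Longrightarrow> w (inv x) = - w x"
  using w_mult[of x "inv x"] nonzero_inv[of x] w_one by simp

lemma w_pow: "\<lbrakk>x \<in> carrier L; x \<noteq> \<zero>\<rbrakk> \<Longrightarrow> w (x [^] (n::nat)) = int n * w x"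
  by (induction n) (auto simp: w_one w_mult pow_nonzero algebra_simps)

lemma w_F: "\<lbrakk>a \<in> F; a \<noteq> \<zero>\<rbrakk> \<Longrightarrow> w a = int (card G) * v a"
  unfolding w_def by (simp add: field_norm_F v_pow)

lemma card_G_pos: "card G > 0" using finite_G id_G card_gt_0_iff by blast

text \<open>The norm of an element of \<open>R\<close> lies in \<open>R\<close> and in
  \<open>F\<close>, hence in \<open>Ov\<close> by \<open>R_F\<close>.\<close>

lemma w_R: assumes "x \<in> R" "x \<noteq> \<zero>" shows "0 \<le> w x"
proof -
  have "field_norm x \<in> Ov" using R_F[OF field_norm_R[OF assms(1)]] field_norm_in_F R_carrier assms by blast
  then show ?thesis using field_norm_nonzero[OF R_carrier] assms by (auto simp: Ov_eq w_def)
qed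

text \<open>If the bound failed, Koenig's lemma would give a limit \<open>y\<close> outside \<open>\<pi> R\<close> with norm \<open>0\<close>.\<close>

lemma w_bounded_primitive:
  "\<exists>C::nat. \<forall>x\<in>R. (\<nexists>r. r \<in> R \<and> x = \<pi> \<otimes> r) \<longrightarrow> w x \<le> int C"
proof (rule ccontr)
  assume "\<not> ?thesis"
  then have "\<forall>C::nat. \<exists>x. x \<in> R \<and> (\<nexists>r. r \<in> R \<and> x = \<pi> \<otimes> r) \<and> int C < w x" by (meson not_le)
  then obtain x where x: "\<And>j::nat. x j \<in> R" "\<And>j. \<nexists>r. r \<in> R \<and> x j = \<pi> \<otimes> r" "\<And>j. int j < w (x j)" by metis
  obtain S where S: "finite S" "S \<subseteq> R" "\<And>y. y \<in> R \<Longrightarrow> \<exists>s\<in>S. \<exists>z\<in>R. y = s \<oplus> \<pi> \<otimes> z" using R_finite by blast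
  \<comment> \<open>A node at level \<open>n\<close> of the tree is an approximation shared modulo
    \<open>\<pi>\<^sup>n\<close> by infinitely many \<open>x j\<close>. The clause for
    \<open>n = 0\<close> makes the path start at zero, as partial sums do.\<close>
  define P where "P n y \<longleftrightarrow> y \<in> R \<and> (n = 0 \<longrightarrow> y = \<zero>) \<and> infinite {j. cong_pow n (x j) y}" for n y
  have "\<exists>f. \<forall>n. P n (f n) \<and> (\<exists>s\<in>S. f (Suc n) = f n \<oplus> \<pi> [^] n \<otimes> s)"
  proof (rule dependent_nat_choice)
    have "cong_pow 0 (x j) \<zero>" for j
      unfolding cong_pow_def using x(1)[of j] R_carrier[OF x(1)[of j]] by (intro bexI[of _ "x j"]) auto
    then show "\<exists>y. P 0 y" unfolding P_def using R_zero by auto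
  next
    fix y n assume P: "P n y"
    have "\<exists>s\<in>S. cong_pow (Suc n) (x j) (y \<oplus> \<pi> [^] n \<otimes> s)" if j: "cong_pow n (x j) y" for j
    proof -
      obtain r where r: "r \<in> R" "x j = y \<oplus> \<pi> [^] n \<otimes> r" using j cong_pow_def by blast
      obtain s z where s: "s \<in> S" "z \<in> R" "r = s \<oplus> \<pi> \<otimes> z" using S(3)[OF r(1)] by blast
      have "y \<oplus> p \<otimes> (s \<oplus> \<pi> \<otimes> z) = (y \<oplus> p \<otimes> s) \<oplus> (p \<otimes> \<pi>) \<otimes> z" if "p \<in> carrier L" for p
        using that R_carrier s(1,2) S(2) P unif_carrier unfolding P_def
        by (simp add: subset_iff) algebra
      from this[OF unif_pow(1)[of n]] have "x j = (y \<oplus> \<pi> [^] n \<otimes> s) \<oplus> \<pi> [^] Suc n \<otimes> z"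
        unfolding r(2) s(3) by simp
      then show ?thesis using s(1,2) unfolding cong_pow_def by blast
    qed
    \<comment> \<open>Pigeonhole: finitely many digits \<open>s\<close> cover an infinite set of
      indices.\<close>
    then have "{j. cong_pow n (x j) y} \<subseteq> (\<Union>s\<in>S. {j. cong_pow (Suc n) (x j) (y \<oplus> \<pi> [^] n \<otimes> s)})" by blast
    then have "infinite (\<Union>s\<in>S. {j. cong_pow (Suc n) (x j) (y \<oplus> \<pi> [^] n \<otimes> s)})"
      using P unfolding P_def by (meson finite_subset)
    then obtain s where s: "s \<in> S" "infinite {j. cong_pow (Suc n) (x j) (y \<oplus> \<pi> [^] n \<otimes> s)}"
      using S(1) by blast
    moreover have "y \<oplus> \<pi> [^] n \<otimes> s \<in> R"
      using P s(1) S(2) unif_pow(5) unfolding P_def by (intro R_add R_smult) auto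
    ultimately have "P (Suc n) (y \<oplus> \<pi> [^] n \<otimes> s)" unfolding P_def by simp
    then show "\<exists>z. P (Suc n) z \<and> (\<exists>s\<in>S. z = y \<oplus> \<pi> [^] n \<otimes> s)" using s(1) by blast
  qed
  then obtain f where f: "\<And>n. P n (f n)" "\<And>n. \<exists>s\<in>S. f (Suc n) = f n \<oplus> \<pi> [^] n \<otimes> s" by blast
  then obtain d where d: "\<And>n. d n \<in> S" "\<And>n. f (Suc n) = f n \<oplus> \<pi> [^] n \<otimes> d n" by metis
  have partial_sum: "partial_sum d n = f n" for n
    by (induction n) (use f(1)[of 0] d(2) in \<open>auto simp: P_def\<close>)
  have dR: "d n \<in> R" for n using d(1)[of n] S(2) by blast
  obtain y where y: "y \<in> R" "\<And>m. cong_pow m y (f m)"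
    using R_complete[of d, OF dR] unfolding cong_pow_def partial_sum by auto
  have yc: "y \<in> carrier L" using R_carrier[OF y(1)] .
  \<comment> \<open>Infinitely many indices allow \<open>j \<ge> m\<close>; the norm of that
    \<open>x j\<close> is then divisible by \<open>\<pi>\<^sup>m\<close>, and by continuity so is
    the norm of \<open>y\<close>.\<close>
  have approx: "\<exists>j\<ge>m. cong_pow m (x j) y" for m
  proof -
    have "infinite {j. cong_pow m (x j) (f m)}" using f(1) unfolding P_def by blast
    then obtain j where j: "j \<ge> m" "cong_pow m (x j) (f m)"
      unfolding infinite_nat_iff_unbounded_le by auto
    have "f m \<in> carrier L" using f(1)[of m] R_carrier unfolding P_def by blast
    then have "cong_pow m (x j) y" using cong_pow_trans[OF j(2) cong_pow_sym[OF y(2)]] yc by blast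
    then show ?thesis using j(1) by blast
  qed
  have "field_norm y = \<zero>"
  proof (rule R_separated[OF field_norm_carrier[OF yc]])
    fix m :: nat
    obtain j where j: "j \<ge> m" "cong_pow m (x j) y" using approx by blast
    have "x j \<noteq> \<zero>" using x(2)[of j] R_zero unif_carrier by (metis r_null)
    then have n: "field_norm (x j) \<in> F" "field_norm (x j) \<noteq> \<zero>" using field_norm_in_F field_norm_nonzero R_carrier x(1) by auto
    have "int m \<le> v (field_norm (x j))" using x(3)[of j] j(1) unfolding w_def by linarith
    then obtain c where c: "c \<in> Ov" "field_norm (x j) = \<pi> [^] m \<otimes> c" using div_unif[OF n] by blast
    have "cong_pow m (field_norm y) (field_norm (x j))" using field_norm_cong_pow[OF y(1) x(1) cong_pow_sym[OF j(2) yc]] .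
    then obtain r where r: "r \<in> R" "field_norm y = \<pi> [^] m \<otimes> c \<oplus> \<pi> [^] m \<otimes> r" unfolding cong_pow_def c(2) by blast
    then have "field_norm y = \<pi> [^] m \<otimes> (c \<oplus> r)"
      using R_carrier Ov_carrier c(1) unif_pow(1) by (simp add: r_distr)
    then show "\<exists>r\<in>R. field_norm y = \<pi> [^] m \<otimes> r" using R_add[OF Ov_R[OF c(1)] r(1)] by (rule bexI)
  qed
  then have "y = \<zero>" using field_norm_nonzero yc by blast
  \<comment> \<open>Level one with \<open>y = \<zero>\<close> puts some \<open>x j\<close> into
    \<open>\<pi> R\<close>, against its choice.\<close>
  then obtain j r where "r \<in> R" "x j = \<zero> \<oplus> \<pi> [^] (1::nat) \<otimes> r" using approx[of 1] unfolding cong_pow_def by blast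
  then show False using x(2)[of j] R_carrier unif_carrier by auto
qed

text \<open>For the least \<open>k\<close> with \<open>\<pi>\<^sup>k x\<close> in \<open>R\<close>,
  either \<open>k = 0\<close> or this multiple is not in \<open>\<pi> R\<close>. In the second case
  its \<open>w\<close> is at most \<open>C\<close>, yet at least \<open>k\<close> because
  \<open>w x\<close> is nonnegative; hence \<open>k \<le> C\<close>.\<close>

lemma w_scale:
  obtains C :: nat where "\<And>x. \<lbrakk>x \<in> carrier L; x = \<zero> \<or> 0 \<le> w x\<rbrakk> \<Longrightarrow> \<pi> [^] C \<otimes> x \<in> R"
proof -
  obtain C :: nat where C: "\<And>x. \<lbrakk>x \<in> R; \<nexists>r. r \<in> R \<and> x = \<pi> \<otimes> r\<rbrakk> \<Longrightarrow> w x \<le> int C"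
    using w_bounded_primitive by blast
  have "\<pi> [^] C \<otimes> x \<in> R" if x: "x \<in> carrier L" "x = \<zero> \<or> 0 \<le> w x" for x
  proof (cases "x = \<zero>")
    case True
    then show ?thesis using R_zero unif_pow by simp
  next
    case False
    define k where "k = (LEAST k::nat. \<pi> [^] k \<otimes> x \<in> R)"
    have k: "\<pi> [^] k \<otimes> x \<in> R" unfolding k_def using R_scale[OF x(1)] by (rule LeastI_ex)
    have "k \<le> C"
    proof (cases k)
      case (Suc i)
      have "\<nexists>r. r \<in> R \<and> \<pi> [^] k \<otimes> x = \<pi> \<otimes> r"
      proof
        assume "\<exists>r. r \<in> R \<and> \<pi> [^] k \<otimes> x = \<pi> \<otimes> r"
        then obtain r where r: "r \<in> R" "\<pi> [^] k \<otimes> x = \<pi> \<otimes> r" by blast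
        have "\<pi> \<otimes> (\<pi> [^] i \<otimes> x) = \<pi> \<otimes> r"
          using r(2) unfolding Suc using unif_carrier x(1) unif_pow(1)[of i] by (simp add: m_ac)
        then have "\<pi> [^] i \<otimes> x = r" using unif unif_carrier x(1) R_carrier[OF r(1)] by (simp add: m_lcancel unif_pow)
        then have "k \<le> i" unfolding k_def using r(1) by (intro Least_le) simp
        then show False using Suc by simp
      qed
      then have "w (\<pi> [^] k \<otimes> x) \<le> int C" by (rule C[OF k])
      moreover have "w (\<pi> [^] k \<otimes> x) = int (card G) * int k + w x"
        using w_mult[OF unif_pow(1,3) x(1) False] w_F[OF unif_pow(2,3)] unif_pow(4) by simp
      moreover have "1 * int k \<le> int (card G) * int k"
        using card_G_pos by (intro mult_right_mono) auto
      ultimately show ?thesis using x(2) False by linarith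
    qed simp
    then show ?thesis by (rule unif_pow_le[OF Ov_module_R x(1) k])
  qed
  then show ?thesis by (rule that)
qed

text \<open>The powers of \<open>x + y\<close> are sums of elements with \<open>w \<ge> 0\<close>, hence lie in one fixed
  lattice, so that \<open>w (x + y)\<close> cannot be negative.\<close>

lemma w_add_nonneg:
  assumes x: "x \<in> carrier L" "x = \<zero> \<or> 0 \<le> w x" and y: "y \<in> carrier L" "y = \<zero> \<or> 0 \<le> w y"
    and nz: "x \<oplus> y \<noteq> \<zero>"
  shows "0 \<le> w (x \<oplus> y)"
proof (rule ccontr)
  assume neg: "\<not> ?thesis"
  obtain C :: nat where C: "\<And>x. \<lbrakk>x \<in> carrier L; x = \<zero> \<or> 0 \<le> w x\<rbrakk> \<Longrightarrow> \<pi> [^] C \<otimes> x \<in> R" using w_scale by blast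
  let ?p = "\<pi> [^] C" and ?s = "x \<oplus> y"
  have s: "?s \<in> carrier L" using x y by simp
  have closed: "z \<otimes> t = \<zero> \<or> 0 \<le> w (z \<otimes> t)"
    if "z \<in> carrier L" "z = \<zero> \<or> 0 \<le> w z" "t \<in> carrier L" "t = \<zero> \<or> 0 \<le> w t" for z t
    using that w_mult[of z t] by (cases "z = \<zero> \<or> t = \<zero>") auto
  \<comment> \<open>The extra factor \<open>z\<close> lets the power be expanded one factor at a
    time, with \<open>z\<close> absorbing \<open>x\<close> or \<open>y\<close>.\<close>
  have pow: "\<lbrakk>z \<in> carrier L; z = \<zero> \<or> 0 \<le> w z\<rbrakk> \<Longrightarrow> ?p \<otimes> (z \<otimes> ?s [^] m) \<in> R" for z and m :: nat
  proof (induction m arbitrary: z)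
    case 0
    then show ?case using C by simp
  next
    case (Suc m)
    have "?p \<otimes> ((z \<otimes> x) \<otimes> ?s [^] m) \<in> R" "?p \<otimes> ((z \<otimes> y) \<otimes> ?s [^] m) \<in> R"
      using Suc closed x y by auto
    moreover have "p \<otimes> (z \<otimes> (q \<otimes> (x \<oplus> y))) = p \<otimes> ((z \<otimes> x) \<otimes> q) \<oplus> p \<otimes> ((z \<otimes> y) \<otimes> q)"
      if "p \<in> carrier L" "q \<in> carrier L" for p q
      using that Suc.prems x(1) y(1) by algebra
    ultimately show ?case using R_add s unif_pow(1) by simp
  qed
  \<comment> \<open>Large enough that even \<open>w ?s = -1\<close> outweighs the contribution
    \<open>card G * C\<close> of \<open>\<pi>\<^sup>C\<close>.\<close>
  define m where "m = Suc (card G * C)"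
  have "?p \<otimes> ?s [^] m \<in> R" using pow[of \<one> m] w_one s by simp
  moreover have nz': "?s [^] m \<noteq> \<zero>" using pow_nonzero[OF s nz] .
  moreover have "?p \<otimes> ?s [^] m \<noteq> \<zero>" using nz' s unif_pow by (simp add: integral_iff)
  ultimately have "0 \<le> w (?p \<otimes> ?s [^] m)" using w_R by blast
  also have "w (?p \<otimes> ?s [^] m) = int (card G) * int C + int m * w ?s"
    using w_mult[OF unif_pow(1,3) _ nz'] s w_F[OF unif_pow(2,3)] unif_pow(4) w_pow[OF s nz] by simp
  finally have "0 \<le> int (card G) * int C + int m * w ?s" .
  moreover have "int m * w ?s \<le> int m * (-1)" using neg by (intro mult_left_mono) auto
  ultimately show False unfolding m_def by simp
qed

text \<open>Division by \<open>x\<close> reduces to one plus an element of nonnegative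
  \<open>w\<close>, the case settled by \<open>w_add_nonneg\<close>.\<close>

lemma w_add:
  assumes x: "x \<in> carrier L" "x \<noteq> \<zero>" and y: "y \<in> carrier L" "y \<noteq> \<zero>" and nz: "x \<oplus> y \<noteq> \<zero>"
    and le: "w x \<le> w y"
  shows "w x \<le> w (x \<oplus> y)"
proof -
  note i = nonzero_inv[OF x]
  let ?q = "y \<otimes> inv x"
  have q: "?q \<in> carrier L" "?q \<noteq> \<zero>" using y i by (auto simp: integral_iff)
  have wq: "0 \<le> w ?q" using w_mult[OF y i(1,2)] w_inv[OF x] le by simp
  have eq: "x \<oplus> y = x \<otimes> (\<one> \<oplus> ?q)"
  proof -
    have "x \<otimes> (\<one> \<oplus> y \<otimes> t) = x \<oplus> y \<otimes> (x \<otimes> t)" if "t \<in> carrier L" for t using that x y by algebra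
    from this[OF i(1)] show ?thesis using i y by simp
  qed
  then have nz1: "\<one> \<oplus> ?q \<noteq> \<zero>" using nz x by auto
  have "0 \<le> w (\<one> \<oplus> ?q)" using w_add_nonneg[of \<one> ?q] wq q w_one nz1 by simp
  then show ?thesis unfolding eq using w_mult[OF x _ nz1] q by simp
qed

section \<open>Finite residue field and normalisation\<close>

lemma R_finite_pow: "\<exists>S. finite S \<and> S \<subseteq> R \<and> (\<forall>x\<in>R. \<exists>s\<in>S. cong_pow m x s)"
proof (induction m)
  case 0
  have "cong_pow 0 x \<zero>" if "x \<in> R" for x
    unfolding cong_pow_def using that R_carrier by (intro bexI[of _ x]) auto
  then show ?case using R_zero by (intro exI[of _ "{\<zero>}"]) auto
next
  case (Suc m)
  then obtain S where S: "finite S" "S \<subseteq> R" "\<And>x. x \<in> R \<Longrightarrow> \<exists>s\<in>S. cong_pow m x s" by blast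
  obtain S' where S': "finite S'" "S' \<subseteq> R" "\<And>x. x \<in> R \<Longrightarrow> \<exists>s\<in>S'. \<exists>y\<in>R. x = s \<oplus> \<pi> \<otimes> y" using R_finite by blast
  let ?T = "(\<lambda>(s, t). s \<oplus> \<pi> [^] m \<otimes> t) ` (S \<times> S')"
  have "\<exists>s\<in>?T. cong_pow (Suc m) x s" if x: "x \<in> R" for x
  proof -
    obtain s r where s: "s \<in> S" "r \<in> R" "x = s \<oplus> \<pi> [^] m \<otimes> r" using S(3)[OF x] cong_pow_def by blast
    obtain t y where t: "t \<in> S'" "y \<in> R" "r = t \<oplus> \<pi> \<otimes> y" using S'(3)[OF s(2)] by blast
    have c: "s \<in> carrier L" "t \<in> carrier L" "y \<in> carrier L" using s t S(2) S'(2) R_carrier by auto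
    have "s \<oplus> p \<otimes> (t \<oplus> \<pi> \<otimes> y) = (s \<oplus> p \<otimes> t) \<oplus> (p \<otimes> \<pi>) \<otimes> y" if "p \<in> carrier L" for p
      using that c unif_carrier by algebra
    from this[OF unif_pow(1)[of m]] have "x = (s \<oplus> \<pi> [^] m \<otimes> t) \<oplus> \<pi> [^] Suc m \<otimes> y"
      unfolding s(3) t(3) by simp
    then have "cong_pow (Suc m) x (s \<oplus> \<pi> [^] m \<otimes> t)" using t(2) cong_pow_def by blast
    then show ?thesis using s(1) t(1) by force
  qed
  moreover have "?T \<subseteq> R" using S(2) S'(2) unif_pow(5) by (auto intro!: R_add R_smult)
  ultimately show ?case using S(1) S'(1) by (intro exI[of _ ?T]) auto
qed

text \<open>Multiplication by \<open>\<pi>\<^sup>C\<close> carries the elements of nonnegative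
  \<open>w\<close> into \<open>R\<close>, which has finitely many classes modulo
  \<open>\<pi>\<close> to the power \<open>C + 1\<close>. Two elements sharing a class differ by
  \<open>\<pi> r\<close> with \<open>r\<close> in \<open>R\<close>, which is zero or has positive
  \<open>w\<close>.\<close>

lemma w_finite_residue:
  "\<exists>S. finite S \<and> (\<forall>s\<in>S. s \<in> carrier L \<and> (s = \<zero> \<or> 0 \<le> w s)) \<and>
    (\<forall>x\<in>carrier L. (x = \<zero> \<or> 0 \<le> w x) \<longrightarrow> (\<exists>s\<in>S. x \<ominus> s = \<zero> \<or> 0 < w (x \<ominus> s)))"
proof -
  obtain C :: nat where C: "\<And>x. \<lbrakk>x \<in> carrier L; x = \<zero> \<or> 0 \<le> w x\<rbrakk> \<Longrightarrow> \<pi> [^] C \<otimes> x \<in> R" using w_scale by blast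
  obtain T where T: "finite T" "T \<subseteq> R" "\<And>x. x \<in> R \<Longrightarrow> \<exists>s\<in>T. cong_pow (Suc C) x s" using R_finite_pow[of "Suc C"] by blast
  let ?p = "\<pi> [^] C"
  define W where "W = {x \<in> carrier L. x = \<zero> \<or> 0 \<le> w x}"
  \<comment> \<open>The representatives in \<open>T\<close> need not come from elements of
    nonnegative \<open>w\<close>; \<open>h\<close> replaces each class that contains the image of
    such an element by one of them.\<close>
  define h where "h t = (SOME z. z \<in> W \<and> cong_pow (Suc C) (?p \<otimes> z) t)" for t
  define S where "S = h ` {t \<in> T. \<exists>z\<in>W. cong_pow (Suc C) (?p \<otimes> z) t}"
  have h: "h t \<in> W" "cong_pow (Suc C) (?p \<otimes> h t) t" if "\<exists>z\<in>W. cong_pow (Suc C) (?p \<otimes> z) t" for t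
    using someI_ex[of "\<lambda>z. z \<in> W \<and> cong_pow (Suc C) (?p \<otimes> z) t"] that unfolding h_def by auto
  have "\<exists>s\<in>S. x \<ominus> s = \<zero> \<or> 0 < w (x \<ominus> s)" if x: "x \<in> W" for x
  proof -
    have xc: "x \<in> carrier L" using x by (simp add: W_def)
    obtain t where t: "t \<in> T" "cong_pow (Suc C) (?p \<otimes> x) t" using T(3)[OF C] x by (auto simp: W_def)
    then have s: "h t \<in> S" "h t \<in> W" "cong_pow (Suc C) (?p \<otimes> h t) t" using h[of t] x by (auto simp: S_def)
    have tc: "t \<in> carrier L" using t(1) T(2) R_carrier by blast
    have hc: "h t \<in> carrier L" using s(2) by (simp add: W_def)
    have "cong_pow (Suc C) (?p \<otimes> x) (?p \<otimes> h t)"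
      using cong_pow_trans[OF t(2) cong_pow_sym[OF s(3) tc]] hc unif_pow(1) by simp
    then obtain r where r: "r \<in> R" "?p \<otimes> x = ?p \<otimes> h t \<oplus> \<pi> [^] Suc C \<otimes> r" unfolding cong_pow_def by blast
    have rc: "r \<in> carrier L" using R_carrier[OF r(1)] .
    have "?p \<otimes> x = ?p \<otimes> (h t \<oplus> \<pi> \<otimes> r)"
      using r(2) hc rc unif_carrier unif_pow(1)[of C] by (simp add: r_distr m_assoc)
    then have "x = h t \<oplus> \<pi> \<otimes> r"
      using m_lcancel[of ?p x "h t \<oplus> \<pi> \<otimes> r"] unif_pow[of C] xc hc rc unif_carrier by simp
    then have "x \<ominus> h t = \<pi> \<otimes> r" using hc rc unif_carrier by simp algebra
    moreover have "0 < w (\<pi> \<otimes> r)" if "r \<noteq> \<zero>"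
      using w_mult[OF unif_carrier unif(2) rc that] w_F[OF unif(1,2)] unif(3) w_R[OF r(1) that] card_G_pos
      by simp
    ultimately have "x \<ominus> h t = \<zero> \<or> 0 < w (x \<ominus> h t)" using unif_carrier by (cases "r = \<zero>") auto
    then show ?thesis using s(1) by blast
  qed
  moreover have "finite S" unfolding S_def using T(1) by simp
  moreover have "S \<subseteq> W" unfolding S_def using h by blast
  ultimately show ?thesis unfolding W_def by (intro exI[of _ S]) blast
qed

text \<open>The values of \<open>w\<close> are the multiples of some positive \<open>d\<close>, so
  \<open>w / d\<close> is onto the integers. Invariance comes from
  \<open>field_norm_G\<close>.\<close>

lemma valuation_extension:
  "\<exists>u. discrete_valuation L u \<and> finite (carrier (residue_field L u)) \<and>
    (\<forall>\<alpha>\<in>G. \<forall>x\<in>carrier L. u (\<alpha> x) = u x) \<and> (\<forall>a\<in>F - {\<zero>}. v a = 0 \<longrightarrow> u a = 0)"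
proof -
  let ?H = "w ` (carrier L - {\<zero>})"
  obtain d where d: "d > 0" "?H = range ((*) d)"
  proof (rule int_subgroup_cyclic[of ?H "w \<pi>"])
    fix a b assume "a \<in> ?H" "b \<in> ?H"
    then obtain x y where x: "x \<in> carrier L" "x \<noteq> \<zero>" "a = w x" and y: "y \<in> carrier L" "y \<noteq> \<zero>" "b = w y" by auto
    have "a - b = w (x \<otimes> inv y)"
      using x y nonzero_inv[OF y(1,2)] w_mult w_inv by simp
    moreover have "x \<otimes> inv y \<in> carrier L - {\<zero>}" using x y nonzero_inv[OF y(1,2)] by (simp add: integral_iff)
    ultimately show "a - b \<in> ?H" by blast
  next
    show "w \<pi> \<in> ?H" using unif unif_carrier by blast
    \<comment> \<open>\<open>w \<pi>\<close> is the order of \<open>G\<close>, so the value group is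
      not trivial.\<close>
    show "w \<pi> \<noteq> 0" using w_F[OF unif(1,2)] unif(3) card_G_pos by simp
  qed blast
  define u where "u x = w x div d" for x
  have w: "w x = d * u x" if "x \<in> carrier L" "x \<noteq> \<zero>" for x
  proof -
    have "w x \<in> range ((*) d)" using that d(2) by blast
    then show ?thesis using d(1) by (auto simp: u_def)
  qed
  interpret u: discrete_valuation L u
  proof unfold_locales
    fix x y assume xy: "x \<in> carrier L - {\<zero>}" "y \<in> carrier L - {\<zero>}"
    then have "d * u (x \<otimes> y) = d * u x + d * u y" using w w_mult by (simp add: integral_iff)
    then have "d * u (x \<otimes> y) = d * (u x + u y)" by (simp add: algebra_simps)
    then show "u (x \<otimes> y) = u x + u y" using d(1) by simp
    assume nz: "x \<oplus> y \<noteq> \<zero>"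
    have "min (w x) (w y) \<le> w (x \<oplus> y)"
    proof (cases "w x \<le> w y")
      case True
      then show ?thesis using w_add[of x y] xy nz by auto
    next
      case False
      then show ?thesis using w_add[of y x] xy nz by (auto simp: a_comm)
    qed
    then show "min (u x) (u y) \<le> u (x \<oplus> y)" using xy nz w d(1) by (auto simp: min_def split: if_splits)
  next
    show "u ` (carrier L - {\<zero>}) = UNIV"
    proof (rule UNIV_eq_I[symmetric])
      fix n
      have "d * n \<in> ?H" using d(2) by blast
      then obtain x where "x \<in> carrier L - {\<zero>}" "w x = d * n" by force
      then have "x \<in> carrier L - {\<zero>}" "u x = n" using d(1) by (auto simp: u_def)
      then show "n \<in> u ` (carrier L - {\<zero>})" by blast
    qed
  qed
  have sign: "0 \<le> u x \<longleftrightarrow> 0 \<le> w x" "1 \<le> u x \<longleftrightarrow> 0 < w x" if "x \<in> carrier L" "x \<noteq> \<zero>" for x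
    using w[OF that] d(1) by (auto simp: zero_le_mult_iff zero_less_mult_iff)
  have "finite (carrier (residue_field L u))"
  proof -
    obtain S where S: "finite S" "\<And>s. s \<in> S \<Longrightarrow> s \<in> carrier L \<and> (s = \<zero> \<or> 0 \<le> w s)"
      "\<And>x. \<lbrakk>x \<in> carrier L; x = \<zero> \<or> 0 \<le> w x\<rbrakk> \<Longrightarrow> \<exists>s\<in>S. x \<ominus> s = \<zero> \<or> 0 < w (x \<ominus> s)"
      using w_finite_residue by blast
    have "S \<subseteq> carrier (valuation_ring L u)"
    proof
      fix s assume "s \<in> S"
      then show "s \<in> carrier (valuation_ring L u)" using S(2)[of s] sign(1)[of s]
        by (auto simp: u.mem_V val_ge_def)
    qed
    moreover have "\<exists>s\<in>S. val_ge L u 1 (x \<ominus> s)" if "x \<in> carrier (valuation_ring L u)" for x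
    proof -
      have x: "x \<in> carrier L" "x = \<zero> \<or> 0 \<le> w x" using that sign by (auto simp: u.mem_V val_ge_def)
      obtain s where s: "s \<in> S" "x \<ominus> s = \<zero> \<or> 0 < w (x \<ominus> s)" using S(3)[OF x] by blast
      then show ?thesis using sign(2)[of "x \<ominus> s"] S(2) x(1) by (auto simp: val_ge_def)
    qed
    ultimately show ?thesis unfolding u.finite_residue_field_iff using S(1) by blast
  qed
  moreover have "\<forall>\<alpha>\<in>G. \<forall>x\<in>carrier L. u (\<alpha> x) = u x" by (simp add: u_def w_def field_norm_G)
  moreover have "\<forall>a\<in>F - {\<zero>}. v a = 0 \<longrightarrow> u a = 0" by (simp add: u_def w_F)
  ultimately show ?thesis using u.discrete_valuation_axioms by blast
qed

end

lemma (in galois_over_complete) invariant_valuation_exists: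
  "\<exists>u. discrete_valuation L u \<and> finite (carrier (residue_field L u)) \<and>
    (\<forall>\<alpha>\<in>G. \<forall>x\<in>carrier L. u (\<alpha> x) = u x) \<and> (\<forall>a\<in>F - {\<zero>}. v a = 0 \<longrightarrow> u a = 0)"
proof -
  show ?thesis
  proof (rule order_exists)
    fix R
    assume R: "Ov_module R" "\<one> \<in> R" "\<And>x y. \<lbrakk>x \<in> R; y \<in> R\<rbrakk> \<Longrightarrow> x \<otimes> y \<in> R"
      "\<And>\<alpha> x. \<lbrakk>\<alpha> \<in> G; x \<in> R\<rbrakk> \<Longrightarrow> \<alpha> x \<in> R"
      "\<And>z. z \<in> carrier L \<Longrightarrow> \<exists>k::nat. \<pi> [^] k \<otimes> z \<in> R"
      "\<exists>S. finite S \<and> S \<subseteq> R \<and> (\<forall>x\<in>R. \<exists>s\<in>S. \<exists>y\<in>R. x = s \<oplus> \<pi> \<otimes> y)"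
      "\<And>d. (\<And>i. d i \<in> R) \<Longrightarrow> \<exists>y\<in>R. \<forall>m. \<exists>r\<in>R. y = partial_sum d m \<oplus> \<pi> [^] m \<otimes> r"
      "\<exists>k::nat. \<forall>x\<in>R. \<pi> [^] k \<otimes> field_trace x \<in> Ov"
    interpret galois_order L F Ov \<pi> v G R
      by (rule galois_order.intro[OF galois_over_complete_axioms galois_order_axioms.intro])
        (fact R)+
    show ?thesis by (rule valuation_extension)
  qed
qed

section \<open>Galois groups over local fields\<close>

lemma (in discrete_valuation) val_ge_divide:
  assumes p: "p \<in> carrier K" "p \<noteq> \<zero>" "v p = 1" and x: "x \<in> carrier K" "val_ge K v (int m) x"
  shows "\<exists>c\<in>carrier V. x = p [^] m \<otimes> c"
proof
  have pm: "p [^] m \<in> carrier K" "p [^] m \<noteq> \<zero>" "v (p [^] m) = int m"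
    using p pow_nonzero val_pow by auto
  note i = nonzero_inv[OF pm(1,2)]
  show eq: "x = p [^] m \<otimes> (inv (p [^] m) \<otimes> x)" using i pm x by (simp add: m_assoc[symmetric])
  have "val_ge K v (v (p [^] m) + 0) (p [^] m \<otimes> (inv (p [^] m) \<otimes> x))" using eq x pm(3) by simp
  then show "inv (p [^] m) \<otimes> x \<in> carrier V"
    using val_ge_mult_cancel[OF pm(1) _ pm(2)] i x unfolding mem_V by blast
qed

text \<open>Restates completeness by digit expansions with remainder. This form carries over to
  spans in \<open>L\<close>, where no valuation is available yet to speak of Cauchy
  sequences.\<close>

lemma (in local_field) power_series_converges:
  assumes p: "p \<in> carrier K" "p \<noteq> \<zero>" "v p = 1" and e: "\<And>i. e i \<in> carrier V"
  shows "\<exists>a\<in>carrier V. \<forall>m. \<exists>r\<in>carrier V. a = rec_nat \<zero> (\<lambda>i s. s \<oplus> p [^] i \<otimes> e i) m \<oplus> p [^] (m::nat) \<otimes> r"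
proof -
  define s where "s = rec_nat \<zero> (\<lambda>i s. s \<oplus> p [^] i \<otimes> e i)"
  have s_simps: "s 0 = \<zero>" "\<And>i. s (Suc i) = s i \<oplus> p [^] i \<otimes> e i" by (simp_all add: s_def)
  have ec: "e i \<in> carrier K" "val_ge K v 0 (e i)" for i using e[of i] by (auto simp: mem_V)
  have pc: "p [^] (i::nat) \<in> carrier K" "val_ge K v (int i) (p [^] i)" for i
    using p val_pow[of p i] by (auto simp: val_ge_def)
  have sc: "s m \<in> carrier K" for m by (induction m) (auto simp: s_simps pc ec)
  have tm: "val_ge K v (int i) (p [^] i \<otimes> e i)" for i
    using val_ge_mult[OF pc(1) ec(1) pc(2) ec(2), of i i] by simp
  have sV: "val_ge K v 0 (s m)" for m
    by (induction m) (auto simp: s_simps sc pc ec intro!: val_ge_add val_ge_mono[OF tm])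
  have diff: "val_ge K v (int m) (s i \<ominus> s m)" if "m \<le> i" for m i
    using that
  proof (induction i rule: dec_induct)
    case base
    then show ?case using sc by (simp add: a_minus_def r_neg)
  next
    case (step i)
    have "(a \<oplus> b) \<ominus> c = (a \<ominus> c) \<oplus> b" if "a \<in> carrier K" "b \<in> carrier K" "c \<in> carrier K" for a b c
      using that by algebra
    from this[OF sc[of i] _ sc[of m], of "p [^] i \<otimes> e i"]
    have "s (Suc i) \<ominus> s m = (s i \<ominus> s m) \<oplus> p [^] i \<otimes> e i" using pc ec by (simp add: s_simps)
    then show ?case using step val_ge_mono[OF tm, of "int m" i] sc pc ec by (simp add: val_ge_add)
  qed
  have "val_Cauchy K v s"
    unfolding val_Cauchy_def
  proof (intro allI exI impI)
    fix N :: int and i j assume "i \<ge> nat N" "j \<ge> nat N"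
    then have "val_ge K v N (s i \<ominus> s (nat N))" "val_ge K v N (s j \<ominus> s (nat N))"
      by (auto intro: val_ge_mono[OF diff[of "nat N"]])
    then have "val_ge K v N ((s i \<ominus> s (nat N)) \<ominus> (s j \<ominus> s (nat N)))" using sc by (simp add: val_ge_diff)
    moreover have "(a \<ominus> c) \<ominus> (b \<ominus> c) = a \<ominus> b" if "a \<in> carrier K" "b \<in> carrier K" "c \<in> carrier K" for a b c
      using that by algebra
    ultimately show "val_ge K v N (s i \<ominus> s j)" using sc by simp
  qed
  then obtain a where a: "a \<in> carrier K" "val_tendsto K v s a" using complete[of s] sc by blast
  \<comment> \<open>The limit inherits the bound: the comparison goes through a partial sum far
    enough along to be close to \<open>a\<close>.\<close>
  have rem: "val_ge K v (int m) (a \<ominus> s m)" for m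
  proof -
    obtain M where M: "\<And>i. i \<ge> M \<Longrightarrow> val_ge K v (int m) (s i \<ominus> a)" using a(2) unfolding val_tendsto_def by blast
    let ?i = "max M m"
    have "val_ge K v (int m) ((s ?i \<ominus> s m) \<ominus> (s ?i \<ominus> a))"
      using M[of ?i] diff[of m ?i] sc a(1) by (simp add: val_ge_diff)
    moreover have "(b \<ominus> c) \<ominus> (b \<ominus> a) = a \<ominus> c" if "b \<in> carrier K" "c \<in> carrier K" for b c
      using that a(1) by algebra
    ultimately show ?thesis using sc by simp
  qed
  have "\<exists>r\<in>carrier V. a = s m \<oplus> p [^] m \<otimes> r" for m
  proof -
    obtain c where c: "c \<in> carrier V" "a \<ominus> s m = p [^] m \<otimes> c"
      using val_ge_divide[OF p _ rem] a(1) sc by blast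
    have "a = s m \<oplus> (a \<ominus> s m)" using a(1) sc[of m] by algebra
    then show ?thesis using c by auto
  qed
  moreover have "a \<in> carrier V" using rem[of 0] a(1) by (simp add: mem_V s_simps a_minus_def)
  ultimately show ?thesis unfolding s_def by blast
qed

lemma (in local_field) valuation_ring_finite_mod:
  assumes p: "p \<in> carrier K" "p \<noteq> \<zero>" "v p = 1"
  shows "\<exists>S. finite S \<and> S \<subseteq> carrier V \<and> (\<forall>x\<in>carrier V. \<exists>s\<in>S. \<exists>y\<in>carrier V. x = s \<oplus> p \<otimes> y)"
proof -
  obtain S where S: "finite S" "S \<subseteq> carrier V" "\<And>x. x \<in> carrier V \<Longrightarrow> \<exists>s\<in>S. val_ge K v 1 (x \<ominus> s)"
    using finite_residue_field unfolding finite_residue_field_iff by blast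
  have "\<exists>s\<in>S. \<exists>y\<in>carrier V. x = s \<oplus> p \<otimes> y" if x: "x \<in> carrier V" for x
  proof -
    obtain s where s: "s \<in> S" "val_ge K v 1 (x \<ominus> s)" using S(3)[OF x] by blast
    have c: "x \<in> carrier K" "s \<in> carrier K" using x s S(2) by (auto simp: mem_V)
    obtain y where y: "y \<in> carrier V" "x \<ominus> s = p [^] (1::nat) \<otimes> y"
      using val_ge_divide[OF p, of "x \<ominus> s" 1] s c by auto
    have "x = s \<oplus> (x \<ominus> s)" using c by algebra
    then have "x = s \<oplus> p \<otimes> y" using y p(1) by simp
    then show ?thesis using s(1) y(1) by blast
  qed
  with S(1,2) show ?thesis by blast
qed

section \<open>The Galois group as a group of extensional maps\<close>

lemma Gal_group_simps:
  "\<alpha> \<in> carrier (Gal_group K L \<phi>) \<longleftrightarrow>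
    \<alpha> \<in> Bij (carrier L) \<and> \<alpha> \<in> ring_hom L L \<and> (\<forall>a\<in>carrier K. \<alpha> (\<phi> a) = \<phi> a)"
  "\<one>\<^bsub>Gal_group K L \<phi>\<^esub> = (\<lambda>x\<in>carrier L. x)"
  by (simp_all add: Gal_group_def BijGroup_def)

lemma Gal_group_mult:
  "\<lbrakk>\<alpha> \<in> carrier (Gal_group K L \<phi>); \<beta> \<in> carrier (Gal_group K L \<phi>)\<rbrakk> \<Longrightarrow>
    \<alpha> \<otimes>\<^bsub>Gal_group K L \<phi>\<^esub> \<beta> = compose (carrier L) \<alpha> \<beta>"
  by (simp add: Gal_group_def BijGroup_def)

text \<open>It is a subgroup of the group of bijections. The inverse there is
  \<open>inv_into\<close> restricted to the carrier, which is again a homomorphism fixing the image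
  of \<open>\<phi>\<close>.\<close>

lemma group_Gal_group:
  assumes L: "ring L" and \<phi>: "\<phi> \<in> carrier K \<rightarrow> carrier L"
  shows "group (Gal_group K L \<phi>)"
proof -
  interpret L: ring L by fact
  let ?A = "{\<alpha> \<in> Bij (carrier L). \<alpha> \<in> ring_hom L L \<and> (\<forall>a\<in>carrier K. \<alpha> (\<phi> a) = \<phi> a)}"
  have "subgroup ?A (BijGroup (carrier L))"
  proof (rule group.subgroupI[OF group_BijGroup])
    show "?A \<subseteq> carrier (BijGroup (carrier L))" by (auto simp: BijGroup_def)
    have "(\<lambda>x\<in>carrier L. x) \<in> ?A" using \<phi> by (auto simp: id_Bij ring_hom_def)
    then show "?A \<noteq> {}" by blast
  next
    fix \<alpha> assume \<alpha>: "\<alpha> \<in> ?A"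
    then have B: "\<alpha> \<in> Bij (carrier L)" and h: "\<alpha> \<in> ring_hom L L" by auto
    have inj: "inj_on \<alpha> (carrier L)" using B by (simp add: Bij_def bij_betw_def)
    let ?i = "\<lambda>x\<in>carrier L. inv_into (carrier L) \<alpha> x"
    have "?i \<in> ring_hom L L"
    proof (rule ring_hom_memI)
      fix x y assume xy: "x \<in> carrier L" "y \<in> carrier L"
      show "?i x \<in> carrier L" using xy Bij_inv_into_mem[OF B] by simp
      show "?i (x \<otimes>\<^bsub>L\<^esub> y) = ?i x \<otimes>\<^bsub>L\<^esub> ?i y"
        using xy Bij_inv_into_lemma[where g = "(\<otimes>\<^bsub>L\<^esub>)", OF ring_hom_mult[OF h] B, of x y] by (simp add: Pi_def)
      show "?i (x \<oplus>\<^bsub>L\<^esub> y) = ?i x \<oplus>\<^bsub>L\<^esub> ?i y"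
        using xy Bij_inv_into_lemma[where g = "(\<oplus>\<^bsub>L\<^esub>)", OF ring_hom_add[OF h] B, of x y] by (simp add: Pi_def)
    next
      show "?i \<one>\<^bsub>L\<^esub> = \<one>\<^bsub>L\<^esub>" using inv_into_f_f[OF inj L.one_closed] ring_hom_one[OF h] by simp
    qed
    moreover have "?i (\<phi> a) = \<phi> a" if "a \<in> carrier K" for a
      using \<alpha> that \<phi> inv_into_f_f[OF inj, of "\<phi> a"] by auto
    ultimately show "inv\<^bsub>BijGroup (carrier L)\<^esub> \<alpha> \<in> ?A"
      using B by (simp add: inv_BijGroup restrict_inv_into_Bij)
  next
    fix \<alpha> \<beta> assume ab: "\<alpha> \<in> ?A" "\<beta> \<in> ?A"
    then have "compose (carrier L) \<alpha> \<beta> \<in> ring_hom L L"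
      by (auto simp: ring_hom_def compose_eq Pi_def)
    moreover have "compose (carrier L) \<alpha> \<beta> (\<phi> a) = \<phi> a" if "a \<in> carrier K" for a
    proof -
      have "\<phi> a \<in> carrier L" using that \<phi> by auto
      then show ?thesis using ab that by (simp add: compose_eq)
    qed
    ultimately show "\<alpha> \<otimes>\<^bsub>BijGroup (carrier L)\<^esub> \<beta> \<in> ?A"
      using ab by (simp add: BijGroup_def compose_Bij)
  qed
  from group.subgroup_imp_group[OF group_BijGroup this] show ?thesis by (simp add: Gal_group_def)
qed

lemma Gal_group_pow:
  assumes "group (Gal_group K L \<phi>)" "\<alpha> \<in> carrier (Gal_group K L \<phi>)" "x \<in> carrier L"
  shows "(\<alpha> [^]\<^bsub>Gal_group K L \<phi>\<^esub> (n::nat)) x = (\<alpha> ^^ n) x"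
  using assms(3)
proof (induction n arbitrary: x)
  case 0
  then show ?case by (simp add: Gal_group_simps)
next
  case (Suc n)
  interpret group "Gal_group K L \<phi>" by fact
  have "\<alpha> x \<in> carrier L" using assms(2) Suc.prems by (auto simp: Gal_group_simps ring_hom_def)
  with Suc show ?case
    using Gal_group_mult[OF nat_pow_closed[OF assms(2), of n] assms(2)]
    by (simp add: compose_eq funpow_swap1)
qed

text \<open>\<open>group_exponent\<close> is a \<open>LEAST\<close> and is attained only given a
  witness, namely the order of the group, by Lagrange.\<close>

lemma heisenberg_group_facts:
  assumes "heisenberg_group l H" "l > 0"
  shows "group H" "finite (carrier H)" "\<And>x. x \<in> carrier H \<Longrightarrow> x [^]\<^bsub>H\<^esub> l = \<one>\<^bsub>H\<^esub>"
    and "\<exists>x\<in>carrier H. \<exists>y\<in>carrier H. x \<otimes>\<^bsub>H\<^esub> y \<noteq> y \<otimes>\<^bsub>H\<^esub> x"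
proof -
  show gH: "group H" using assms(1) by (simp add: heisenberg_group_def)
  interpret H: group H by fact
  have o: "order H = l ^ 3" using assms(1) by (simp add: heisenberg_group_def)
  then show "finite (carrier H)" using assms(2) by (intro card_ge_0_finite) (simp add: order_def)
  have "0 < order H \<and> (\<forall>x\<in>carrier H. x [^]\<^bsub>H\<^esub> order H = \<one>\<^bsub>H\<^esub>)"
    using o assms(2) H.pow_order_eq_1 by simp
  then have "0 < group_exponent H \<and> (\<forall>x\<in>carrier H. x [^]\<^bsub>H\<^esub> group_exponent H = \<one>\<^bsub>H\<^esub>)"
    unfolding group_exponent_def by (rule LeastI)
  then show "\<And>x. x \<in> carrier H \<Longrightarrow> x [^]\<^bsub>H\<^esub> l = \<one>\<^bsub>H\<^esub>"
    using assms(1) by (simp add: heisenberg_group_def)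
  show "\<exists>x\<in>carrier H. \<exists>y\<in>carrier H. x \<otimes>\<^bsub>H\<^esub> y \<noteq> y \<otimes>\<^bsub>H\<^esub> x"
  proof (rule ccontr)
    assume "\<not> ?thesis"
    then have "comm_group H" by (intro H.group_comm_groupI) auto
    then show False using assms(1) by (simp add: heisenberg_group_def)
  qed
qed

lemma (in ring) add_pow_one_mult:
  "add_pow R (m * n :: nat) \<one> = add_pow R m \<one> \<otimes> add_pow R n \<one>"
proof (induction m)
  case (Suc m)
  have "add_pow R (n + m * n) \<one> = add_pow R n \<one> \<oplus> add_pow R (m * n) \<one>"
    by (simp add: add.nat_pow_mult)
  then show ?case using Suc by (simp add: l_distr a_comm)
qed simp

lemma (in ring_hom_cring) hom_add_pow_one:
  "h (add_pow R (n::nat) \<one>\<^bsub>R\<^esub>) = add_pow S n \<one>\<^bsub>S\<^esub>"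
  by (induction n) simp_all

text \<open>The invariant valuation on \<open>L\<close> makes every element of the group a
  \<open>val_auto\<close>, so \<open>commutator_trivial\<close> applies to each pair. All orders
  \<open>l ^ e\<close> are covered at once.\<close>

theorem galois_group_exponent_prime_comm:
  assumes l: "Factorial_Ring.prime l" "l \<noteq> 2"
    and K: "local_field K v" and ext: "finite_galois_extension K L \<phi>"
    and unit: "add_pow K l \<one>\<^bsub>K\<^esub> \<noteq> \<zero>\<^bsub>K\<^esub>" "v (add_pow K l \<one>\<^bsub>K\<^esub>) = 0"
    and order: "card (carrier (Gal_group K L \<phi>)) = l ^ e"
    and exponent: "\<And>\<alpha>. \<alpha> \<in> carrier (Gal_group K L \<phi>) \<Longrightarrow>
      \<alpha> [^]\<^bsub>Gal_group K L \<phi>\<^esub> l = \<one>\<^bsub>Gal_group K L \<phi>\<^esub>"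
  shows "comm_group (Gal_group K L \<phi>)"
proof -
  let ?G = "Gal_group K L \<phi>"
  interpret K: local_field K v by fact
  interpret L: field L using ext by (simp add: finite_galois_extension_def)
  have hom: "\<phi> \<in> ring_hom K L" using ext by (simp add: finite_galois_extension_def)
  interpret \<phi>: ring_hom_cring K L \<phi> by unfold_locales (rule hom)
  interpret G: group ?G by (rule group_Gal_group[OF L.ring_axioms]) auto
  have inj: "inj_on \<phi> (carrier K)" and sub: "subfield (\<phi> ` carrier K) L"
    using ring_hom_ring.img_is_subfield[OF ring_hom_ringI2[OF K.ring_axioms L.ring_axioms hom] K.carrier_is_subfield]
    by auto
  obtain p where p: "p \<in> carrier K" "p \<noteq> \<zero>\<^bsub>K\<^esub>" "v p = 1" by (rule K.obtain_uniformizer)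
  have nz: "\<phi> a = \<zero>\<^bsub>L\<^esub> \<longleftrightarrow> a = \<zero>\<^bsub>K\<^esub>" if "a \<in> carrier K" for a
    using inj_on_eq_iff[OF inj that K.zero_closed] by simp
  \<comment> \<open>The locale places the base field inside \<open>L\<close>, so \<open>v\<close> is
    carried to the image through the inverse of the injective \<open>\<phi>\<close>.\<close>
  define vF where "vF y = v (the_inv_into (carrier K) \<phi> y)" for y
  have vF: "vF (\<phi> a) = v a" if "a \<in> carrier K" for a
    unfolding vF_def by (simp add: the_inv_into_f_f[OF inj that])
  \<comment> \<open>\<open>\<phi>\<close> commutes with partial sums; membership in the carrier is
    included because the induction step uses it.\<close>
  have partial_sum: "rec_nat \<zero>\<^bsub>L\<^esub> (\<lambda>i s. s \<oplus>\<^bsub>L\<^esub> \<phi> p [^]\<^bsub>L\<^esub> i \<otimes>\<^bsub>L\<^esub> \<phi> (c i)) m =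
      \<phi> (rec_nat \<zero>\<^bsub>K\<^esub> (\<lambda>i s. s \<oplus>\<^bsub>K\<^esub> p [^]\<^bsub>K\<^esub> i \<otimes>\<^bsub>K\<^esub> c i) m) \<and>
      rec_nat \<zero>\<^bsub>K\<^esub> (\<lambda>i s. s \<oplus>\<^bsub>K\<^esub> p [^]\<^bsub>K\<^esub> i \<otimes>\<^bsub>K\<^esub> c i) m \<in> carrier K"
    if "\<And>i. c i \<in> carrier K" for c and m :: nat
    using that p by (induction m) auto
  have V: "a \<in> carrier K" if "a \<in> carrier K.V" for a using that by (simp add: K.mem_V)
  have fin: "finite (carrier ?G)" using order l(1) by (intro card_ge_0_finite) (simp add: prime_gt_0_nat)
  have nat: "add_pow L (n::nat) \<one>\<^bsub>L\<^esub> = \<phi> (add_pow K n \<one>\<^bsub>K\<^esub>)" for n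
    by (simp add: \<phi>.hom_add_pow_one)
  interpret E: galois_over_complete L "\<phi> ` carrier K" "\<phi> ` carrier K.V" "\<phi> p" vF "carrier ?G"
  proof (rule galois_over_complete.intro[OF L.field_axioms galois_over_complete_axioms.intro])
    show "subfield (\<phi> ` carrier K) L" by fact
    fix x y assume "x \<in> \<phi> ` carrier K - {\<zero>\<^bsub>L\<^esub>}" "y \<in> \<phi> ` carrier K - {\<zero>\<^bsub>L\<^esub>}"
    then obtain a b where "a \<in> carrier K - {\<zero>\<^bsub>K\<^esub>}" "x = \<phi> a" "b \<in> carrier K - {\<zero>\<^bsub>K\<^esub>}" "y = \<phi> b"
      using nz by auto
    then show "vF (x \<otimes>\<^bsub>L\<^esub> y) = vF x + vF y"
      using vF[of "a \<otimes>\<^bsub>K\<^esub> b"] vF[of a] vF[of b] K.val_mult[of a b] by simp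
  next
    show "\<phi> ` carrier K.V = {x \<in> \<phi> ` carrier K. x = \<zero>\<^bsub>L\<^esub> \<or> 0 \<le> vF x}"
      using vF nz by (auto simp: K.mem_V val_ge_def)
  next
    fix x y assume "x \<in> \<phi> ` carrier K.V" "y \<in> \<phi> ` carrier K.V"
    then obtain a b where ab: "a \<in> carrier K.V" "x = \<phi> a" "b \<in> carrier K.V" "y = \<phi> b" by blast
    then have "x \<oplus>\<^bsub>L\<^esub> y = \<phi> (a \<oplus>\<^bsub>K\<^esub> b)" using V by simp
    moreover have "a \<oplus>\<^bsub>K\<^esub> b \<in> carrier K.V" using ab K.val_ge_add by (simp add: K.mem_V)
    ultimately show "x \<oplus>\<^bsub>L\<^esub> y \<in> \<phi> ` carrier K.V" by blast
  next
    show "\<phi> p \<in> \<phi> ` carrier K" "\<phi> p \<noteq> \<zero>\<^bsub>L\<^esub>" "vF (\<phi> p) = 1" using p nz vF by auto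
  next
    obtain S where S: "finite S" "S \<subseteq> carrier K.V"
      "\<And>x. x \<in> carrier K.V \<Longrightarrow> \<exists>s\<in>S. \<exists>y\<in>carrier K.V. x = s \<oplus>\<^bsub>K\<^esub> p \<otimes>\<^bsub>K\<^esub> y"
      using K.valuation_ring_finite_mod[OF p] by blast
    have "\<exists>s\<in>\<phi> ` S. \<exists>y\<in>\<phi> ` carrier K.V. \<phi> a = s \<oplus>\<^bsub>L\<^esub> \<phi> p \<otimes>\<^bsub>L\<^esub> y" if a: "a \<in> carrier K.V" for a
    proof -
      obtain s y where sy: "s \<in> S" "y \<in> carrier K.V" "a = s \<oplus>\<^bsub>K\<^esub> p \<otimes>\<^bsub>K\<^esub> y" using S(3)[OF a] by blast
      then have "\<phi> a = \<phi> s \<oplus>\<^bsub>L\<^esub> \<phi> p \<otimes>\<^bsub>L\<^esub> \<phi> y" using V S(2) p(1) by auto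
      then show ?thesis using sy by blast
    qed
    then show "\<exists>S. finite S \<and> S \<subseteq> \<phi> ` carrier K.V \<and>
        (\<forall>x\<in>\<phi> ` carrier K.V. \<exists>s\<in>S. \<exists>y\<in>\<phi> ` carrier K.V. x = s \<oplus>\<^bsub>L\<^esub> \<phi> p \<otimes>\<^bsub>L\<^esub> y)"
      using S(1,2) by (intro exI[of _ "\<phi> ` S"]) blast
  next
    fix d assume "\<And>i::nat. d i \<in> \<phi> ` carrier K.V"
    then have "\<forall>i. \<exists>a. a \<in> carrier K.V \<and> d i = \<phi> a" by blast
    then obtain c where c: "\<And>i. c i \<in> carrier K.V" "\<And>i. d i = \<phi> (c i)" by metis
    let ?s = "rec_nat \<zero>\<^bsub>K\<^esub> (\<lambda>i s. s \<oplus>\<^bsub>K\<^esub> p [^]\<^bsub>K\<^esub> i \<otimes>\<^bsub>K\<^esub> c i)"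
    obtain a where a: "a \<in> carrier K.V" "\<And>m. \<exists>r\<in>carrier K.V. a = ?s m \<oplus>\<^bsub>K\<^esub> p [^]\<^bsub>K\<^esub> m \<otimes>\<^bsub>K\<^esub> r"
      using K.power_series_converges[OF p, of c, OF c(1)] by auto
    have "\<exists>r\<in>\<phi> ` carrier K.V. \<phi> a =
        rec_nat \<zero>\<^bsub>L\<^esub> (\<lambda>i s. s \<oplus>\<^bsub>L\<^esub> \<phi> p [^]\<^bsub>L\<^esub> i \<otimes>\<^bsub>L\<^esub> d i) m \<oplus>\<^bsub>L\<^esub> \<phi> p [^]\<^bsub>L\<^esub> m \<otimes>\<^bsub>L\<^esub> r" for m
    proof -
      obtain r where r: "r \<in> carrier K.V" "a = ?s m \<oplus>\<^bsub>K\<^esub> p [^]\<^bsub>K\<^esub> m \<otimes>\<^bsub>K\<^esub> r" using a(2) by blast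
      have "\<phi> a = \<phi> (?s m) \<oplus>\<^bsub>L\<^esub> \<phi> p [^]\<^bsub>L\<^esub> m \<otimes>\<^bsub>L\<^esub> \<phi> r"
        unfolding r(2) using partial_sum[of c m] c(1) V r(1) p(1) by simp
      then show ?thesis unfolding c(2) using partial_sum[of c m] c(1) V r(1) by auto
    qed
    then show "\<exists>y\<in>\<phi> ` carrier K.V. \<forall>m. \<exists>r\<in>\<phi> ` carrier K.V.
        y = rec_nat \<zero>\<^bsub>L\<^esub> (\<lambda>i s. s \<oplus>\<^bsub>L\<^esub> \<phi> p [^]\<^bsub>L\<^esub> i \<otimes>\<^bsub>L\<^esub> d i) m \<oplus>\<^bsub>L\<^esub> \<phi> p [^]\<^bsub>L\<^esub> m \<otimes>\<^bsub>L\<^esub> r"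
      using a(1) by blast
  next
    show "finite (carrier ?G)" by fact
    show "(\<lambda>x\<in>carrier L. x) \<in> carrier ?G" using G.one_closed by (simp add: Gal_group_simps(2))
    show "compose (carrier L) \<alpha> \<beta> \<in> carrier ?G" if "\<alpha> \<in> carrier ?G" "\<beta> \<in> carrier ?G" for \<alpha> \<beta>
      using G.m_closed[OF that] Gal_group_mult[OF that] by simp
    show "\<alpha> \<in> Bij (carrier L)" "\<alpha> \<in> ring_hom L L" if "\<alpha> \<in> carrier ?G" for \<alpha>
      using that by (auto simp: Gal_group_simps)
    show "\<alpha> x = x" if "\<alpha> \<in> carrier ?G" "x \<in> \<phi> ` carrier K" for \<alpha> x
      using that by (auto simp: Gal_group_simps)
    show "x \<in> \<phi> ` carrier K" if "x \<in> carrier L" "\<And>\<alpha>. \<alpha> \<in> carrier ?G \<Longrightarrow> \<alpha> x = x" for x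
      using ext that unfolding finite_galois_extension_def by blast
    have "L.finite_dimension (\<phi> ` carrier K) (carrier L)" using ext by (simp add: finite_galois_extension_def)
    then obtain us where "set us \<subseteq> carrier L" "L.Span (\<phi> ` carrier K) us = carrier L"
      using L.exists_base[OF sub] unfolding L.finite_dimension_def by blast
    then show "\<exists>us. set us \<subseteq> carrier L \<and> L.Span (\<phi> ` carrier K) us = carrier L" by blast
    \<comment> \<open>The order of the group is a power of \<open>l\<close>, nonzero in the field
      because \<open>l\<close> is.\<close>
    have "add_pow K (l ^ n) \<one>\<^bsub>K\<^esub> \<noteq> \<zero>\<^bsub>K\<^esub>" for n
      by (induction n) (auto simp: K.add_pow_one_mult K.integral_iff unit)
    then show "add_pow L (card (carrier ?G)) \<one>\<^bsub>L\<^esub> \<noteq> \<zero>\<^bsub>L\<^esub>" unfolding order nat using nz by simp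
  qed
  obtain u where u: "discrete_valuation L u" "finite (carrier (residue_field L u))"
    "\<And>\<alpha> x. \<lbrakk>\<alpha> \<in> carrier ?G; x \<in> carrier L\<rbrakk> \<Longrightarrow> u (\<alpha> x) = u x"
    "\<And>a. \<lbrakk>a \<in> \<phi> ` carrier K; a \<noteq> \<zero>\<^bsub>L\<^esub>; vF a = 0\<rbrakk> \<Longrightarrow> u a = 0"
    using E.invariant_valuation_exists by blast
  interpret U: discrete_valuation L u by fact
  have lu: "add_pow L l \<one>\<^bsub>L\<^esub> \<noteq> \<zero>\<^bsub>L\<^esub>" "u (add_pow L l \<one>\<^bsub>L\<^esub>) = 0"
    unfolding nat using nz u(4) vF unit by auto
  have auto: "U.val_auto \<alpha>" if "\<alpha> \<in> carrier ?G" for \<alpha>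
    unfolding U.val_auto_def using E.hom_G[OF that] E.G_hom(6)[OF that] u(3)[OF that] by simp
  have pow: "(\<alpha> ^^ l) x = x" if "\<alpha> \<in> carrier ?G" "x \<in> carrier L" for \<alpha> x
    using Gal_group_pow[OF G.group_axioms that, of l] exponent[OF that(1)] that(2) by (simp add: Gal_group_simps)
  show ?thesis
  proof (rule G.group_comm_groupI)
    fix \<alpha> \<beta> assume ab: "\<alpha> \<in> carrier ?G" "\<beta> \<in> carrier ?G"
    let ?ab = "\<alpha> \<otimes>\<^bsub>?G\<^esub> \<beta>" and ?ba = "\<beta> \<otimes>\<^bsub>?G\<^esub> \<alpha>"
    \<comment> \<open>The commutator in the shape
      \<open>\<alpha> \<beta> = c \<beta> \<alpha>\<close> that \<open>commutator_trivial\<close>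
      expects.\<close>
    define c where "c = ?ab \<otimes>\<^bsub>?G\<^esub> inv\<^bsub>?G\<^esub> ?ba"
    have c: "c \<in> carrier ?G" using ab by (simp add: c_def)
    have c_eq: "c \<otimes>\<^bsub>?G\<^esub> ?ba = ?ab" using ab by (simp add: c_def G.m_assoc)
    have "\<alpha> (\<beta> x) = c (\<beta> (\<alpha> x))" if "x \<in> carrier L" for x
      using fun_cong[OF c_eq, of x] that ab c Gal_group_mult[OF c G.m_closed[OF ab(2,1)]]
      by (simp add: Gal_group_mult compose_eq E.G_hom)
    then have "c x = x" if "x \<in> carrier L" for x
      using U.commutator_trivial[OF u(2) l lu auto[OF ab(1)] auto[OF ab(2)] auto[OF c]
        pow[OF ab(1)] pow[OF ab(2)] pow[OF c]] that by blast
    then have "c = \<one>\<^bsub>?G\<^esub>"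
      using E.G_ext[OF c E.id_G] by (simp add: Gal_group_simps)
    then show "?ab = ?ba" using c_eq ab by simp
  qed
qed

text \<open>Order and exponent pass from \<open>H\<close> to the Galois group, which is then
  commutative; commutativity returns to \<open>H\<close> along the isomorphism, a
  contradiction.\<close>

theorem corollary8p8:
  fixes l p :: nat
    and H :: "('c, 'h) monoid_scheme"
    and K :: "('a, 'm) ring_scheme" and v :: "'a \<Rightarrow> int"
  assumes "Factorial_Ring.prime l" and "l \<noteq> 2"
    and "heisenberg_group l H"
    and "local_field K v"
    and "ring_characteristic (residue_field K v) = p" and "p \<noteq> l"
  shows "\<not> (\<exists>(L :: ('b, 'n) ring_scheme) \<phi>.
              finite_galois_extension K L \<phi> \<and> Gal_group K L \<phi> \<cong> H)"
proof
  assume "\<exists>(L :: ('b, 'n) ring_scheme) \<phi>. finite_galois_extension K L \<phi> \<and> Gal_group K L \<phi> \<cong> H"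
  then obtain L :: "('b, 'n) ring_scheme" and \<phi> h where
    ext: "finite_galois_extension K L \<phi>" and h: "h \<in> iso (Gal_group K L \<phi>) H"
    by (auto simp: is_iso_def)
  let ?G = "Gal_group K L \<phi>"
  interpret K: local_field K v by fact
  note H = heisenberg_group_facts[OF assms(3) prime_gt_0_nat[OF assms(1)]]
  interpret H: group H by (rule H(1))
  have "ring L" "\<phi> \<in> carrier K \<rightarrow> carrier L"
    using ext by (auto simp: finite_galois_extension_def field_def domain_def cring_def ring_hom_def)
  then interpret G: group ?G by (rule group_Gal_group)
  interpret h: group_hom ?G H h
    using h by unfold_locales (simp add: iso_def)
  have bij: "bij_betw h (carrier ?G) (carrier H)" using h by (simp add: iso_def)
  then have inj: "inj_on h (carrier ?G)" by (simp add: bij_betw_def)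
  have "comm_group ?G"
  proof (rule galois_group_exponent_prime_comm[OF assms(1,2,4) ext])
    show "add_pow K l \<one>\<^bsub>K\<^esub> \<noteq> \<zero>\<^bsub>K\<^esub>" "v (add_pow K l \<one>\<^bsub>K\<^esub>) = 0"
      using K.val_nat_eq_zero[OF K.finite_residue_field assms(5,1,6)] by auto
    show "card (carrier ?G) = l ^ 3"
      using bij_betw_same_card[OF bij] assms(3) by (simp add: heisenberg_group_def order_def)
    fix \<alpha> assume \<alpha>: "\<alpha> \<in> carrier ?G"
    \<comment> \<open>The relation holds in \<open>H\<close> and is pulled back by injectivity of
      \<open>h\<close>.\<close>
    then have "h (\<alpha> [^]\<^bsub>?G\<^esub> l) = h \<one>\<^bsub>?G\<^esub>" by (simp add: h.hom_nat_pow H(3))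
    then show "\<alpha> [^]\<^bsub>?G\<^esub> l = \<one>\<^bsub>?G\<^esub>" using inj_onD[OF inj] \<alpha> by blast
  qed
  then interpret G: comm_group ?G .
  obtain x y where "x \<in> carrier H" "y \<in> carrier H" and ne: "x \<otimes>\<^bsub>H\<^esub> y \<noteq> y \<otimes>\<^bsub>H\<^esub> x" using H(4) by blast
  then have "x \<in> h ` carrier ?G" "y \<in> h ` carrier ?G" using bij by (auto simp: bij_betw_def)
  then obtain \<alpha> \<beta> where "\<alpha> \<in> carrier ?G" "x = h \<alpha>" "\<beta> \<in> carrier ?G" "y = h \<beta>" by blast
  then show False using ne G.m_comm[of \<alpha> \<beta>] h.hom_mult[of \<alpha> \<beta>] h.hom_mult[of \<beta> \<alpha>] by simp
qed

end
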